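(* Let $d\in\mathbb{Q}^\ast$ be such that $16d$ is $6$th-power-free, and let $E^d:y^2=x^3+16d$. Then \begin{itemize} \item $\mathbb{Q}(E^d[3])=\mathbb{Q}(\zeta_3,\sqrt[6]{d})$, and \item $\mathbb{Q}(E^d[9])=\mathbb{Q}(\zeta_3,\sqrt[6]{d},\sqrt[3]{3},\zeta_9+\zeta_9^{-1})$. \end{itemize} In particular, \begin{enumerate} \item[1.] $[\mathbb{Q}(E^d[3]):\mathbb{Q}]=2$ if and only if $d\in\{1,-27\}$; \item[2.] $[\mathbb{Q}(E^d[3]):\mathbb{Q}]=4$ if and only if $d=t^3$ for some $t\in\mathbb{Q}^\ast$, $t\neq1,-3$; \item[3.] $[\mathbb{Q}(E^d[3]):\mathbb{Q}]=6$ if and only if $d=t^2,-3t^2$ for some $t\in\mathbb{Q}^\ast\setminus\{\pm1,\pm3\}$; or \item[4.] $[\mathbb{Q}(E^d[3]):\mathbb{Q}]=12$ otherwise; \end{enumerate} and \begin{enumerate} \item[5.] $[\mathbb{Q}(E^d[9]):\mathbb{Q}]=18$ if and only if $d\in\{1,-3,9,-27,81,-243\}$; \item[6.] $[\mathbb{Q}(E^d[9]):\mathbb{Q}]=36$ if and only if $d=t^3$ or $9t^3$ for some $t\in\mathbb{Q}^\ast$, $t\neq1,-3$, or $d=3t^3$ for some $t\in\mathbb{Q}^\ast$, $t\neq-1,3$; \item[7.] $[\mathbb{Q}(E^d[9]):\mathbb{Q}]=54$ if and only if $d=t^2$ or $-3t^2$ for $t\in\mathbb{Q}^\ast\setminus\{\pm1,\pm3,\pm9\}$;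 or \item[8.] $[\mathbb{Q}(E^d[9]):\mathbb{Q}]=108$ otherwise. \end{enumerate}
   Context: For an elliptic curve $E/\mathbb{Q}$ and an integer $n\geq 1$, $\mathbb{Q}(E[n])$ is the $n$-division field, i.e. the field generated over $\mathbb{Q}$ by the coordinates of the $n$-torsion points of $E(\overline{\mathbb{Q}})$; $\zeta_n$ is a primitive $n$th root of unity.
   Formalization: In item 3 (hence in "otherwise" of item 4) the exclusions are respective: d=t^2 with t≠±1, or d=-3t^2 with t≠±3; excluding ±1,±3 for both forms is false, since d=9 and d=-3 give degree 6. "16d is 6th-power-free" means 16d is a 6th-power-free integer. *)

theory Defs
  imports "HOL-Algebra.Algebra" "HOL-Algebra.Algebraic_Closure_Type" "HOL-Computational_Algebra.Computational_Algebra" Complex_Main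
begin

text \<open>
  For \<open>k = 2\<close> this is the library's \<^const>\<open>squarefree\<close>. A rational number is called
  \<open>k\<close>-th-power-free if it is an integer with this property.
\<close>

definition power_free :: "nat \<Rightarrow> 'a::comm_monoid_mult \<Rightarrow> bool" where
  "power_free k n \<longleftrightarrow> (\<forall>x. x ^ k dvd n \<longrightarrow> x dvd 1)"

definition rat_power_free :: "nat \<Rightarrow> rat \<Rightarrow> bool" where
  "rat_power_free k q \<longleftrightarrow> (\<exists>m::int. q = of_int m \<and> power_free k m)"

definition primitive_root_of_unity :: "nat \<Rightarrow> 'a::monoid_mult \<Rightarrow> bool" where
  "primitive_root_of_unity n z \<longleftrightarrow> n > 0 \<and> z ^ n = 1 \<and> (\<forall>k. 0 < k \<and> k < n \<longrightarrow> z ^ k \<noteq> 1)"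

text \<open>
  The curve \<open>y\<^sup>2 = x\<^sup>3 + a x + b\<close> and its chord-and-tangent addition (\<open>b\<close> does not enter the
  formulas). All definitions are meant for \<open>4 a\<^sup>3 + 27 b\<^sup>2 \<noteq> 0\<close> and for points on the curve;
  in particular, for points with \<open>x\<^sub>1 = x\<^sub>2\<close> one has \<open>y\<^sub>2 = y\<^sub>1\<close> or \<open>y\<^sub>2 = - y\<^sub>1\<close>.
\<close>

datatype 'a point = Infinity | Affine 'a 'a

definition curve_points :: "'a::field set \<Rightarrow> 'a \<Rightarrow> 'a \<Rightarrow> 'a point set" where
  "curve_points L a b =
     insert Infinity {Affine x y | x y. x \<in> L \<and> y \<in> L \<and> y ^ 2 = x ^ 3 + a * x + b}"

fun point_add :: "'a::field \<Rightarrow> 'a point \<Rightarrow> 'a point \<Rightarrow> 'a point" where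
  "point_add a Infinity Q = Q"
| "point_add a P Infinity = P"
| "point_add a (Affine x1 y1) (Affine x2 y2) =
     (if x1 = x2 \<and> y1 = - y2 then Infinity
      else let m = (if x1 = x2 then (3 * x1 ^ 2 + a) / (2 * y1) else (y2 - y1) / (x2 - x1));
               x3 = m ^ 2 - x1 - x2
           in Affine x3 (m * (x1 - x3) - y1))"

definition point_mult :: "'a::field \<Rightarrow> nat \<Rightarrow> 'a point \<Rightarrow> 'a point" where
  "point_mult a n P = (point_add a P ^^ n) Infinity"

definition torsion_points :: "'a::field set \<Rightarrow> 'a \<Rightarrow> 'a \<Rightarrow> nat \<Rightarrow> 'a point set" where
  "torsion_points L a b n = {P \<in> curve_points L a b. point_mult a n P = Infinity}"

definition coordinates :: "'a point set \<Rightarrow> 'a set" where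
  "coordinates A = {z. \<exists>x y. Affine x y \<in> A \<and> (z = x \<or> z = y)}"

text \<open>
  The algebraic closure of \<open>\<rat>\<close> is taken inside \<open>\<complex>\<close>; number fields are subfields of \<open>\<complex>\<close>.
\<close>

abbreviation CC :: "complex ring" where
  "CC \<equiv> ring_of_type_algebra"

abbreviation Qbar :: "complex set" where
  "Qbar \<equiv> {z. algebraic z}"

definition adjoin_rat :: "complex set \<Rightarrow> complex set" where
  "adjoin_rat S = generate_field CC (\<rat> \<union> S)"

definition division_field :: "rat \<Rightarrow> rat \<Rightarrow> nat \<Rightarrow> complex set" where
  "division_field a b n =
     adjoin_rat (coordinates (torsion_points Qbar (of_rat a) (of_rat b) n))"

text \<open>
  \<open>[K : \<rat>] = n\<close>, as a relation: \<^const>\<open>ring.dim\<close> would be unspecified for \<open>K\<close> of infinite degree.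
\<close>

abbreviation degree_over_rat :: "complex set \<Rightarrow> nat \<Rightarrow> bool" where
  "degree_over_rat K n \<equiv> ring.dimension CC n \<rat> K"

text \<open>The division fields of \<open>E\<^sup>d : y\<^sup>2 = x\<^sup>3 + 16 d\<close>.\<close>

abbreviation Ed_division_field :: "rat \<Rightarrow> nat \<Rightarrow> complex set" where
  "Ed_division_field d n \<equiv> division_field 0 (16 * d) n"

end

theory Submission
  imports Defs
begin

text \<open>
  Let \<open>s\<^sup>6 = d\<close>. Scaling by \<open>2 s\<close> identifies \<open>y\<^sup>2 = x\<^sup>3 + 16 d\<close> with
  \<open>y\<^sup>2 = x\<^sup>3 + 1/4\<close>, because \<open>(2 s)\<^sup>6 / 4 = 16 d\<close>. On the latter curve the nonzero
  3-torsion points have \<open>x = 0\<close> or \<open>x\<^sup>3 = -1\<close>; scaled back, their coordinates generate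
  \<open>\<rat>(\<omega>, s)\<close> with \<open>\<omega> = \<zeta>\<^sub>3\<close>. As \<open>\<omega>\<close> and \<open>s\<close> thus lie in both division fields, the
  9-division field is \<open>\<rat>(\<omega>, s)\<close> with the coordinates of the 9-torsion points of
  \<open>y\<^sup>2 = x\<^sup>3 + 1/4\<close> adjoined.

  The 9-torsion is computed without the associativity of the group law. The multiples of \<open>P\<close>
  are the orbit of the point at infinity under \<open>Q \<mapsto> P + Q\<close>, and if that orbit has exact period
  9 then no two of its points coincide. So \<open>2P\<close>, \<open>3P\<close>, \<open>4P\<close> are given by the generic formulas,
  while the other half of the orbit consists of their negatives. The only remaining condition is
  \<open>P + 4P = -4P\<close>, which is polynomial in \<open>Z = x\<^sup>3\<close>
  (\<open>nine_torsion_necessary\<close>, \<open>nine_torsion_sufficient\<close>). The polynomial has a factor of degree 3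
  and one of degree 9, which reflect the endomorphism \<open>\<surd>-3\<close>, given on \<open>x\<close>-coordinates by
  \<open>x \<mapsto> - (x\<^sup>3 + 1) / (3 x\<^sup>2)\<close>: it sends the roots of the first factor to \<open>x\<^sup>3 = -1\<close>, and those of
  the second to roots of the first. The first factor is solved by
  \<open>1 / (\<zeta> + \<zeta>\<^sup>-\<^sup>1)\<close> with \<open>\<zeta>\<close> a primitive 9th root of unity, the second by Cardano's formula, whose
  radicals turn out to be \<open>\<alpha> c\<close> and \<open>\<beta> c\<^sup>2\<close> with \<open>c\<^sup>3 = 3\<close> and \<open>\<alpha>, \<beta> \<in> \<rat>(\<zeta> + \<zeta>\<^sup>-\<^sup>1)\<close>
  (\<open>r_cubic_factor\<close>). This gives both inclusions for the 9-division field.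

  The degrees are computed in towers: first \<open>\<omega>\<close> and \<open>\<surd>d\<close>, then the cube roots of \<open>3\<close>, \<open>\<omega>\<close> and
  \<open>d\<close>. Each cube root contributes a factor 1 or 3, decided by an elementary form of Kummer theory
  (\<open>cube_in_adjoin_cbrt\<close>, \<open>cube_in_adjoin_sqrt\<close>) and by norms from \<open>\<rat>(\<omega>)\<close> to \<open>\<rat>\<close>. So the degrees are
  determined by whether \<open>d\<close> is a square in \<open>\<rat>(\<omega>)\<close>, and whether it is a rational cube (for
  9-torsion: up to a power of 3). If both hold then \<open>d\<close> is a sixth power times one of six integers,
  and as \<open>16 d\<close> is sixth-power-free it equals that integer.
\<close>

section \<open>Subfields of the complex numbers\<close>

lemma CC_simps [simp]:
  "carrier CC = UNIV" "x \<oplus>\<^bsub>CC\<^esub> y = x + y" "x \<otimes>\<^bsub>CC\<^esub> y = x * y" "\<zero>\<^bsub>CC\<^esub> = 0" "\<one>\<^bsub>CC\<^esub> = 1"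
  by (simp_all add: ring_of_type_algebra_def)

lemma field_CC: "field CC"
  by (rule field_from_type_algebra)

interpretation CC: cring CC
  by (rule cring_from_type_algebra)

lemma CC_a_inv [simp]: "\<ominus>\<^bsub>CC\<^esub> x = - x"
  by (rule CC.minus_equality) auto

lemma CC_m_inv [simp]: "x \<noteq> 0 \<Longrightarrow> inv\<^bsub>CC\<^esub> x = inverse x"
  by (rule CC.comm_inv_char) auto

lemma subfield_CC_I:
  assumes "1 \<in> K" "\<And>x y. x \<in> K \<Longrightarrow> y \<in> K \<Longrightarrow> x + y \<in> K" "\<And>x y. x \<in> K \<Longrightarrow> y \<in> K \<Longrightarrow> x * y \<in> K"
    "\<And>x. x \<in> K \<Longrightarrow> - x \<in> K" "\<And>x. x \<in> K \<Longrightarrow> x \<noteq> 0 \<Longrightarrow> inverse x \<in> K"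
  shows "subfield K CC"
proof (rule field.subfieldI'[OF field_CC])
  show "subring K CC"
    by (rule CC.subringI) (use assms in auto)
  show "\<And>k. k \<in> K - {\<zero>\<^bsub>CC\<^esub>} \<Longrightarrow> inv\<^bsub>CC\<^esub> k \<in> K"
    using assms by auto
qed

context
  fixes K assumes K: "subfield K CC"
begin

lemma subfield_1: "1 \<in> K"
  and subfield_0: "0 \<in> K"
  and subfield_add: "x \<in> K \<Longrightarrow> y \<in> K \<Longrightarrow> x + y \<in> K"
  and subfield_mult: "x \<in> K \<Longrightarrow> y \<in> K \<Longrightarrow> x * y \<in> K"
  and subfield_uminus: "x \<in> K \<Longrightarrow> - x \<in> K"
  using subringE[OF subfieldE(1)[OF K]] by simp_all

lemma subfield_inverse: "x \<in> K \<Longrightarrow> inverse x \<in> K"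
  using CC.subfield_m_inv(1)[OF K, of x] subfield_0 by (cases "x = 0") auto

lemma subfield_diff: "x \<in> K \<Longrightarrow> y \<in> K \<Longrightarrow> x - y \<in> K"
  using subfield_add[of x "- y"] subfield_uminus by simp

lemma subfield_divide: "x \<in> K \<Longrightarrow> y \<in> K \<Longrightarrow> x / y \<in> K"
  by (simp add: divide_inverse subfield_mult subfield_inverse)

lemma subfield_power: "x \<in> K \<Longrightarrow> x ^ n \<in> K"
  by (induction n) (auto intro: subfield_1 subfield_mult)

lemma subfield_of_nat: "of_nat n \<in> K"
  by (induction n) (auto intro: subfield_0 subfield_1 subfield_add)

lemma subfield_numeral: "numeral n \<in> K"
  using subfield_of_nat[of "numeral n"] by simp

lemma subfield_of_int: "of_int n \<in> K"
  by (cases n) (auto intro: subfield_of_nat subfield_uminus subfield_diff subfield_1)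

lemma subfield_Rats: "\<rat> \<subseteq> K"
proof
  fix x :: complex assume "x \<in> \<rat>"
  then obtain a b where "x = of_int a / of_int b"
    by (elim Rats_cases') auto
  then show "x \<in> K" by (simp add: subfield_divide subfield_of_int)
qed

lemma subfield_of_rat: "of_rat q \<in> K"
  using subfield_Rats by auto

lemmas subfield_closed = subfield_1 subfield_0 subfield_add subfield_mult subfield_uminus
  subfield_inverse subfield_diff subfield_divide subfield_power subfield_numeral subfield_of_rat

end

lemma subfield_rat: "subfield \<rat> CC"
  by (rule subfield_CC_I) auto

section \<open>Adjunction\<close>

text \<open>The subfield of \<open>\<complex>\<close> generated by \<open>K\<close> and \<open>x\<close>.\<close>
definition adjoin :: "complex set \<Rightarrow> complex \<Rightarrow> complex set" where
  "adjoin K x = generate_field CC (insert x K)"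

lemma subfield_adjoin: "subfield (adjoin K x) CC"
  unfolding adjoin_def by (rule field.generate_field_is_subfield[OF field_CC]) simp

lemma subset_adjoin: "K \<subseteq> adjoin K x"
  and mem_adjoin: "x \<in> adjoin K x"
  unfolding adjoin_def by (auto intro: generate_field.incl)

lemma adjoin_least: "subfield L CC \<Longrightarrow> K \<subseteq> L \<Longrightarrow> x \<in> L \<Longrightarrow> adjoin K x \<subseteq> L"
  unfolding adjoin_def by (rule field.generate_field_min_subfield1[OF field_CC]) auto

lemma adjoin_trivial: "subfield K CC \<Longrightarrow> x \<in> K \<Longrightarrow> adjoin K x = K"
  by (intro equalityI adjoin_least subset_adjoin) auto

lemma subfield_adjoin_rat: "subfield (adjoin_rat S) CC"
  unfolding adjoin_rat_def by (rule field.generate_field_is_subfield[OF field_CC]) simp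

lemma adjoin_rat_least: "subfield L CC \<Longrightarrow> S \<subseteq> L \<Longrightarrow> adjoin_rat S \<subseteq> L"
  unfolding adjoin_rat_def
  by (rule field.generate_field_min_subfield1[OF field_CC]) (auto dest: subfield_Rats[THEN subsetD])

lemma subset_adjoin_rat: "S \<subseteq> adjoin_rat S"
  unfolding adjoin_rat_def by (auto intro: generate_field.incl)

lemma adjoin_rat_eqI: "S \<subseteq> adjoin_rat T \<Longrightarrow> T \<subseteq> adjoin_rat S \<Longrightarrow> adjoin_rat S = adjoin_rat T"
  by (intro equalityI adjoin_rat_least subfield_adjoin_rat)

section \<open>Extensions of degree 2 and 3\<close>

lemma dimension_self: "subfield K CC \<Longrightarrow> ring.dimension CC 1 K K"
  by (rule CC.dimension_one)

lemma line_extension_iff: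
  "u \<in> ring.line_extension CC K a E \<longleftrightarrow> (\<exists>k\<in>K. \<exists>v\<in>E. u = k * a + v)"
  by (simp add: CC.line_extension_mem_iff)

lemma adjoin_sqrt_eq:
  assumes K: "subfield K CC" and x: "x ^ 2 \<in> K"
  shows "adjoin K x = {p + q * x | p q. p \<in> K \<and> q \<in> K}" (is "_ = ?E")
proof (cases "x \<in> K")
  case True
  have "u = u + 0 * x" for u by simp
  then have "K \<subseteq> ?E" using subfield_0[OF K] by blast
  moreover have "?E \<subseteq> K" using True by (auto intro: subfield_closed[OF K])
  ultimately show ?thesis using adjoin_trivial[OF K True] by simp
next
  case False
  note cl = subfield_closed[OF K]
  have memI: "u \<in> ?E" if "u = p + q * x" "p \<in> K" "q \<in> K" for u p q
    using that by blast
  show ?thesis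
  proof (rule equalityI)
    show "?E \<subseteq> adjoin K x"
      using subset_adjoin[of K x] mem_adjoin[of x K]
      by (auto intro!: subfield_closed[OF subfield_adjoin[of K x]])
    have "subfield ?E CC"
    proof (rule subfield_CC_I)
      show "1 \<in> ?E" by (rule memI[of _ 1 0]) (auto intro: cl)
    next
      fix u v assume "u \<in> ?E" "v \<in> ?E"
      then obtain p q r s where e: "u = p + q * x" "p \<in> K" "q \<in> K" "v = r + s * x" "r \<in> K" "s \<in> K"
        by blast
      show "u + v \<in> ?E"
        by (rule memI[of _ "p + r" "q + s"]) (use e in \<open>auto intro: cl simp: algebra_simps\<close>)
      show "u * v \<in> ?E"
        by (rule memI[of _ "p * r + q * s * x ^ 2" "p * s + q * r"])
           (use e x in \<open>auto intro!: cl simp: algebra_simps power2_eq_square\<close>)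
    next
      fix u assume "u \<in> ?E"
      then obtain p q where e: "u = p + q * x" "p \<in> K" "q \<in> K"
        by blast
      show "- u \<in> ?E"
        by (rule memI[of _ "- p" "- q"]) (use e in \<open>auto intro: cl simp: algebra_simps\<close>)
      assume "u \<noteq> 0"
      \<comment> \<open>The norm of \<open>u\<close>.\<close>
    define N where "N = p ^ 2 - q ^ 2 * x ^ 2"
      have N: "N = u * (p - q * x)"
        by (simp add: N_def e algebra_simps power2_eq_square)
      have "p - q * x \<noteq> 0"
      proof
        assume *: "p - q * x = 0"
        then have "q = 0"
          using e False cl(8)[of p q] by (metis nonzero_mult_div_cancel_left eq_iff_diff_eq_0)
        then show False using * \<open>u \<noteq> 0\<close> e by auto
      qed
      then have "N \<noteq> 0" using N \<open>u \<noteq> 0\<close> by simp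
      then have "inverse u = (p - q * x) / N"
        unfolding N using \<open>u \<noteq> 0\<close> \<open>p - q * x \<noteq> 0\<close> by (simp add: inverse_eq_divide)
      also have "\<dots> = p / N + (- q / N) * x"
        by (simp add: diff_divide_distrib)
      finally have "inverse u = p / N + (- q / N) * x" .
      moreover have "N \<in> K" unfolding N_def using e x by (auto intro!: cl)
      ultimately show "inverse u \<in> ?E"
        using e by (intro memI[of _ "p / N" "- q / N"]) (auto intro!: cl)
    qed
    moreover have "K \<subseteq> ?E"
    proof
      fix u assume "u \<in> K"
      then show "u \<in> ?E" by (intro memI[of u u 0]) (auto intro: cl)
    qed
    moreover have "x \<in> ?E" by (rule memI[of x 0 1]) (auto intro: cl)
    ultimately show "adjoin K x \<subseteq> ?E" by (intro adjoin_least)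
  qed
qed

lemma dimension_adjoin_sqrt:
  assumes K: "subfield K CC" and x: "x ^ 2 \<in> K" "x \<notin> K"
  shows "ring.dimension CC 2 K (adjoin K x)"
proof -
  have "ring.dimension CC (Suc 1) K (ring.line_extension CC K x K)"
    by (rule CC.Suc_dim) (use x dimension_self[OF K] in auto)
  moreover have "ring.line_extension CC K x K = adjoin K x"
    unfolding adjoin_sqrt_eq[OF K x(1)] set_eq_iff line_extension_iff by (auto simp: add.commute)
  ultimately show ?thesis by (simp add: numeral_2_eq_2)
qed

text \<open>
  In this context \<open>x\<close> is a cube root of an element of \<open>K\<close> that is not a cube in \<open>K\<close>.
\<close>
context
  fixes K x assumes K: "subfield K CC" and x3: "x ^ 3 \<in> K" and noncube: "\<And>y. y \<in> K \<Longrightarrow> y ^ 3 \<noteq> x ^ 3"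
begin

text \<open>
  The common core of the linear independence of \<open>1, x, x\<^sup>2\<close> and of the nonvanishing of the norm:
  the two relations give \<open>q\<^sup>3 = x\<^sup>3 r\<^sup>3\<close>.
\<close>
lemma cubic_eq_zero:
  assumes "p \<in> K" "q \<in> K" "r \<in> K" "q ^ 2 = r * p" "q * p = x ^ 3 * r ^ 2"
  shows "q = 0 \<and> r = 0"
proof -
  have "q ^ 3 = q * (r * p)" using assms(4) by (simp add: power3_eq_cube power2_eq_square)
  also have "\<dots> = r * (x ^ 3 * r ^ 2)" using assms(5) by simp
  finally have eq: "q ^ 3 = x ^ 3 * r ^ 3" by (simp add: power3_eq_cube power2_eq_square)
  have "r = 0"
  proof (rule ccontr)
    assume r: "r \<noteq> 0"
    then have "(q / r) ^ 3 = x ^ 3" using eq by (simp add: power_divide)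
    then show False using noncube subfield_divide[OF K assms(2,3)] by blast
  qed
  moreover from this eq have "q = 0" by simp
  ultimately show ?thesis by simp
qed

lemma cube_root_notin: "x \<notin> K"
  using noncube by blast

lemma cubic_independent:
  assumes mem: "p \<in> K" "q \<in> K" "r \<in> K" and eq: "p + q * x + r * x ^ 2 = 0"
  shows "p = 0 \<and> q = 0 \<and> r = 0"
proof -
  have "(r * p - q ^ 2) * x = q * p - x ^ 3 * r ^ 2"
    using eq by Groebner_Basis.algebra
  moreover have "r * p - q ^ 2 \<in> K" "q * p - x ^ 3 * r ^ 2 \<in> K"
    using mem x3 by (auto intro!: subfield_closed[OF K])
  ultimately have "r * p - q ^ 2 = 0"
    using cube_root_notin subfield_divide[OF K]
    by (metis nonzero_mult_div_cancel_left)
  with \<open>_ = q * p - x ^ 3 * r ^ 2\<close> have "q ^ 2 = r * p" "q * p = x ^ 3 * r ^ 2" by auto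
  from cubic_eq_zero[OF mem this] eq show ?thesis by auto
qed

lemma adjoin_cbrt_eq:
  "adjoin K x = {p + q * x + r * x ^ 2 | p q r. p \<in> K \<and> q \<in> K \<and> r \<in> K}" (is "_ = ?E")
proof (rule equalityI)
  note cl = subfield_closed[OF K]
  have memI: "u \<in> ?E" if "u = p + q * x + r * x ^ 2" "p \<in> K" "q \<in> K" "r \<in> K" for u p q r
    using that by blast
  show "?E \<subseteq> adjoin K x"
    using subset_adjoin[of K x] mem_adjoin[of x K]
    by (auto intro!: subfield_closed[OF subfield_adjoin[of K x]])
  have "subfield ?E CC"
  proof (rule subfield_CC_I)
    show "1 \<in> ?E" by (rule memI[of _ 1 0 0]) (auto intro: cl)
  next
    fix u v assume "u \<in> ?E" "v \<in> ?E"
    then obtain p q r p' q' r' where e: "u = p + q * x + r * x ^ 2" "p \<in> K" "q \<in> K" "r \<in> K"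
      "v = p' + q' * x + r' * x ^ 2" "p' \<in> K" "q' \<in> K" "r' \<in> K"
      by blast
    show "u + v \<in> ?E"
      by (rule memI[of _ "p + p'" "q + q'" "r + r'"]) (use e in \<open>auto intro: cl simp: algebra_simps\<close>)
    show "u * v \<in> ?E"
    proof (rule memI[of _ "p * p' + (q * r' + r * q') * x ^ 3" "p * q' + q * p' + r * r' * x ^ 3"
            "p * r' + q * q' + r * p'"])
      show "u * v = p * p' + (q * r' + r * q') * x ^ 3 + (p * q' + q * p' + r * r' * x ^ 3) * x
          + (p * r' + q * q' + r * p') * x ^ 2"
        unfolding e by Groebner_Basis.algebra
    qed (use e x3 in \<open>auto intro!: cl\<close>)
  next
    fix u assume "u \<in> ?E"
    then obtain p q r where e: "u = p + q * x + r * x ^ 2" "p \<in> K" "q \<in> K" "r \<in> K"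
      by blast
    show "- u \<in> ?E"
      by (rule memI[of _ "- p" "- q" "- r"]) (use e in \<open>auto intro: cl simp: algebra_simps\<close>)
    assume "u \<noteq> 0"
    \<comment> \<open>\<open>P + Q x + R x\<^sup>2\<close> is the product of the two other conjugates of \<open>u\<close>, and \<open>N\<close> is the norm.\<close>
    define P where "P = p ^ 2 - x ^ 3 * (q * r)"
    define Q where "Q = x ^ 3 * r ^ 2 - p * q"
    define R where "R = q ^ 2 - p * r"
    define N where "N = p ^ 3 + x ^ 3 * q ^ 3 + x ^ 3 * x ^ 3 * r ^ 3 - 3 * x ^ 3 * (p * q * r)"
    have N: "N = u * (P + Q * x + R * x ^ 2)"
      unfolding N_def P_def Q_def R_def e by Groebner_Basis.algebra
    define a where "a = x ^ 3"
    have mem: "P \<in> K" "Q \<in> K" "R \<in> K" "N \<in> K"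
      unfolding P_def Q_def R_def N_def a_def[symmetric] using e x3[folded a_def] by (auto intro!: cl)
    have "P + Q * x + R * x ^ 2 \<noteq> 0"
    proof
      assume "P + Q * x + R * x ^ 2 = 0"
      from cubic_independent[OF mem(1-3) this] have "P = 0" "Q = 0" "R = 0" by auto
      with cubic_eq_zero[OF e(2-4)] have "q = 0" "r = 0"
        by (auto simp: Q_def R_def algebra_simps)
      with \<open>P = 0\<close> have "p = 0" by (simp add: P_def)
      with \<open>q = 0\<close> \<open>r = 0\<close> \<open>u \<noteq> 0\<close> e show False by simp
    qed
    then have "N \<noteq> 0" using N \<open>u \<noteq> 0\<close> by simp
    then have "inverse u = (P + Q * x + R * x ^ 2) / N"
      using N \<open>u \<noteq> 0\<close> by (simp add: field_simps)
    also have "\<dots> = P / N + (Q / N) * x + (R / N) * x ^ 2"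
      by (simp add: add_divide_distrib)
    finally show "inverse u \<in> ?E"
      using mem by (intro memI[of _ "P / N" "Q / N" "R / N"]) (auto intro!: cl)
  qed
  moreover have "K \<subseteq> ?E"
  proof
    fix u assume "u \<in> K"
    then show "u \<in> ?E" by (intro memI[of u u 0 0]) (auto intro: cl)
  qed
  moreover have "x \<in> ?E" by (rule memI[of x 0 1 0]) (auto intro: cl)
  ultimately show "adjoin K x \<subseteq> ?E" by (intro adjoin_least)
qed

lemma dimension_adjoin_cbrt: "ring.dimension CC 3 K (adjoin K x)"
proof -
  note cl = subfield_closed[OF K]
  define E where "E = ring.line_extension CC K x K"
  have "ring.dimension CC (Suc 1) K E"
    unfolding E_def by (rule CC.Suc_dim) (use cube_root_notin dimension_self[OF K] in auto)
  moreover have "x ^ 2 \<notin> E"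
  proof
    assume "x ^ 2 \<in> E"
    then obtain q p where "p \<in> K" "q \<in> K" "x ^ 2 = q * x + p"
      unfolding E_def line_extension_iff by blast
    then have "(- p) + (- q) * x + 1 * x ^ 2 = 0" by simp
    then have "(1::complex) = 0"
      using cubic_independent[of "- p" "- q" 1] \<open>p \<in> K\<close> \<open>q \<in> K\<close> by (auto intro: cl)
    then show False by simp
  qed
  ultimately have "ring.dimension CC (Suc (Suc 1)) K (ring.line_extension CC K (x ^ 2) E)"
    by (intro CC.Suc_dim) auto
  moreover have "ring.line_extension CC K (x ^ 2) E = adjoin K x"
  proof -
    have "u \<in> ring.line_extension CC K (x ^ 2) E \<longleftrightarrow>
        (\<exists>r\<in>K. \<exists>q\<in>K. \<exists>p\<in>K. u = r * x ^ 2 + (q * x + p))" for u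
      unfolding E_def line_extension_iff Bex_def by blast
    moreover have "r * x ^ 2 + (q * x + p) = p + q * x + r * x ^ 2" for p q r by simp
    ultimately show ?thesis unfolding adjoin_cbrt_eq set_eq_iff by (simp, blast)
  qed
  ultimately show ?thesis by (simp add: numeral_3_eq_3)
qed

text \<open>
  Kummer theory for a single cube root: an element of \<open>K\<close> that becomes a cube in \<open>K(x)\<close>
  lies in one of the classes of \<open>1\<close>, \<open>x\<^sup>3\<close>, \<open>x\<^sup>6\<close> modulo cubes of \<open>K\<close>. Expanding
  \<open>(p + q x + r x\<^sup>2)\<^sup>3\<close>, the vanishing of the coefficients of \<open>x\<close> and \<open>x\<^sup>2\<close> leaves at most
  one of \<open>p\<close>, \<open>q\<close>, \<open>r\<close> nonzero.
\<close>
lemma cube_in_adjoin_cbrt: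
  assumes b: "b \<in> K" and y: "y \<in> adjoin K x" "b = y ^ 3"
  shows "\<exists>i<3. \<exists>m\<in>K. b = (x ^ 3) ^ i * m ^ 3"
proof -
  note cl = subfield_closed[OF K]
  obtain p q r where e: "y = p + q * x + r * x ^ 2" "p \<in> K" "q \<in> K" "r \<in> K"
    using y(1) unfolding adjoin_cbrt_eq by blast
  define P where "P = p ^ 3 + x ^ 3 * q ^ 3 + x ^ 3 * x ^ 3 * r ^ 3 + 6 * x ^ 3 * (p * q * r) - b"
  define Q where "Q = 3 * (p ^ 2 * q + x ^ 3 * (q ^ 2 * r) + x ^ 3 * (p * r ^ 2))"
  define R where "R = 3 * (p * q ^ 2 + p ^ 2 * r + x ^ 3 * (q * r ^ 2))"
  have "P + Q * x + R * x ^ 2 = y ^ 3 - b"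
    unfolding P_def Q_def R_def e by Groebner_Basis.algebra
  then have "P + Q * x + R * x ^ 2 = 0" using y by simp
  moreover define a where "a = x ^ 3"
  have "P \<in> K" "Q \<in> K" "R \<in> K"
    unfolding P_def Q_def R_def a_def[symmetric] using e x3[folded a_def] b by (auto intro!: cl)
  ultimately have PQR: "P = 0" "Q = 0" "R = 0"
    using cubic_independent by blast+
  have "x \<noteq> 0" using cube_root_notin subfield_0[OF K] by metis
  have "p * (x ^ 3 * r ^ 3 - q ^ 3) = 0"
    using PQR(2,3) unfolding Q_def R_def by Groebner_Basis.algebra
  moreover have "p = 0 \<or> r = 0" if "x ^ 3 * r ^ 3 = q ^ 3"
  proof (rule ccontr)
    assume "\<not> ?thesis"
    then have "(q / r) ^ 3 = x ^ 3" using that by (simp add: power_divide field_simps)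
    then show False using noncube subfield_divide[OF K e(3,4)] by blast
  qed
  ultimately consider "p = 0" | "r = 0" by fastforce
  then have "(q = 0 \<and> r = 0) \<or> (p = 0 \<and> r = 0) \<or> (p = 0 \<and> q = 0)"
    using PQR \<open>x \<noteq> 0\<close> unfolding Q_def R_def by cases auto
  then show ?thesis
  proof (elim disjE conjE)
    assume "q = 0" "r = 0"
    then have "b = (x ^ 3) ^ 0 * p ^ 3" using PQR(1) by (simp add: P_def)
    then show ?thesis using e(2) by (intro exI[of _ 0]) auto
  next
    assume "p = 0" "r = 0"
    then have "b = (x ^ 3) ^ 1 * q ^ 3" using PQR(1) by (simp add: P_def)
    then show ?thesis using e(3) by (intro exI[of _ 1]) auto
  next
    assume "p = 0" "q = 0"
    then have "b = (x ^ 3) ^ 2 * r ^ 3" using PQR(1) by (simp add: P_def power2_eq_square)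
    then show ?thesis using e(4) by (intro exI[of _ 2]) auto
  qed
qed

end

text \<open>The norm of a cube is a cube, so an element of \<open>K\<close> that is a cube in a quadratic
  extension has a cube as its square, and hence is itself a cube.\<close>
lemma cube_in_adjoin_sqrt:
  assumes K: "subfield K CC" and x: "x ^ 2 \<in> K" and b: "b \<in> K"
    and y: "y \<in> adjoin K x" "b = y ^ 3"
  shows "\<exists>m\<in>K. b = m ^ 3"
proof (cases "x \<in> K \<or> b = 0")
  case True
  then show ?thesis
    using adjoin_trivial[OF K] y subfield_0[OF K] by (metis power_zero_numeral)
next
  case False
  note cl = subfield_closed[OF K]
  obtain p q where e: "y = p + q * x" "p \<in> K" "q \<in> K"
    using y(1) unfolding adjoin_sqrt_eq[OF K x] by blast
  define Q where "Q = 3 * p ^ 2 * q + q ^ 3 * x ^ 2"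
  define P where "P = b - (p ^ 3 + 3 * p * q ^ 2 * x ^ 2)"
  have "Q * x = P"
    unfolding P_def Q_def y(2) e(1) by Groebner_Basis.algebra
  moreover have "Q \<in> K" "P \<in> K" unfolding P_def Q_def using e x b by (auto intro!: cl)
  ultimately have "Q = 0"
    using False subfield_divide[OF K] by (metis nonzero_mult_div_cancel_left)
  define n where "n = p ^ 2 - q ^ 2 * x ^ 2"
  have "n \<in> K" unfolding n_def using e x by (auto intro!: cl)
  have "(p - q * x) ^ 3 = b - 2 * Q * x"
    unfolding Q_def y(2) e(1) by Groebner_Basis.algebra
  then have "n ^ 3 = b ^ 2"
    using \<open>Q = 0\<close> y(2) e(1) unfolding n_def by Groebner_Basis.algebra
  then have "b = (b / n) ^ 3"
    using False by (auto simp: power_divide field_simps power2_eq_square power3_eq_cube)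
  then show ?thesis using subfield_divide[OF K b \<open>n \<in> K\<close>] by blast
qed

section \<open>Multiples of a point\<close>

text \<open>
  The multiples of \<open>P\<close> form the orbit of \<open>Infinity\<close> under \<open>point_add a P\<close>. The
  lemmas on periods below use nothing else about the addition.
\<close>
lemma point_mult_Suc: "point_mult a (Suc n) P = point_add a P (point_mult a n P)"
  and point_mult_0: "point_mult a 0 P = Infinity"
  by (simp_all add: point_mult_def)

lemma point_add_Infinity_right [simp]: "point_add a P Infinity = P"
  by (cases P) auto

lemma point_mult_1: "point_mult a (Suc 0) P = P"
  by (simp add: point_mult_Suc point_mult_0)

lemma point_mult_diff:
  assumes "point_mult a j P = point_mult a i P" "j \<le> n"
  shows "point_mult a (n - j + i) P = point_mult a n P"
proof -
  have "point_mult a (n - j + i) P = (point_add a P ^^ (n - j)) (point_mult a i P)"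
    by (simp add: point_mult_def funpow_add)
  also have "\<dots> = (point_add a P ^^ (n - j + j)) Infinity"
    unfolding assms(1)[symmetric] by (simp add: point_mult_def funpow_add)
  finally show ?thesis using assms(2) by (simp add: point_mult_def)
qed

lemma point_mult_mod:
  "point_mult a k P = Infinity \<Longrightarrow> point_mult a (n mod k) P = point_mult a n P"
  unfolding point_mult_def by (rule funpow_mod_eq)

lemma point_mult_nine_cases:
  assumes "point_mult a 9 P = Infinity" "point_mult a 3 P \<noteq> Infinity"
    and "0 < k" "k < 9"
  shows "point_mult a k P \<noteq> Infinity"
proof
  assume k: "point_mult a k P = Infinity"
  have one: "point_mult a 1 P \<noteq> Infinity"
    using assms(2) point_mult_mod[of a 1 P 3] by (auto simp: point_mult_0)
  have "k \<in> {1, 2, 3, 4, 5, 6, 7, 8}" using assms(3,4) by auto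
  then consider "k = 3" | "9 mod k = 1" | "k = 5 \<or> k = 7" | "k = 6" | "k = 1" by auto
  then show False
  proof cases
    case 3
    then show False
      using k point_mult_mod[of a k P 9] point_mult_mod[of a 4 P 5] point_mult_mod[of a 2 P 7] one assms(1) by auto
  qed (use k point_mult_mod[of a k P 9] assms one in auto)
qed

lemma point_mult_nine_distinct:
  assumes "point_mult a 9 P = Infinity" "point_mult a 3 P \<noteq> Infinity" "i < j" "j < 9"
  shows "point_mult a j P \<noteq> point_mult a i P"
  using point_mult_diff[of a j P i 9] point_mult_nine_cases[OF assms(1,2), of "9 - j + i"] assms
  by auto

section \<open>Twisting\<close>

text \<open>
  The isomorphism \<open>(x, y) \<mapsto> (l\<^sup>2 x, l\<^sup>3 y)\<close> from \<open>y\<^sup>2 = x\<^sup>3 + b\<close> to \<open>y\<^sup>2 = x\<^sup>3 + l\<^sup>6 b\<close>.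
\<close>
fun scale_point :: "'a::field \<Rightarrow> 'a point \<Rightarrow> 'a point" where
  "scale_point l Infinity = Infinity"
| "scale_point l (Affine x y) = Affine (l ^ 2 * x) (l ^ 3 * y)"

lemma point_add_scale:
  assumes "l \<noteq> 0"
  shows "point_add 0 (scale_point l P) (scale_point l Q) = scale_point l (point_add 0 P Q)"
proof (cases P; cases Q)
  fix x1 y1 x2 y2
  assume PQ: "P = Affine x1 y1" "Q = Affine x2 y2"
  define m where "m = (if x1 = x2 then 3 * x1 ^ 2 / (2 * y1) else (y2 - y1) / (x2 - x1))"
  define m' where "m' = (if l ^ 2 * x1 = l ^ 2 * x2 then 3 * (l ^ 2 * x1) ^ 2 / (2 * (l ^ 3 * y1))
      else (l ^ 3 * y2 - l ^ 3 * y1) / (l ^ 2 * x2 - l ^ 2 * x1))"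
  have "m' = l * m"
  proof (cases "x1 = x2")
    case True
    have "3 * (l ^ 2 * x1) ^ 2 = (l * (3 * x1 ^ 2)) * l ^ 3"
      "2 * (l ^ 3 * y1) = (2 * y1) * l ^ 3"
      by Groebner_Basis.algebra+
    then show ?thesis using True assms unfolding m_def m'_def
      by (simp only: mult_divide_mult_cancel_right refl if_True power_eq_0_iff not_False_eq_True)
         simp
  next
    case False
    have "l ^ 3 * y2 - l ^ 3 * y1 = l * (y2 - y1) * l ^ 2"
      "l ^ 2 * x2 - l ^ 2 * x1 = (x2 - x1) * l ^ 2"
      by Groebner_Basis.algebra+
    then show ?thesis using False assms by (simp add: m_def m'_def)
  qed
  moreover have "point_add 0 P Q = (if x1 = x2 \<and> y1 = - y2 then Infinity
      else Affine (m ^ 2 - x1 - x2) (m * (x1 - (m ^ 2 - x1 - x2)) - y1))"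
    by (simp add: PQ m_def Let_def)
  moreover have "point_add 0 (scale_point l P) (scale_point l Q) =
    (if l ^ 2 * x1 = l ^ 2 * x2 \<and> l ^ 3 * y1 = - (l ^ 3 * y2) then Infinity
      else Affine (m' ^ 2 - l ^ 2 * x1 - l ^ 2 * x2)
        (m' * (l ^ 2 * x1 - (m' ^ 2 - l ^ 2 * x1 - l ^ 2 * x2)) - l ^ 3 * y1))"
    by (simp add: PQ m'_def Let_def)
  moreover have "(l * m) ^ 2 - l ^ 2 * x1 - l ^ 2 * x2 = l ^ 2 * (m ^ 2 - x1 - x2)"
    by Groebner_Basis.algebra
  moreover have "l * m * (l ^ 2 * x1 - l ^ 2 * u) - l ^ 3 * y1 = l ^ 3 * (m * (x1 - u) - y1)" for u
    by Groebner_Basis.algebra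
  moreover have "l ^ 3 * y1 = - (l ^ 3 * y2) \<longleftrightarrow> y1 = - y2"
    using assms by (metis mult_left_cancel mult_minus_right power_not_zero)
  moreover have "l ^ 2 * x1 = l ^ 2 * x2 \<longleftrightarrow> x1 = x2"
    using assms by simp
  ultimately show ?thesis
    by auto
qed auto

lemma point_mult_scale:
  assumes "l \<noteq> 0"
  shows "point_mult 0 n (scale_point l P) = scale_point l (point_mult 0 n P)"
proof (induction n)
  case (Suc n)
  then show ?case by (simp add: point_mult_Suc point_add_scale[OF assms])
qed (simp add: point_mult_0)

lemma scale_point_eq_Infinity: "scale_point l P = Infinity \<longleftrightarrow> P = Infinity"
  by (cases P) auto

section \<open>Coordinates of the first multiples on \<open>y\<^sup>2 = x\<^sup>3 + 1/4\<close>\<close>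

text \<open>
  As \<open>\<omega>\<close> and \<open>-1\<close> act on the curve, the multiples of \<open>(x, y)\<close> have the form \<open>(x a, y c)\<close> where
  \<open>a\<close> and \<open>c\<close> are rational functions of \<open>x\<^sup>3\<close> alone. Adding \<open>(x, y)\<close> once more transforms
  \<open>(a, c)\<close> as follows.
\<close>
lemma point_add_chord:
  fixes x y a c :: complex
  assumes "y ^ 2 = x ^ 3 + 1 / 4" "x \<noteq> 0" "a \<noteq> 1"
    and "m = (c - 1) / (a - 1)" "a' = (x ^ 3 + 1 / 4) * m ^ 2 / x ^ 3 - 1 - a" "c' = m * (1 - a') - 1"
  shows "point_add 0 (Affine x y) (Affine (x * a) (y * c)) = Affine (x * a') (y * c')"
proof -
  define M where "M = (y * c - y) / (x * a - x)"
  have "x \<noteq> x * a" using assms(2,3) by simp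
  then have add: "point_add 0 (Affine x y) (Affine (x * a) (y * c)) =
      Affine (M ^ 2 - x - x * a) (M * (x - (M ^ 2 - x - x * a)) - y)"
    by (simp add: M_def Let_def)
  have "y * c - y = y * (c - 1)" "x * a - x = x * (a - 1)" by (simp_all add: algebra_simps)
  then have M: "M = y / x * m"
    by (simp add: M_def assms(4))
  have "M ^ 2 = y ^ 2 * m ^ 2 / x ^ 2"
    by (simp add: M power_mult_distrib power_divide)
  also have "\<dots> = x * (y ^ 2 * m ^ 2 / x ^ 3)"
    using assms(2) by (simp add: power2_eq_square power3_eq_cube)
  finally have "M ^ 2 = x * ((x ^ 3 + 1 / 4) * m ^ 2 / x ^ 3)"
    by (simp only: assms(1))
  then have x: "M ^ 2 - x - x * a = x * a'"
    by (simp add: assms(5) algebra_simps)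
  have "M * (x - x * a') = y * m * (1 - a')"
    using assms(2) by (simp add: M field_simps)
  then have "M * (x - x * a') - y = y * c'"
    by (simp add: assms(6) algebra_simps)
  then show ?thesis unfolding add x by simp
qed

text \<open>
  Up to a constant, the factor of the fourth division polynomial prime to the second one, in \<open>Z = x\<^sup>3\<close>.
\<close>
definition psi4_factor :: "complex \<Rightarrow> complex" where "psi4_factor Z = 2 * Z ^ 2 + 10 * Z - 1"

text \<open>
  The multiples \<open>nP\<close> of \<open>P = (x, y)\<close> for \<open>n = 2, 3, 4\<close> are \<open>(x \<cdot> xfac\<^sub>n, y \<cdot> yfac\<^sub>n)\<close>, evaluated
  at \<open>Z = x\<^sup>3\<close>.
\<close>
definition xfac2 :: "complex \<Rightarrow> complex" where "xfac2 Z = (Z - 2) / (4 * Z + 1)"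
definition yfac2 :: "complex \<Rightarrow> complex" where "yfac2 Z = psi4_factor Z / (4 * Z + 1) ^ 2"
definition xfac3 :: "complex \<Rightarrow> complex" where
  "xfac3 Z = (Z ^ 3 - 24 * Z ^ 2 + 3 * Z + 1) / (9 * Z * (Z + 1) ^ 2)"
definition yfac3 :: "complex \<Rightarrow> complex" where
  "yfac3 Z = (Z ^ 4 + 55 * Z ^ 3 - 111 * Z ^ 2 - 5 * Z - 2) / (27 * Z * (Z + 1) ^ 3)"
definition xfac4 :: "complex \<Rightarrow> complex" where
  "xfac4 Z = (Z ^ 5 - 136 * Z ^ 4 + 184 * Z ^ 3 + 136 * Z ^ 2 + 62 * Z + 4) / ((4 * Z + 1) * psi4_factor Z ^ 2)"
definition yfac4 :: "complex \<Rightarrow> complex" where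
  "yfac4 Z = (2 * Z ^ 8 + 616 * Z ^ 7 - 7336 * Z ^ 6 - 1544 * Z ^ 5 - 3430 * Z ^ 4 - 4124 * Z ^ 3
     - 952 * Z ^ 2 - 104 * Z - 1) / ((4 * Z + 1) ^ 2 * psi4_factor Z ^ 3)"

lemma quotient_minus_1: "(d::complex) \<noteq> 0 \<Longrightarrow> n / d - 1 = (n - d) / d"
  by (simp add: diff_divide_distrib)

lemma xfac2_minus_1: "4 * Z + 1 \<noteq> 0 \<Longrightarrow> xfac2 Z - 1 = - 3 * (Z + 1) / (4 * Z + 1)"
  by (simp add: xfac2_def field_simps)

lemma xfac3_minus_1:
  assumes "Z \<noteq> 0" "Z + 1 \<noteq> 0"
  shows "xfac3 Z - 1 = - (4 * Z + 1) * psi4_factor Z / (9 * Z * (Z + 1) ^ 2)"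
proof -
  have "Z ^ 3 - 24 * Z ^ 2 + 3 * Z + 1 - 9 * Z * (Z + 1) ^ 2 = - (4 * Z + 1) * psi4_factor Z"
    unfolding psi4_factor_def by Groebner_Basis.algebra
  moreover have "xfac3 Z - 1 = (Z ^ 3 - 24 * Z ^ 2 + 3 * Z + 1 - 9 * Z * (Z + 1) ^ 2) / (9 * Z * (Z + 1) ^ 2)"
    unfolding xfac3_def using assms by (intro quotient_minus_1) simp
  ultimately show ?thesis by (simp only:)
qed

lemma xfac4_minus_1:
  assumes "4 * Z + 1 \<noteq> 0" "psi4_factor Z \<noteq> 0"
  shows "xfac4 Z - 1 = 3 * (Z + 1) * (1 + 25 * Z + 15 * Z ^ 2 - 95 * Z ^ 3 - 5 * Z ^ 4) / ((4 * Z + 1) * psi4_factor Z ^ 2)"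
proof -
  have "Z ^ 5 - 136 * Z ^ 4 + 184 * Z ^ 3 + 136 * Z ^ 2 + 62 * Z + 4 - (4 * Z + 1) * psi4_factor Z ^ 2
      = 3 * (Z + 1) * (1 + 25 * Z + 15 * Z ^ 2 - 95 * Z ^ 3 - 5 * Z ^ 4)"
    unfolding psi4_factor_def by Groebner_Basis.algebra
  moreover have "xfac4 Z - 1 = (Z ^ 5 - 136 * Z ^ 4 + 184 * Z ^ 3 + 136 * Z ^ 2 + 62 * Z + 4
      - (4 * Z + 1) * psi4_factor Z ^ 2) / ((4 * Z + 1) * psi4_factor Z ^ 2)"
    unfolding xfac4_def using assms by (intro quotient_minus_1) simp
  ultimately show ?thesis by (simp only:)
qed

text \<open>
  The recursion of \<open>point_add_chord\<close> leads from the factors of \<open>2P\<close> to those of \<open>3P\<close>, and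
  from these to those of \<open>4P\<close>. All identities reduce to identities between polynomials in \<open>Z\<close>.
\<close>
lemma triple_factors:
  assumes "Z \<noteq> 0" "Z + 1 \<noteq> 0" "4 * Z + 1 \<noteq> 0"
  shows "(Z + 1 / 4) * ((yfac2 Z - 1) / (xfac2 Z - 1)) ^ 2 / Z - 1 - xfac2 Z = xfac3 Z"
    and "(yfac2 Z - 1) / (xfac2 Z - 1) * (1 - xfac3 Z) - 1 = yfac3 Z"
proof -
  define W where "W = 4 * Z + 1"
  define B where "B = Z + 1"
  define T where "T = psi4_factor Z"
  define n where "n = 14 * Z ^ 2 - 2 * Z + 2"
  define p where "p = Z ^ 3 - 24 * Z ^ 2 + 3 * Z + 1"
  have nz: "Z \<noteq> 0" "W \<noteq> 0" "B \<noteq> 0" using assms by (simp_all add: W_def B_def)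
  have "T - W ^ 2 = - n" unfolding T_def psi4_factor_def W_def n_def by Groebner_Basis.algebra
  then have c: "yfac2 Z - 1 = - n / W ^ 2"
    using quotient_minus_1[of "W ^ 2" T] nz unfolding yfac2_def W_def[symmetric] T_def[symmetric] by simp
  have a: "xfac2 Z - 1 = - 3 * B / W"
    unfolding W_def B_def by (rule xfac2_minus_1[OF assms(3)])
  have m: "(yfac2 Z - 1) / (xfac2 Z - 1) = n / (3 * W * B)"
    using nz unfolding c a by (simp add: field_simps power2_eq_square)
  have Z4: "Z + 1 / 4 = W / 4" by (simp add: W_def)
  have key: "n ^ 2 - 36 * W * B ^ 2 * Z - 36 * B ^ 2 * Z * (Z - 2) = 4 * W * p"
    unfolding n_def W_def B_def p_def by Groebner_Basis.algebra
  have "W / 4 * (n / (3 * W * B)) ^ 2 / Z - 1 - (Z - 2) / W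
      = (n ^ 2 - 36 * W * B ^ 2 * Z - 36 * B ^ 2 * Z * (Z - 2)) / (36 * W * B ^ 2 * Z)"
    using nz by (simp add: divide_simps power_divide) (simp add: algebra_simps power2_eq_square)
  then have x: "W / 4 * (n / (3 * W * B)) ^ 2 / Z - 1 - (Z - 2) / W = p / (9 * Z * B ^ 2)"
    unfolding key using nz by simp
  show "(Z + 1 / 4) * ((yfac2 Z - 1) / (xfac2 Z - 1)) ^ 2 / Z - 1 - xfac2 Z = xfac3 Z"
    unfolding m Z4 unfolding xfac2_def xfac3_def W_def[symmetric] B_def[symmetric] p_def[symmetric] by (rule x)
  have xfac3: "1 - xfac3 Z = W * T / (9 * Z * B ^ 2)"
    using arg_cong[OF xfac3_minus_1[OF assms(1,2)], of uminus]
    unfolding W_def[symmetric] B_def[symmetric] T_def[symmetric] by simp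
  have key': "n * T - 27 * Z * B ^ 3 = Z ^ 4 + 55 * Z ^ 3 - 111 * Z ^ 2 - 5 * Z - 2"
    unfolding n_def T_def psi4_factor_def B_def by Groebner_Basis.algebra
  have "n / (3 * W * B) * (W * T / (9 * Z * B ^ 2)) - 1 = (n * T - 27 * Z * B ^ 3) / (27 * Z * B ^ 3)"
    using nz by (simp add: divide_simps power2_eq_square power3_eq_cube)
  then show "(yfac2 Z - 1) / (xfac2 Z - 1) * (1 - xfac3 Z) - 1 = yfac3 Z"
    unfolding m xfac3 yfac3_def B_def[symmetric] key'[symmetric] .
qed

lemma quadruple_factors:
  assumes "Z \<noteq> 0" "Z + 1 \<noteq> 0" "4 * Z + 1 \<noteq> 0" "psi4_factor Z \<noteq> 0"
  shows "(Z + 1 / 4) * ((yfac3 Z - 1) / (xfac3 Z - 1)) ^ 2 / Z - 1 - xfac3 Z = xfac4 Z"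
    and "(yfac3 Z - 1) / (xfac3 Z - 1) * (1 - xfac4 Z) - 1 = yfac4 Z"
proof -
  define W where "W = 4 * Z + 1"
  define B where "B = Z + 1"
  define T where "T = psi4_factor Z"
  define n where "n = - 26 * Z ^ 4 - 26 * Z ^ 3 - 192 * Z ^ 2 - 32 * Z - 2"
  define p where "p = Z ^ 3 - 24 * Z ^ 2 + 3 * Z + 1"
  define q where "q = 1 + 25 * Z + 15 * Z ^ 2 - 95 * Z ^ 3 - 5 * Z ^ 4"
  define N where "N = Z ^ 5 - 136 * Z ^ 4 + 184 * Z ^ 3 + 136 * Z ^ 2 + 62 * Z + 4"
  have nz: "Z \<noteq> 0" "W \<noteq> 0" "B \<noteq> 0" "T \<noteq> 0" using assms by (simp_all add: W_def B_def T_def)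
  have "Z ^ 4 + 55 * Z ^ 3 - 111 * Z ^ 2 - 5 * Z - 2 - 27 * Z * B ^ 3 = n"
    unfolding n_def B_def by Groebner_Basis.algebra
  then have c: "yfac3 Z - 1 = n / (27 * Z * B ^ 3)"
    using quotient_minus_1[of "27 * Z * B ^ 3"] nz unfolding yfac3_def B_def[symmetric] by simp
  have a: "xfac3 Z - 1 = - W * T / (9 * Z * B ^ 2)"
    unfolding W_def B_def T_def by (rule xfac3_minus_1[OF assms(1,2)])
  have m: "(yfac3 Z - 1) / (xfac3 Z - 1) = - n / (3 * B * W * T)"
    using nz unfolding c a by (simp add: field_simps power2_eq_square power3_eq_cube)
  have Z4: "Z + 1 / 4 = W / 4" by (simp add: W_def)
  have key: "n ^ 2 - 36 * B ^ 2 * W * T ^ 2 * Z - 4 * W * T ^ 2 * p = 36 * B ^ 2 * Z * N"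
    unfolding n_def W_def B_def p_def T_def psi4_factor_def N_def by Groebner_Basis.algebra
  have "W / 4 * (- n / (3 * B * W * T)) ^ 2 / Z - 1 - p / (9 * Z * B ^ 2)
      = (n ^ 2 - 36 * B ^ 2 * W * T ^ 2 * Z - 4 * W * T ^ 2 * p) / (36 * B ^ 2 * W * T ^ 2 * Z)"
    using nz by (simp add: divide_simps power_divide) (simp add: algebra_simps power2_eq_square)
  then have x: "W / 4 * (- n / (3 * B * W * T)) ^ 2 / Z - 1 - p / (9 * Z * B ^ 2) = N / (W * T ^ 2)"
    unfolding key using nz by simp
  show "(Z + 1 / 4) * ((yfac3 Z - 1) / (xfac3 Z - 1)) ^ 2 / Z - 1 - xfac3 Z = xfac4 Z"
    unfolding m Z4 unfolding xfac3_def xfac4_def W_def[symmetric] B_def[symmetric] p_def[symmetric]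
      T_def[symmetric] N_def[symmetric] by (rule x)
  have xfac4: "1 - xfac4 Z = - (3 * B * q) / (W * T ^ 2)"
    using arg_cong[OF xfac4_minus_1[OF assms(3,4)], of uminus]
    unfolding W_def[symmetric] B_def[symmetric] T_def[symmetric] q_def[symmetric] by simp
  have key': "n * q - W ^ 2 * T ^ 3 = 2 * Z ^ 8 + 616 * Z ^ 7 - 7336 * Z ^ 6 - 1544 * Z ^ 5
      - 3430 * Z ^ 4 - 4124 * Z ^ 3 - 952 * Z ^ 2 - 104 * Z - 1"
    unfolding n_def T_def psi4_factor_def W_def q_def by Groebner_Basis.algebra
  have "- n / (3 * B * W * T) * (- (3 * B * q) / (W * T ^ 2)) - 1 = (n * q - W ^ 2 * T ^ 3) / (W ^ 2 * T ^ 3)"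
    using nz by (simp add: divide_simps power2_eq_square power3_eq_cube)
  then show "(yfac3 Z - 1) / (xfac3 Z - 1) * (1 - xfac4 Z) - 1 = yfac4 Z"
    unfolding m xfac4 yfac4_def W_def[symmetric] T_def[symmetric] key'[symmetric] .
qed

text \<open>
  By \<open>point_add_chord\<close>, the left-hand side vanishes iff \<open>P + 4P\<close> has the same \<open>x\<close>-coordinate
  as \<open>4P\<close>, when \<open>xfac4 Z \<noteq> 1\<close> and \<open>x \<noteq> 0\<close>.
\<close>
lemma quintuple_condition:
  assumes "4 * Z + 1 \<noteq> 0" "psi4_factor Z \<noteq> 0"
  shows "(Z + 1 / 4) * (yfac4 Z - 1) ^ 2 - Z * (xfac4 Z - 1) ^ 2 * (1 + 2 * xfac4 Z) =
     - 81 * Z * (Z + 1) ^ 3 * (Z ^ 3 - 24 * Z ^ 2 + 3 * Z + 1) *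
     ((Z ^ 3 - 24 * Z ^ 2 + 3 * Z + 1) ^ 3 + 729 * Z ^ 2 * (Z + 1) ^ 6) / ((4 * Z + 1) ^ 3 * psi4_factor Z ^ 6)"
proof -
  define W where "W = 4 * Z + 1"
  define B where "B = Z + 1"
  define T where "T = psi4_factor Z"
  define p where "p = Z ^ 3 - 24 * Z ^ 2 + 3 * Z + 1"
  define q where "q = 1 + 25 * Z + 15 * Z ^ 2 - 95 * Z ^ 3 - 5 * Z ^ 4"
  define N where "N = Z ^ 5 - 136 * Z ^ 4 + 184 * Z ^ 3 + 136 * Z ^ 2 + 62 * Z + 4"
  define M where "M = 2 * Z ^ 8 + 616 * Z ^ 7 - 7336 * Z ^ 6 - 1544 * Z ^ 5
      - 3430 * Z ^ 4 - 4124 * Z ^ 3 - 952 * Z ^ 2 - 104 * Z - 1"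
  define s where "s = M - W ^ 2 * T ^ 3"
  define R where "R = - 81 * Z * B ^ 3 * p * (p ^ 3 + 729 * Z ^ 2 * B ^ 6)"
  have nz: "W \<noteq> 0" "T \<noteq> 0" using assms by (simp_all add: W_def T_def)
  have Z4: "Z + 1 / 4 = W / 4" by (simp add: W_def)
  have c: "yfac4 Z - 1 = s / (W ^ 2 * T ^ 3)"
    using quotient_minus_1[of "W ^ 2 * T ^ 3" M] nz
    unfolding yfac4_def W_def[symmetric] T_def[symmetric] M_def[symmetric] s_def by simp
  have a: "xfac4 Z - 1 = 3 * B * q / (W * T ^ 2)"
    unfolding W_def B_def T_def q_def by (rule xfac4_minus_1[OF assms])
  have a': "xfac4 Z = N / (W * T ^ 2)"
    unfolding xfac4_def W_def B_def T_def N_def ..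
  have key: "s ^ 2 - 36 * Z * B ^ 2 * q ^ 2 * (W * T ^ 2 + 2 * N) = 4 * R"
    unfolding s_def M_def W_def T_def psi4_factor_def B_def q_def N_def R_def p_def by Groebner_Basis.algebra
  have "W / 4 * (s / (W ^ 2 * T ^ 3)) ^ 2 - Z * (3 * B * q / (W * T ^ 2)) ^ 2 * (1 + 2 * (N / (W * T ^ 2)))
     = (s ^ 2 - 36 * Z * B ^ 2 * q ^ 2 * (W * T ^ 2 + 2 * N)) / (4 * (W ^ 3 * T ^ 6))"
  proof -
    have "W / 4 * (s / (W ^ 2 * T ^ 3)) ^ 2 = s ^ 2 / (4 * (W ^ 3 * T ^ 6))"
      using nz by (simp add: power_divide power_mult_distrib divide_simps eval_nat_numeral)
    moreover have "Z * (3 * B * q / (W * T ^ 2)) ^ 2 * (1 + 2 * (N / (W * T ^ 2)))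
      = 36 * Z * B ^ 2 * q ^ 2 * (W * T ^ 2 + 2 * N) / (4 * (W ^ 3 * T ^ 6))"
      using nz by (simp add: power_divide power_mult_distrib divide_simps eval_nat_numeral)
    ultimately show ?thesis by (simp add: diff_divide_distrib)
  qed
  also have "\<dots> = R / (W ^ 3 * T ^ 6)" unfolding key by simp
  finally show ?thesis
    unfolding Z4 c a unfolding a'
    R_def W_def[symmetric] B_def[symmetric] T_def[symmetric] p_def[symmetric] .
qed

section \<open>Points of the curve\<close>

lemma point_add_on_curve:
  fixes b :: complex
  assumes "P \<in> curve_points UNIV 0 b" "Q \<in> curve_points UNIV 0 b"
  shows "point_add 0 P Q \<in> curve_points UNIV 0 b"
proof (cases P; cases Q)
  fix x1 y1 x2 y2
  assume PQ: "P = Affine x1 y1" "Q = Affine x2 y2"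
  have on1: "y1 ^ 2 = x1 ^ 3 + b" and on2: "y2 ^ 2 = x2 ^ 3 + b"
    using assms PQ by (auto simp: curve_points_def)
  have fin: "Affine x3 (m * (x1 - x3) - y1) \<in> curve_points UNIV 0 b"
    if m: "2 * m * y1 + m ^ 2 * (x2 - x1) = x2 ^ 2 + x1 * x2 + x1 ^ 2" and x3: "x3 = m ^ 2 - x1 - x2" for m x3
  proof -
    have "(m * (x1 - x3) - y1) ^ 2 = x3 ^ 3 + b"
      using m on1 unfolding x3 by Groebner_Basis.algebra
    then show ?thesis by (auto simp: curve_points_def)
  qed
  show ?thesis
  proof (cases "x1 = x2")
    case True
    then have "y1 = y2 \<or> y1 = - y2" using on1 on2 by (metis power2_eq_iff)
    show ?thesis
    proof (cases "y1 = - y2")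
      case True
      then show ?thesis using \<open>x1 = x2\<close> PQ by (simp add: curve_points_def)
    next
      case False
      with \<open>y1 = y2 \<or> _\<close> have "y1 = y2" "y1 \<noteq> 0" by auto
      define m where "m = 3 * x1 ^ 2 / (2 * y1)"
      have "2 * m * y1 = 3 * x1 ^ 2" using \<open>y1 \<noteq> 0\<close> by (simp add: m_def)
      then have "2 * m * y1 + m ^ 2 * (x2 - x1) = x2 ^ 2 + x1 * x2 + x1 ^ 2"
        using \<open>x1 = x2\<close> by (simp add: power2_eq_square)
      from fin[OF this refl] show ?thesis
        using False \<open>x1 = x2\<close> by (simp add: PQ m_def Let_def)
    qed
  next
    case False
    define m where "m = (y2 - y1) / (x2 - x1)"
    have "m * (x2 - x1) = y2 - y1" using False by (simp add: m_def)
    then have "(x2 - x1) * (2 * m * y1 + m ^ 2 * (x2 - x1)) = (x2 - x1) * (x2 ^ 2 + x1 * x2 + x1 ^ 2)"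
      using on1 on2 by Groebner_Basis.algebra
    then have "2 * m * y1 + m ^ 2 * (x2 - x1) = x2 ^ 2 + x1 * x2 + x1 ^ 2"
      using False by simp
    from fin[OF this refl] show ?thesis
      using False by (simp add: PQ m_def Let_def)
  qed
qed (use assms in auto)

lemma point_mult_on_curve:
  fixes b :: complex
  assumes "P \<in> curve_points UNIV 0 b"
  shows "point_mult 0 n P \<in> curve_points UNIV 0 b"
proof (induction n)
  case 0
  then show ?case by (simp add: point_mult_0 curve_points_def)
next
  case (Suc n)
  then show ?case by (simp add: point_mult_Suc point_add_on_curve[OF assms])
qed

lemma point_add_slope:
  assumes "x1 \<noteq> x2" "m * (x2 - x1) = y2 - y1" "m ^ 2 - x1 - x2 = x3" "m * (x1 - x3) - y1 = y3"
  shows "point_add a (Affine x1 y1) (Affine x2 y2) = Affine x3 (y3 :: complex)"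
proof -
  have "m = (y2 - y1) / (x2 - x1)" using assms(1,2) by (simp add: eq_divide_eq)
  then show ?thesis using assms(1) unfolding assms(3,4)[symmetric] by (simp add: Let_def)
qed

lemma point_double_slope:
  assumes "y \<noteq> 0" "2 * y * m = 3 * x ^ 2" "m ^ 2 - x - x = x3" "m * (x - x3) - y = y3"
  shows "point_add 0 (Affine x y) (Affine x y) = Affine x3 (y3 :: complex)"
proof -
  have "m = 3 * x ^ 2 / (2 * y)" using assms(1,2) by (simp add: eq_divide_eq mult.commute)
  then show ?thesis using assms(1) unfolding assms(3,4)[symmetric] by (simp add: Let_def)
qed

text \<open>
  If \<open>P + Q = S\<close>, then \<open>P\<close>, \<open>Q\<close> and \<open>-S\<close> are collinear, so \<open>P + (-S) = -Q\<close>. The next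
  lemma is the case \<open>Q = P\<close>; the one after it is the converse of that case, in which the chord
  through \<open>P\<close> and \<open>Q\<close> is tangent at \<open>P\<close>.
\<close>
lemma point_add_third_point:
  fixes x y :: complex
  assumes "point_add 0 (Affine x y) (Affine x2 y2) = Affine x3 y3" "x2 \<noteq> x" "x3 \<noteq> x"
  shows "point_add 0 (Affine x y) (Affine x3 (- y3)) = Affine x2 (- y2)"
proof -
  define m where "m = (y2 - y) / (x2 - x)"
  have m: "m * (x2 - x) = y2 - y" using assms(2) by (simp add: m_def)
  have x3: "x3 = m ^ 2 - x - x2" and y3: "y3 = m * (x - x3) - y"
    using assms by (auto simp: m_def Let_def)
  show ?thesis
    by (rule point_add_slope[where m = m]) (use assms(3) m x3 y3 in \<open>auto simp: algebra_simps\<close>)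
qed

lemma point_double_third_point:
  fixes x y :: complex
  assumes "point_add 0 (Affine x y) (Affine x y) = Affine x3 y3" "x3 \<noteq> x"
  shows "point_add 0 (Affine x y) (Affine x3 (- y3)) = Affine x (- y)"
proof -
  define m where "m = 3 * x ^ 2 / (2 * y)"
  have "y \<noteq> 0" using assms by auto
  then have x3: "x3 = m ^ 2 - x - x" and y3: "y3 = m * (x - x3) - y"
    using assms by (auto simp: m_def Let_def)
  show ?thesis
    by (rule point_add_slope[where m = m]) (use assms(2) x3 y3 in \<open>auto simp: algebra_simps\<close>)
qed

lemma point_double_of_tangent:
  fixes x y :: complex
  assumes "y ^ 2 = x ^ 3 + b" "y2 ^ 2 = x2 ^ 3 + b" "y \<noteq> 0" "x2 \<noteq> x"
    and "point_add 0 (Affine x y) (Affine x2 y2) = Affine x (- y)"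
  shows "point_add 0 (Affine x y) (Affine x y) = Affine x2 (- y2)"
proof -
  define m where "m = (y2 - y) / (x2 - x)"
  have m: "m * (x2 - x) = y2 - y" using assms(4) by (simp add: m_def)
  have m2: "m ^ 2 - x - x2 = x" using assms by (auto simp: m_def Let_def)
  have "(x2 - x) * (2 * y * m) = (x2 - x) * (3 * x ^ 2)"
    using assms(1,2) m m2 by Groebner_Basis.algebra
  then have "2 * y * m = 3 * x ^ 2" using assms(4) mult_left_cancel[of "x2 - x" "2 * y * m"] by auto
  then show ?thesis
    by (rule point_double_slope[OF assms(3)]) (use m m2 in \<open>auto simp: algebra_simps\<close>)
qed

lemma point_double:
  fixes x y :: complex
  assumes "y ^ 2 = x ^ 3 + 1 / 4" "y \<noteq> 0"
  shows "point_add 0 (Affine x y) (Affine x y) = Affine (x * xfac2 (x ^ 3)) (y * yfac2 (x ^ 3))"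
proof -
  define W where "W = 4 * x ^ 3 + 1"
  have W: "W = 4 * y ^ 2" using assms(1) by (simp add: W_def)
  then have "W \<noteq> 0" using assms(2) by simp
  define m where "m = 3 * x ^ 2 / (2 * y)"
  have "m ^ 2 = 9 * x ^ 4 / W"
    unfolding m_def W by (simp add: power_divide power_mult_distrib)
  also have "\<dots> - x - x = x * xfac2 (x ^ 3)"
    unfolding xfac2_def W_def[symmetric] using \<open>W \<noteq> 0\<close>
    by (simp add: divide_simps) (simp add: W_def algebra_simps eval_nat_numeral)
  finally have x2: "m ^ 2 - x - x = x * xfac2 (x ^ 3)" .
  have d: "x - x * xfac2 (x ^ 3) = 3 * x * (x ^ 3 + 1) / W"
    unfolding xfac2_def W_def[symmetric] using \<open>W \<noteq> 0\<close>
    by (simp add: divide_simps) (simp add: W_def algebra_simps)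
  have "m = y * (6 * x ^ 2 / W)"
    using \<open>y \<noteq> 0\<close> unfolding m_def W by (simp add: field_simps power2_eq_square)
  moreover have "6 * x ^ 2 / W * (3 * x * (x ^ 3 + 1) / W) - 1 = yfac2 (x ^ 3)"
    unfolding yfac2_def W_def[symmetric] psi4_factor_def using \<open>W \<noteq> 0\<close>
    by (simp add: divide_simps) (simp add: W_def algebra_simps eval_nat_numeral)
  moreover have "y * u * (3 * x * (x ^ 3 + 1) / W) - y = y * (u * (3 * x * (x ^ 3 + 1) / W) - 1)" for u
    by (simp only: right_diff_distrib mult.assoc mult_1_right)
  ultimately have y2: "m * (x - x * xfac2 (x ^ 3)) - y = y * yfac2 (x ^ 3)"
    unfolding d by (simp only:)
  show ?thesis
    by (rule point_double_slope[OF assms(2) _ x2 y2]) (use assms(2) in \<open>simp add: m_def\<close>)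
qed

lemma same_x_on_curve:
  fixes b :: complex
  assumes "Affine x y \<in> curve_points UNIV a b" "Affine x y' \<in> curve_points UNIV a b"
  shows "y' = y \<or> y' = - y"
proof -
  have "y' ^ 2 = y ^ 2" using assms by (simp add: curve_points_def)
  then show ?thesis by (simp only: power2_eq_iff)
qed

lemma four_y_squared: "y ^ 2 = x ^ 3 + 1 / 4 \<Longrightarrow> 4 * x ^ 3 + 1 = 4 * (y::complex) ^ 2"
  by simp

lemma xfac2_eq_1_iff: "4 * Z + 1 \<noteq> 0 \<Longrightarrow> xfac2 Z = 1 \<longleftrightarrow> Z + 1 = 0"
  unfolding eq_iff_diff_eq_0[of "xfac2 Z"] xfac2_minus_1
  by (simp only: divide_eq_0_iff mult_eq_0_iff neg_equal_0_iff_equal zero_neq_numeral[symmetric] simp_thms)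

lemma xfac3_eq_1_iff:
  "Z \<noteq> 0 \<Longrightarrow> Z + 1 \<noteq> 0 \<Longrightarrow> 4 * Z + 1 \<noteq> 0 \<Longrightarrow> xfac3 Z = 1 \<longleftrightarrow> psi4_factor Z = 0"
  unfolding eq_iff_diff_eq_0[of "xfac3 Z"] xfac3_minus_1
  by (simp only: divide_eq_0_iff mult_eq_0_iff neg_equal_0_iff_equal zero_neq_numeral[symmetric] simp_thms
      power_eq_0_iff)

lemma xfac4_eq_1_iff:
  "4 * Z + 1 \<noteq> 0 \<Longrightarrow> psi4_factor Z \<noteq> 0 \<Longrightarrow>
    xfac4 Z = 1 \<longleftrightarrow> Z + 1 = 0 \<or> 1 + 25 * Z + 15 * Z ^ 2 - 95 * Z ^ 3 - 5 * Z ^ 4 = 0"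
  unfolding eq_iff_diff_eq_0[of "xfac4 Z"] xfac4_minus_1
  by (simp only: divide_eq_0_iff mult_eq_0_iff zero_neq_numeral[symmetric] simp_thms
      power_eq_0_iff)

lemma three_torsion_iff:
  fixes x y :: complex
  assumes "y ^ 2 = x ^ 3 + 1 / 4"
  shows "point_mult 0 3 (Affine x y) = Infinity \<longleftrightarrow> x = 0 \<or> x ^ 3 = - 1"
proof (cases "y = 0")
  case True
  have "x \<noteq> 0" "x ^ 3 \<noteq> - 1"
    using assms True by auto
  then show ?thesis using True by (simp add: numeral_3_eq_3 point_mult_Suc point_mult_0)
next
  case False
  define Z where "Z = x ^ 3"
  have W: "4 * Z + 1 \<noteq> 0" unfolding Z_def four_y_squared[OF assms] using False by simp
  have "point_mult 0 3 (Affine x y) = point_add 0 (Affine x y) (Affine (x * xfac2 Z) (y * yfac2 Z))"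
    using point_double[OF assms False] by (simp add: numeral_3_eq_3 point_mult_Suc point_mult_0 Z_def)
  then have "point_mult 0 3 (Affine x y) = Infinity \<longleftrightarrow> x = x * xfac2 Z \<and> y = - (y * yfac2 Z)"
    by (simp add: Let_def)
  also have "x = x * xfac2 Z \<longleftrightarrow> x = 0 \<or> Z + 1 = 0"
    using xfac2_eq_1_iff[OF W] by auto
  also have "Z + 1 = 0 \<longleftrightarrow> Z = - 1"
    by (rule eq_neg_iff_add_eq_0[symmetric])
  also have "(x = 0 \<or> Z = - 1) \<and> y = - (y * yfac2 Z) \<longleftrightarrow> x = 0 \<or> Z = - 1"
  proof -
    have "yfac2 Z = - 1" if "Z = 0 \<or> Z = - 1"
      using that by (auto simp: yfac2_def psi4_factor_def)
    moreover have "Z = 0" if "x = 0" using that by (simp add: Z_def)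
    ultimately show ?thesis by auto
  qed
  finally show ?thesis by (simp add: Z_def)
qed

text \<open>The multiples \<open>2P\<close>, \<open>3P\<close>, \<open>4P\<close> as long as the chord formulas apply.\<close>
lemma point_mult_2:
  fixes x y :: complex
  assumes "y ^ 2 = x ^ 3 + 1 / 4" "y \<noteq> 0"
  shows "point_mult 0 2 (Affine x y) = Affine (x * xfac2 (x ^ 3)) (y * yfac2 (x ^ 3))"
  using point_double[OF assms] by (simp add: numeral_2_eq_2 point_mult_Suc point_mult_0)

lemma point_mult_3:
  fixes x y :: complex
  assumes "y ^ 2 = x ^ 3 + 1 / 4" "y \<noteq> 0" "x \<noteq> 0" "x ^ 3 + 1 \<noteq> 0"
  shows "point_mult 0 3 (Affine x y) = Affine (x * xfac3 (x ^ 3)) (y * yfac3 (x ^ 3))"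
proof -
  have W: "4 * x ^ 3 + 1 \<noteq> 0" unfolding four_y_squared[OF assms(1)] using assms(2) by simp
  have "x ^ 3 \<noteq> 0" using assms(3) by simp
  note s = triple_factors[OF this assms(4) W]
  have "xfac2 (x ^ 3) \<noteq> 1" using xfac2_eq_1_iff[OF W] assms(4) by blast
  from point_add_chord[OF assms(1,3) this refl s(1)[symmetric] s(2)[symmetric]]
  show ?thesis using point_mult_2[OF assms(1,2)] point_mult_Suc[of 0 2 "Affine x y"] by simp
qed

lemma point_mult_4:
  fixes x y :: complex
  assumes "y ^ 2 = x ^ 3 + 1 / 4" "y \<noteq> 0" "x \<noteq> 0" "x ^ 3 + 1 \<noteq> 0" "psi4_factor (x ^ 3) \<noteq> 0"
  shows "point_mult 0 4 (Affine x y) = Affine (x * xfac4 (x ^ 3)) (y * yfac4 (x ^ 3))"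
proof -
  have W: "4 * x ^ 3 + 1 \<noteq> 0" unfolding four_y_squared[OF assms(1)] using assms(2) by simp
  have nz: "x ^ 3 \<noteq> 0" using assms(3) by simp
  note s = quadruple_factors[OF nz assms(4) W assms(5)]
  have "xfac3 (x ^ 3) \<noteq> 1" using xfac3_eq_1_iff[OF nz assms(4) W] assms(5) by blast
  from point_add_chord[OF assms(1,3) this refl s(1)[symmetric] s(2)[symmetric]]
  show ?thesis using point_mult_3[OF assms(1-4)] point_mult_Suc[of 0 3 "Affine x y"] by simp
qed

section \<open>The points of order 9\<close>

text \<open>
  On \<open>x\<close>-coordinates the endomorphism \<open>\<surd>-3\<close> of the curve is \<open>x \<mapsto> u = - (x\<^sup>3 + 1) / (3 x\<^sup>2)\<close>,
  so \<open>u\<^sup>3 = - (Z + 1)\<^sup>3 / (27 Z\<^sup>2)\<close> with \<open>Z = x\<^sup>3\<close>. The condition \<open>u\<^sup>3 = -1\<close> is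
  \<open>Z\<^sup>3 - 24 Z\<^sup>2 + 3 Z + 1 = 0\<close>. Up to sign, \<open>nine_poly\<close> is the numerator of the same cubic
  evaluated at \<open>u\<^sup>3\<close>.
\<close>
definition nine_poly :: "complex \<Rightarrow> complex" where
  "nine_poly Z = (Z ^ 3 - 24 * Z ^ 2 + 3 * Z + 1) ^ 3 + 729 * Z ^ 2 * (Z + 1) ^ 6"

lemma point_mult_two: "point_mult a 2 P = point_add a P P"
  by (simp add: numeral_2_eq_2 point_mult_Suc point_mult_0)

text \<open>
  If \<open>P\<close> has exact period 9, the points \<open>2P, \<dots>, 7P\<close> are all different from \<open>\<plusminus>P\<close>, so all
  chords through \<open>P\<close> are generic. Starting from \<open>8P = -P\<close>, reversing the chords one by one gives
  \<open>2P = -7P\<close>, \<open>3P = -6P\<close> and \<open>4P = -5P\<close>, and \<open>quintuple_condition\<close> applies.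
\<close>
lemma nine_torsion_necessary:
  fixes x y :: complex
  defines "P \<equiv> Affine x y"
  assumes P: "y ^ 2 = x ^ 3 + 1 / 4" and nine: "point_mult 0 9 P = Infinity" and three: "point_mult 0 3 P \<noteq> Infinity"
  shows "(x ^ 3) ^ 3 - 24 * (x ^ 3) ^ 2 + 3 * x ^ 3 + 1 = 0 \<or> nine_poly (x ^ 3) = 0"
proof -
  define Z where "Z = x ^ 3"
  have oncurve: "point_mult 0 k P \<in> curve_points UNIV 0 (1/4)" for k
    by (rule point_mult_on_curve) (use P in \<open>simp add: P_def curve_points_def\<close>)
  have mult_ex: "\<exists>u v. point_mult 0 k P = Affine u v \<and> v ^ 2 = u ^ 3 + 1 / 4 \<and> u \<noteq> x" if k: "1 < k" "k < 8" for k
  proof -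
    obtain u v where uv: "point_mult 0 k P = Affine u v"
      using point_mult_nine_cases[OF nine three, of k] k by (cases "point_mult 0 k P") auto
    have "u \<noteq> x"
    proof
      assume "u = x"
      moreover have "Affine x y \<in> curve_points UNIV 0 (1/4)" using P by (simp add: curve_points_def)
      ultimately have "v = y \<or> v = - y"
        using oncurve[of k] same_x_on_curve[of x y 0 "1/4" v] uv by auto
      moreover have "v \<noteq> y"
        using point_mult_nine_distinct[OF nine three, of 1 k] k uv \<open>u = x\<close>
        by (auto simp: point_mult_1 P_def)
      moreover have "v \<noteq> - y"
      proof
        assume "v = - y"
        then have "point_mult 0 (Suc k) P = Infinity"
          using uv \<open>u = x\<close> by (simp add: point_mult_Suc P_def)
        then show False using point_mult_nine_cases[OF nine three, of "Suc k"] k by simp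
      qed
      ultimately show False by blast
    qed
    then show ?thesis using uv oncurve[of k] by (auto simp: curve_points_def)
  qed
  have x0: "x \<noteq> 0" and Z1: "Z + 1 \<noteq> 0"
    using three three_torsion_iff[OF P] by (auto simp: P_def Z_def add_eq_0_iff2)
  have y0: "y \<noteq> 0"
    using point_mult_nine_cases[OF nine three, of 2] by (auto simp: P_def point_mult_two)
  have W: "4 * Z + 1 \<noteq> 0" unfolding Z_def four_y_squared[OF P] using y0 by simp
  have Z0: "Z \<noteq> 0" using x0 by (simp add: Z_def)
  have T: "psi4_factor Z \<noteq> 0"
  proof
    assume "psi4_factor Z = 0"
    then have "xfac3 Z = 1" using xfac3_eq_1_iff[OF Z0 Z1 W] by blast
    then show False using mult_ex[of 3] point_mult_3[OF P y0 x0] Z1 by (auto simp: P_def Z_def)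
  qed
  have four: "point_mult 0 4 P = Affine (x * xfac4 Z) (y * yfac4 Z)"
    using point_mult_4[OF P y0 x0] Z1 T by (simp add: Z_def P_def)
  then have xfac4: "xfac4 Z \<noteq> 1" using mult_ex[of 4] by auto
  define m where "m = (yfac4 Z - 1) / (xfac4 Z - 1)"
  define a5 where "a5 = (Z + 1 / 4) * m ^ 2 / Z - 1 - xfac4 Z"
  have five: "point_mult 0 5 P = Affine (x * a5) (y * (m * (1 - a5) - 1))"
    using point_add_chord[OF P x0 xfac4 m_def _ refl, folded Z_def, OF a5_def] point_mult_Suc[of 0 4 P] four
    by (simp add: P_def Z_def)
  obtain x7 y7 where P7: "point_mult 0 7 P = Affine x7 y7" "y7 ^ 2 = x7 ^ 3 + 1 / 4" "x7 \<noteq> x"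
    using mult_ex[of 7] by auto
  obtain x6 y6 where P6: "point_mult 0 6 P = Affine x6 y6" "x6 \<noteq> x"
    using mult_ex[of 6] by auto
  obtain x5 y5 where P5: "point_mult 0 5 P = Affine x5 y5" "x5 \<noteq> x"
    using mult_ex[of 5] by auto
  have P8: "point_mult 0 8 P = Affine x (- y)"
  proof -
    obtain u v where uv: "point_mult 0 8 P = Affine u v"
      using point_mult_nine_cases[OF nine three, of 8] by (cases "point_mult 0 8 P") auto
    have "point_add 0 P (point_mult 0 8 P) = Infinity"
      using nine point_mult_Suc[of 0 8 P] by simp
    then have "point_add 0 (Affine x y) (Affine u v) = Infinity" unfolding uv unfolding P_def .
    then have "u = x \<and> v = - y" by (auto simp: Let_def split: if_splits)
    then show ?thesis using uv by simp
  qed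
  have "point_add 0 (Affine x y) (Affine x7 y7) = Affine x (- y)"
    using P8 P7(1) point_mult_Suc[of 0 7 P] by (simp add: P_def)
  from point_double_of_tangent[OF P P7(2) y0 P7(3) this]
  have P2: "point_mult 0 2 P = Affine x7 (- y7)"
    unfolding point_mult_two P_def .
  have P3: "point_mult 0 3 P = Affine x6 (- y6)"
    using point_add_third_point[of x y x6 y6 x7 y7] P2 P6 P7 point_mult_Suc[of 0 6 P] point_mult_Suc[of 0 2 P]
    by (simp add: P_def)
  have "point_mult 0 4 P = Affine x5 (- y5)"
    using point_add_third_point[of x y x5 y5 x6 y6] P3 P5 P6 point_mult_Suc[of 0 5 P] point_mult_Suc[of 0 3 P]
    by (simp add: P_def)
  then have "a5 = xfac4 Z" using four five P5 x0 by auto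
  moreover have "u = 1 + 2 * v" if "u - 1 - v = v" for u v :: complex
    using that by (simp add: diff_eq_eq)
  ultimately have "(Z + 1 / 4) * m ^ 2 / Z = 1 + 2 * xfac4 Z"
    unfolding a5_def by blast
  then have "(Z + 1 / 4) * m ^ 2 = Z * (1 + 2 * xfac4 Z)"
    by (simp only: nonzero_divide_eq_eq[OF Z0] mult.commute)
  moreover have "w * (m * e) ^ 2 - Z * e ^ 2 * k = 0" if "w * m ^ 2 = Z * k" for w e k
    using that by Groebner_Basis.algebra
  moreover have "yfac4 Z - 1 = m * (xfac4 Z - 1)" using xfac4 by (simp add: m_def)
  ultimately have "(Z + 1 / 4) * (yfac4 Z - 1) ^ 2 - Z * (xfac4 Z - 1) ^ 2 * (1 + 2 * xfac4 Z) = 0"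
    by (simp only:)
  then have "- 81 * Z * (Z + 1) ^ 3 * (Z ^ 3 - 24 * Z ^ 2 + 3 * Z + 1) * nine_poly Z / ((4 * Z + 1) ^ 3 * psi4_factor Z ^ 6) = 0"
    unfolding quintuple_condition[OF W T] nine_poly_def .
  then show ?thesis
    using Z0 Z1 W T unfolding Z_def[symmetric] divide_eq_0_iff mult_eq_0_iff power_eq_0_iff by simp
qed

text \<open>
  At the roots of the two factors, the denominators of the multiples do not vanish, and \<open>2P\<close>,
  \<open>3P\<close>, \<open>4P\<close> differ from \<open>\<plusminus>P\<close>.
\<close>
lemma nine_poly_nonvanishing:
  assumes root: "Z ^ 3 - 24 * Z ^ 2 + 3 * Z + 1 = 0 \<or> nine_poly Z = 0"
  shows "Z + 1 \<noteq> 0 \<and> 4 * Z + 1 \<noteq> 0 \<and> psi4_factor Z \<noteq> 0 \<and> 1 + 25 * Z + 15 * Z ^ 2 - 95 * Z ^ 3 - 5 * Z ^ 4 \<noteq> 0"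
proof (intro conjI notI)
  assume "Z + 1 = 0"
  then have "Z = - 1" by (simp add: add_eq_0_iff2)
  then show False using root by (auto simp: nine_poly_def)
next
  assume W: "4 * Z + 1 = 0"
  show False
    using root
  proof
    assume "Z ^ 3 - 24 * Z ^ 2 + 3 * Z + 1 = 0"
    then show False using W by Groebner_Basis.algebra
  next
    assume "nine_poly Z = 0"
    then show False using W unfolding nine_poly_def by Groebner_Basis.algebra
  qed
next
  assume T: "psi4_factor Z = 0"
  show False
    using root
  proof
    assume "Z ^ 3 - 24 * Z ^ 2 + 3 * Z + 1 = 0"
    then show False using T unfolding psi4_factor_def by Groebner_Basis.algebra
  next
    assume "nine_poly Z = 0"
    then show False using T unfolding psi4_factor_def nine_poly_def by Groebner_Basis.algebra
  qed
next
  assume q: "1 + 25 * Z + 15 * Z ^ 2 - 95 * Z ^ 3 - 5 * Z ^ 4 = 0"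
  show False
    using root
  proof
    assume "Z ^ 3 - 24 * Z ^ 2 + 3 * Z + 1 = 0"
    then show False using q by Groebner_Basis.algebra
  next
    assume "nine_poly Z = 0"
    then show False using q unfolding nine_poly_def by Groebner_Basis.algebra
  qed
qed

lemma nine_torsion_sufficient:
  fixes x y :: complex
  assumes P: "y ^ 2 = x ^ 3 + 1 / 4"
    and root: "(x ^ 3) ^ 3 - 24 * (x ^ 3) ^ 2 + 3 * x ^ 3 + 1 = 0 \<or> nine_poly (x ^ 3) = 0"
  shows "point_mult 0 9 (Affine x y) = Infinity"
proof -
  define Z where "Z = x ^ 3"
  have root: "Z ^ 3 - 24 * Z ^ 2 + 3 * Z + 1 = 0 \<or> nine_poly Z = 0"
    using root by (simp add: Z_def)
  have x0: "x \<noteq> 0" using root by (auto simp: Z_def nine_poly_def)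
  then have Z0: "Z \<noteq> 0" by (simp add: Z_def)
  note nv = nine_poly_nonvanishing[OF root]
  have Z1: "Z + 1 \<noteq> 0" and W: "4 * Z + 1 \<noteq> 0" and T: "psi4_factor Z \<noteq> 0"
    and q: "1 + 25 * Z + 15 * Z ^ 2 - 95 * Z ^ 3 - 5 * Z ^ 4 \<noteq> 0"
    using nv by auto
  have y0: "y \<noteq> 0" using W four_y_squared[OF P] by (auto simp: Z_def)
  have "xfac2 Z \<noteq> 1" using xfac2_eq_1_iff[OF W] Z1 by blast
  have "xfac3 Z \<noteq> 1" using xfac3_eq_1_iff[OF Z0 Z1 W] T by blast
  have xfac4: "xfac4 Z \<noteq> 1" using xfac4_eq_1_iff[OF W T] Z1 q by blast
  define m where "m = (yfac4 Z - 1) / (xfac4 Z - 1)"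
  define a5 where "a5 = (Z + 1 / 4) * m ^ 2 / Z - 1 - xfac4 Z"
  note P1s = Z1[unfolded Z_def] T[unfolded Z_def]
  note two = point_mult_2[OF P y0, folded Z_def]
  note three = point_mult_3[OF P y0 x0 P1s(1), folded Z_def]
  note four = point_mult_4[OF P y0 x0 P1s, folded Z_def]
  have five: "point_mult 0 5 (Affine x y) = Affine (x * a5) (y * (m * (1 - a5) - 1))"
    using point_add_chord[OF P x0 xfac4 m_def _ refl, folded Z_def, OF a5_def] point_mult_Suc[of 0 4 "Affine x y"] four
    by (simp add: Z_def)
  have "(Z + 1 / 4) * (yfac4 Z - 1) ^ 2 - Z * (xfac4 Z - 1) ^ 2 * (1 + 2 * xfac4 Z) = 0"
    unfolding quintuple_condition[OF W T] using root by (auto simp: nine_poly_def)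
  moreover have c: "yfac4 Z - 1 = m * (xfac4 Z - 1)" using xfac4 by (simp add: m_def)
  moreover have "e ^ 2 * (w * m ^ 2) = e ^ 2 * (Z * k)" if "w * (m * e) ^ 2 - Z * e ^ 2 * k = 0" for w e k
    using that by Groebner_Basis.algebra
  ultimately have "(xfac4 Z - 1) ^ 2 * ((Z + 1 / 4) * m ^ 2) = (xfac4 Z - 1) ^ 2 * (Z * (1 + 2 * xfac4 Z))"
    by (simp only:)
  then have "(Z + 1 / 4) * m ^ 2 = Z * (1 + 2 * xfac4 Z)" using xfac4 by simp
  then have "a5 = xfac4 Z" unfolding a5_def using Z0 by simp
  moreover from this c have "m * (1 - a5) - 1 = - yfac4 Z" by (simp add: algebra_simps)
  ultimately have five: "point_mult 0 5 (Affine x y) = Affine (x * xfac4 Z) (- (y * yfac4 Z))"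
    using five by simp
  have six: "point_mult 0 6 (Affine x y) = Affine (x * xfac3 Z) (- (y * yfac3 Z))"
    using point_add_third_point[of x y "x * xfac3 Z" "y * yfac3 Z" "x * xfac4 Z" "y * yfac4 Z"] three four five xfac4 \<open>xfac3 Z \<noteq> 1\<close> x0
      point_mult_Suc[of 0 3 "Affine x y"] point_mult_Suc[of 0 5 "Affine x y"] by simp
  have seven: "point_mult 0 7 (Affine x y) = Affine (x * xfac2 Z) (- (y * yfac2 Z))"
    using point_add_third_point[of x y "x * xfac2 Z" "y * yfac2 Z" "x * xfac3 Z" "y * yfac3 Z"] two three six \<open>xfac2 Z \<noteq> 1\<close> \<open>xfac3 Z \<noteq> 1\<close> x0
      point_mult_Suc[of 0 2 "Affine x y"] point_mult_Suc[of 0 6 "Affine x y"] by simp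
  have eight: "point_mult 0 8 (Affine x y) = Affine x (- y)"
    using point_double_third_point[of x y "x * xfac2 Z" "y * yfac2 Z"] two seven \<open>xfac2 Z \<noteq> 1\<close> x0
      point_mult_Suc[of 0 7 "Affine x y"]
    by (simp add: point_mult_two)
  show ?thesis
    using eight point_mult_Suc[of 0 8 "Affine x y"] by simp
qed

section \<open>The 9-torsion points of \<open>y\<^sup>2 = x\<^sup>3 + 1/4\<close>\<close>

lemma cube_roots:
  fixes a b \<omega> :: complex
  assumes "\<omega> ^ 2 + \<omega> + 1 = 0" "a ^ 3 = b ^ 3"
  shows "\<exists>\<rho>\<in>{1, \<omega>, \<omega> ^ 2}. a = \<rho> * b"
proof -
  have "(a - b) * (a - \<omega> * b) * (a - \<omega> ^ 2 * b) = 0"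
    using assms by Groebner_Basis.algebra
  then show ?thesis by auto
qed

lemma cube_root_of_unity_cubed: "\<omega> ^ 2 + \<omega> + 1 = 0 \<Longrightarrow> \<rho> \<in> {1, \<omega>, \<omega> ^ 2} \<Longrightarrow> \<rho> ^ 3 = (1::complex)"
proof -
  assume o: "\<omega> ^ 2 + \<omega> + 1 = 0" and "\<rho> \<in> {1, \<omega>, \<omega> ^ 2}"
  have "\<omega> ^ 3 = 1" using o by Groebner_Basis.algebra
  then have "(\<omega> ^ 2) ^ 3 = 1" by Groebner_Basis.algebra
  then show ?thesis using \<open>\<omega> ^ 3 = 1\<close> \<open>\<rho> \<in> _\<close> by auto
qed

text \<open>
  The roots of \<open>t\<^sup>3 - 3 t + 1\<close> are \<open>\<zeta>\<^sup>k + \<zeta>\<^sup>-\<^sup>k\<close> for \<open>k = 1, 2, 4\<close>.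
\<close>
lemma cyclotomic_cubic_roots:
  fixes t w :: complex
  assumes "w ^ 3 - 3 * w + 1 = 0" "t ^ 3 - 3 * t + 1 = 0"
  shows "t \<in> {w, w ^ 2 - 2, 2 - w - w ^ 2}"
proof -
  have "(t - w) * (t - (w ^ 2 - 2)) * (t - (2 - w - w ^ 2)) = 0"
    using assms by Groebner_Basis.algebra
  then show ?thesis by auto
qed

text \<open>
  If \<open>\<surd>-3\<close> maps \<open>x\<close> to a cube root of \<open>-1\<close>, then after multiplication by a cube root of unity
  it maps \<open>x\<close> to \<open>-1\<close>. The equation for such \<open>s\<close> is reciprocal to that of
  \<open>\<zeta> + \<zeta>\<^sup>-\<^sup>1\<close>, see \<open>inverse_cyclotomic_mem\<close>.
\<close>
lemma cubic_factor_roots: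
  fixes x \<omega> :: complex
  assumes \<omega>: "\<omega> ^ 2 + \<omega> + 1 = 0" and x: "(x ^ 3) ^ 3 - 24 * (x ^ 3) ^ 2 + 3 * x ^ 3 + 1 = 0"
  shows "\<exists>\<rho>\<in>{1, \<omega>, \<omega> ^ 2}. \<exists>s. x = \<rho> * s \<and> s ^ 3 - 3 * s ^ 2 + 1 = 0"
proof -
  have "(x ^ 3 + 1) ^ 3 = (3 * x ^ 2) ^ 3" using x by Groebner_Basis.algebra
  from cube_roots[OF \<omega> this] obtain \<rho> where \<rho>: "\<rho> \<in> {1, \<omega>, \<omega> ^ 2}" "x ^ 3 + 1 = \<rho> * (3 * x ^ 2)"
    by blast
  have r3: "\<rho> ^ 3 = 1" by (rule cube_root_of_unity_cubed[OF \<omega> \<rho>(1)])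
  define s where "s = \<rho> ^ 2 * x"
  have "x = \<rho> * s" unfolding s_def using r3 by Groebner_Basis.algebra
  moreover have "s ^ 3 - 3 * s ^ 2 + 1 = 0" unfolding s_def using r3 \<rho>(2) by Groebner_Basis.algebra
  ultimately show ?thesis using \<rho>(1) by blast
qed

lemma nine_poly_roots:
  fixes x \<omega> :: complex
  assumes \<omega>: "\<omega> ^ 2 + \<omega> + 1 = 0" and x: "nine_poly (x ^ 3) = 0"
  shows "\<exists>\<rho>\<in>{1, \<omega>, \<omega> ^ 2}. \<exists>s r. x = \<rho> / r \<and> r \<noteq> 0 \<and> s ^ 3 - 3 * s ^ 2 + 1 = 0 \<and> r ^ 3 + 3 * r * s + 1 = 0"
proof -
  have x0: "x \<noteq> 0" using x by (auto simp: nine_poly_def)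
  \<comment> \<open>The \<open>x\<close>-coordinate of the image under \<open>\<surd>-3\<close>, which is a root of the cubic factor.\<close>
  define u where "u = - (x ^ 3 + 1) / (3 * x ^ 2)"
  have u: "3 * x ^ 2 * u = - (x ^ 3 + 1)" using x0 by (simp add: u_def)
  have "(x ^ 6) ^ 3 * ((u ^ 3) ^ 3 - 24 * (u ^ 3) ^ 2 + 3 * u ^ 3 + 1) = 0"
  proof -
    define v where "v = 3 * x ^ 2 * u"
    have "3 ^ 9 * ((x ^ 6) ^ 3 * ((u ^ 3) ^ 3 - 24 * (u ^ 3) ^ 2 + 3 * u ^ 3 + 1))
       = (v ^ 3) ^ 3 - 24 * (v ^ 3) ^ 2 * (27 * (x ^ 3) ^ 2) + 3 * v ^ 3 * (27 * (x ^ 3) ^ 2) ^ 2 + (27 * (x ^ 3) ^ 2) ^ 3"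
      unfolding v_def by Groebner_Basis.algebra
    also have "\<dots> = - nine_poly (x ^ 3)"
      unfolding nine_poly_def v_def u by Groebner_Basis.algebra
    finally show ?thesis using x by simp
  qed
  then have "(u ^ 3) ^ 3 - 24 * (u ^ 3) ^ 2 + 3 * u ^ 3 + 1 = 0" using x0 by simp
  from cubic_factor_roots[OF \<omega> this] obtain \<rho> s where \<rho>: "\<rho> \<in> {1, \<omega>, \<omega> ^ 2}" "u = \<rho> * s" "s ^ 3 - 3 * s ^ 2 + 1 = 0"
    by blast
  have r3: "\<rho> ^ 3 = 1" by (rule cube_root_of_unity_cubed[OF \<omega> \<rho>(1)])
  then have "\<rho> \<noteq> 0" by auto
  define r where "r = \<rho> / x"
  have "x = \<rho> / r" "r \<noteq> 0" using x0 \<open>\<rho> \<noteq> 0\<close> by (simp_all add: r_def)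
  moreover have "r ^ 3 + 3 * r * s + 1 = 0"
  proof -
    have rx: "r * x = \<rho>" using x0 by (simp add: r_def)
    have "x ^ 3 * (r ^ 3 + 3 * r * s + 1) = (r * x) ^ 3 + 3 * x ^ 2 * ((r * x) * s) + x ^ 3"
      by Groebner_Basis.algebra
    also have "\<dots> = 0" unfolding rx r3 \<rho>(2)[symmetric] u by simp
    finally have "x ^ 3 * (r ^ 3 + 3 * r * s + 1) = 0" .
    then show ?thesis using x0 by simp
  qed
  ultimately show ?thesis using \<rho> by blast
qed

lemma cubic_factor_point: "s ^ 3 - 3 * s ^ 2 + 1 = 0 \<Longrightarrow> (1 / 2 + s - s ^ 2) ^ 2 = s ^ 3 + 1 / (4 :: complex)"
  by Groebner_Basis.algebra

lemma cubic_factor_of_root: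
  "s ^ 3 - 3 * s ^ 2 + 1 = 0 \<Longrightarrow> (s ^ 3) ^ 3 - 24 * (s ^ 3) ^ 2 + 3 * s ^ 3 + 1 = (0 :: complex)"
  by Groebner_Basis.algebra

lemma nine_poly_of_root:
  fixes s r x :: complex
  assumes s: "s ^ 3 - 3 * s ^ 2 + 1 = 0" and r: "r ^ 3 + 3 * r * s + 1 = 0" and x: "x * r = 1"
  shows "nine_poly (x ^ 3) = 0"
proof -
  define g where "g = - 3 * r * s"
  have g: "1 + r ^ 3 = g" unfolding g_def using r by Groebner_Basis.algebra
  define Z where "Z = x ^ 3"
  have Z: "Z * r ^ 3 = 1" unfolding Z_def using x by Groebner_Basis.algebra
  have Z1: "(Z + 1) * r ^ 3 = g" using Z g by Groebner_Basis.algebra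
  have Zp: "(Z ^ 3 - 24 * Z ^ 2 + 3 * Z + 1) * (r ^ 3) ^ 3 = g ^ 3 - 27 * r ^ 3"
    using Z Z1 by Groebner_Basis.algebra
  have "nine_poly Z * ((r ^ 3) ^ 3) ^ 3 = (g ^ 3 - 27 * r ^ 3) ^ 3 + 729 * r ^ 3 * g ^ 6"
  proof -
    have "nine_poly Z * ((r ^ 3) ^ 3) ^ 3 = ((Z ^ 3 - 24 * Z ^ 2 + 3 * Z + 1) * (r ^ 3) ^ 3) ^ 3
       + 729 * (Z * r ^ 3) ^ 2 * r ^ 3 * ((Z + 1) * r ^ 3) ^ 6"
      unfolding nine_poly_def by Groebner_Basis.algebra
    then show ?thesis unfolding Zp Z1 Z by simp
  qed
  also have "\<dots> = 27 ^ 3 * (r ^ 3) ^ 3 * (27 * s ^ 6 - (s ^ 3 + 1) ^ 3)"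
    unfolding g_def by Groebner_Basis.algebra
  also have "27 * s ^ 6 - (s ^ 3 + 1) ^ 3 = 0"
    using s by Groebner_Basis.algebra
  finally show ?thesis using x unfolding Z_def by auto
qed

text \<open>
  Cardano's formula for \<open>r\<^sup>3 + 3 r s + 1\<close>: its roots are \<open>\<omega>\<^sup>k A + \<omega>\<^sup>-\<^sup>k B\<close> where
  \<open>A B = -s\<close> and \<open>A\<^sup>3 + B\<^sup>3 = -1\<close>. The relation between \<open>s\<close> and the 9th roots of unity makes
  \<open>A\<close> and \<open>B\<close> explicit multiples of \<open>c\<close> and \<open>c\<^sup>2\<close>, with coefficients in \<open>\<rat>(s)\<close>.
\<close>
lemma r_cubic_factor:
  fixes s c \<omega> :: complex
  assumes s: "s ^ 3 - 3 * s ^ 2 + 1 = 0" and c: "c ^ 3 = 3" and \<omega>: "\<omega> ^ 2 + \<omega> + 1 = 0"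
    and A: "A = (s ^ 2 - s - 2) / 3 * c" and B: "B = (2 * s - s ^ 2) / 3 * c ^ 2"
  shows "r ^ 3 + 3 * r * s + 1 = (r - (A + B)) * (r - (\<omega> * A + \<omega> ^ 2 * B)) * (r - (\<omega> ^ 2 * A + \<omega> * B))"
    and "A * B = - s"
proof -
  have A3: "3 * A = (s ^ 2 - s - 2) * c" and B3: "3 * B = (2 * s - s ^ 2) * c ^ 2"
    by (simp_all add: A B)
  have "9 * (A * B) = 9 * (- s)"
    using A3 B3 s c by Groebner_Basis.algebra
  then show AB: "A * B = - s" by simp
  have "27 * (A ^ 3 + B ^ 3) = (s ^ 2 - s - 2) ^ 3 * c ^ 3 + (2 * s - s ^ 2) ^ 3 * (c ^ 3) ^ 2"
    using A3 B3 by Groebner_Basis.algebra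
  also have "\<dots> = 27 * (- 1)"
    unfolding c using s by Groebner_Basis.algebra
  finally have A3B3: "A ^ 3 + B ^ 3 = - 1"
    by (simp only: mult_cancel_left zero_neq_numeral[symmetric] simp_thms)
  have "(r - (A + B)) * (r - (\<omega> * A + \<omega> ^ 2 * B)) * (r - (\<omega> ^ 2 * A + \<omega> * B))
     = r ^ 3 - 3 * (A * B) * r - (A ^ 3 + B ^ 3)"
    using \<omega> by Groebner_Basis.algebra
  then show "r ^ 3 + 3 * r * s + 1 = (r - (A + B)) * (r - (\<omega> * A + \<omega> ^ 2 * B)) * (r - (\<omega> ^ 2 * A + \<omega> * B))"
    unfolding AB A3B3 by simp
qed

lemma square_mem:
  assumes "subfield K CC" "y ^ 2 = z ^ 2" "z \<in> K"
  shows "y \<in> K"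
  using assms(2,3) subfield_uminus[OF assms(1)] by (auto simp: power2_eq_iff)

lemma three_torsion_coords:
  assumes K: "subfield K CC" and \<omega>: "\<omega> \<in> K" "\<omega> ^ 2 + \<omega> + 1 = 0"
    and P: "y ^ 2 = x ^ 3 + 1 / 4" and x: "x = 0 \<or> x ^ 3 = - 1"
  shows "x \<in> K \<and> y \<in> K"
  using x
proof
  note cl = subfield_closed[OF K]
  assume "x = 0"
  then show ?thesis
    using P square_mem[OF K, of y "1 / 2"] by (auto intro!: cl simp: power_divide)
next
  note cl = subfield_closed[OF K]
  assume "x ^ 3 = - 1"
  then have "x ^ 3 = (- 1) ^ 3" by simp
  from cube_roots[OF \<omega>(2) this] have "x \<in> K" using \<omega>(1) by (auto intro!: cl)
  moreover have "y ^ 2 = ((2 * \<omega> + 1) / 2) ^ 2"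
  proof -
    have "(2 * \<omega> + 1) ^ 2 = - 3" using \<omega>(2) by Groebner_Basis.algebra
    then show ?thesis unfolding power_divide P \<open>x ^ 3 = - 1\<close> by simp
  qed
  then have "y \<in> K" by (rule square_mem[OF K]) (use \<omega>(1) in \<open>auto intro!: cl\<close>)
  ultimately show ?thesis by blast
qed

lemma inverse_cyclotomic_mem:
  assumes K: "subfield K CC" and w: "w \<in> K" "w ^ 3 - 3 * w + 1 = 0" and s: "s ^ 3 - 3 * s ^ 2 + 1 = 0"
  shows "s \<in> K"
proof -
  note cl = subfield_closed[OF K]
  have s0: "s \<noteq> 0" using s by auto
  have "s ^ 3 * ((1 / s) ^ 3 - 3 * (1 / s) + 1) = s ^ 3 - 3 * s ^ 2 + 1"
    using s0 by (simp add: power_divide field_simps power2_eq_square power3_eq_cube)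
  then have "(1 / s) ^ 3 - 3 * (1 / s) + 1 = 0" using s s0 by simp
  from cyclotomic_cubic_roots[OF w(2) this] have "1 / s \<in> {w, w ^ 2 - 2, 2 - w - w ^ 2}" .
  moreover have "{w, w ^ 2 - 2, 2 - w - w ^ 2} \<subseteq> K" using w(1) by (auto intro!: cl)
  ultimately have "1 / s \<in> K" by blast
  then show ?thesis using subfield_inverse[OF K, of "1 / s"] by simp
qed

lemma nine_torsion_coords:
  assumes K: "subfield K CC" and \<omega>: "\<omega> \<in> K" "\<omega> ^ 2 + \<omega> + 1 = 0"
    and w: "w \<in> K" "w ^ 3 - 3 * w + 1 = 0" and c: "c \<in> K" "c ^ 3 = 3"
    and P: "y ^ 2 = x ^ 3 + 1 / 4" and nine: "point_mult 0 9 (Affine x y) = Infinity"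
  shows "x \<in> K \<and> y \<in> K"
proof -
  note cl = subfield_closed[OF K]
  have \<rho>: "\<rho> \<in> K" if "\<rho> \<in> {1, \<omega>, \<omega> ^ 2}" for \<rho>
    using that \<omega>(1) by (auto intro!: cl)
  consider (three) "point_mult 0 3 (Affine x y) = Infinity"
    | (p3) "(x ^ 3) ^ 3 - 24 * (x ^ 3) ^ 2 + 3 * x ^ 3 + 1 = 0"
    | (p9) "nine_poly (x ^ 3) = 0"
    using nine_torsion_necessary[OF P nine] by blast
  then show ?thesis
  proof cases
    case three
    then show ?thesis using three_torsion_coords[OF K \<omega> P] three_torsion_iff[OF P] by blast
  next
    case p3
    from cubic_factor_roots[OF \<omega>(2) this] obtain \<rho> s where rs: "\<rho> \<in> {1, \<omega>, \<omega> ^ 2}" "x = \<rho> * s" "s ^ 3 - 3 * s ^ 2 + 1 = 0"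
      by blast
    have "s \<in> K" by (rule inverse_cyclotomic_mem[OF K w rs(3)])
    moreover have "y ^ 2 = (1 / 2 + s - s ^ 2) ^ 2"
      unfolding P cubic_factor_point[OF rs(3)] rs(2) power_mult_distrib cube_root_of_unity_cubed[OF \<omega>(2) rs(1)] by simp
    then have "y \<in> K" by (rule square_mem[OF K]) (use \<open>s \<in> K\<close> in \<open>auto intro!: cl\<close>)
    ultimately show ?thesis using rs(1,2) \<rho> subfield_mult[OF K] by blast
  next
    case p9
    from nine_poly_roots[OF \<omega>(2) this] obtain \<rho> s r where rs: "\<rho> \<in> {1, \<omega>, \<omega> ^ 2}" "x = \<rho> / r" "r \<noteq> 0"
      "s ^ 3 - 3 * s ^ 2 + 1 = 0" "r ^ 3 + 3 * r * s + 1 = 0"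
      by blast
    have "s \<in> K" by (rule inverse_cyclotomic_mem[OF K w rs(4)])
    have "r \<in> K"
    proof -
      define A where "A = (s ^ 2 - s - 2) / 3 * c"
      define B where "B = (2 * s - s ^ 2) / 3 * c ^ 2"
      have "A \<in> K" "B \<in> K" unfolding A_def B_def using \<open>s \<in> K\<close> c(1) by (auto intro!: cl)
      then show ?thesis
        using r_cubic_factor(1)[OF rs(4) c(2) \<omega>(2) A_def B_def, of r] rs(5) \<omega>(1) by (auto intro!: cl)
    qed
    then have "x \<in> K" using rs(1,2) \<rho> subfield_divide[OF K] by blast
    define Z where "Z = x ^ 3"
    have "Z \<in> K" unfolding Z_def using \<open>x \<in> K\<close> by (rule subfield_power[OF K])
    have "Z - 2 \<noteq> 0"
    proof
      assume "Z - 2 = 0"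
      then have "Z = 2" by simp
      then show False using p9 by (simp add: Z_def[symmetric] nine_poly_def)
    qed
    have Zr: "Z * r ^ 3 = 1"
      using rs(3) cube_root_of_unity_cubed[OF \<omega>(2) rs(1)] unfolding Z_def rs(2) by (simp add: power_divide)
    have y: "y ^ 2 = Z + 1 / 4" using P by (simp add: Z_def)
    \<comment> \<open>The \<open>y\<close>-coordinate of the image under \<open>\<surd>-3\<close> is \<open>y (Z - 2)\<close> divided by \<open>3 (2 \<omega> + 1) Z\<close>, up to
      sign, and by \<open>cubic_factor_point\<close> it equals \<open>1/2 + s - s\<^sup>2\<close> up to sign.\<close>
    have "(y * (Z - 2)) ^ 2 = (3 * (2 * \<omega> + 1) * Z * (1 / 2 + s - s ^ 2)) ^ 2"
    proof -
      have "27 * Z ^ 2 * s ^ 3 = - ((Z + 1) ^ 3)"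
      proof -
        have "3 * r * s = - (r ^ 3 + 1)" using rs(5) by Groebner_Basis.algebra
        then have "(3 * r * s) ^ 3 * Z ^ 3 = - ((r ^ 3 + 1) ^ 3 * Z ^ 3)" by Groebner_Basis.algebra
        moreover have "(3 * r * s) ^ 3 * Z ^ 3 = 27 * Z ^ 2 * s ^ 3" using Zr by Groebner_Basis.algebra
        moreover have "(r ^ 3 + 1) ^ 3 * Z ^ 3 = (Z + 1) ^ 3" using Zr by Groebner_Basis.algebra
        ultimately show ?thesis by simp
      qed
      then have "27 * Z ^ 2 * (s ^ 3 + 1 / 4) = - ((Z + 1) ^ 3) + 27 / 4 * Z ^ 2"
        by (simp add: distrib_left)
      moreover have "(3 * (2 * \<omega> + 1) * Z * v) ^ 2 = - (27 * Z ^ 2 * v ^ 2)" for v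
        using \<omega>(2) by Groebner_Basis.algebra
      ultimately have "(3 * (2 * \<omega> + 1) * Z * (1 / 2 + s - s ^ 2)) ^ 2 = (Z + 1) ^ 3 - 27 / 4 * Z ^ 2"
        by (simp only: cubic_factor_point[OF rs(4)]) simp
      moreover have "(y * (Z - 2)) ^ 2 = (Z + 1) ^ 3 - 27 / 4 * Z ^ 2"
        unfolding power_mult_distrib y by (simp add: algebra_simps eval_nat_numeral)
      ultimately show ?thesis by simp
    qed
    then have "y * (Z - 2) \<in> K"
      by (rule square_mem[OF K]) (use \<open>s \<in> K\<close> \<open>Z \<in> K\<close> \<omega>(1) in \<open>auto intro!: cl\<close>)
    from subfield_divide[OF K this, of "Z - 2"] have "y * (Z - 2) / (Z - 2) \<in> K"
      using \<open>Z \<in> K\<close> cl(7,10) by blast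
    then show ?thesis using \<open>x \<in> K\<close> \<open>Z - 2 \<noteq> 0\<close> by simp
  qed
qed

text \<open>
  Conversely, the \<open>x\<close>-coordinates of 9-torsion points determine \<open>w\<close> (from \<open>x = 1/w\<close>) and the
  three roots of \<open>r\<^sup>3 + 3 r s + 1\<close>; combined with powers of \<open>\<omega>\<close> these isolate \<open>A\<close>, a nonzero
  multiple of \<open>c\<close> by an element of \<open>\<rat>(w)\<close>.
\<close>
lemma generators_from_nine_torsion:
  assumes L: "subfield L CC" and \<omega>: "\<omega> \<in> L" "\<omega> ^ 2 + \<omega> + 1 = 0"
    and w: "w ^ 3 - 3 * w + 1 = 0" and c: "c ^ 3 = 3"
    and tors: "\<And>x y. y ^ 2 = x ^ 3 + 1 / 4 \<Longrightarrow> point_mult 0 9 (Affine x y) = Infinity \<Longrightarrow> x \<in> L"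
  shows "w \<in> L \<and> c \<in> L"
proof -
  note cl = subfield_closed[OF L]
  define s where "s = 1 / w"
  have w0: "w \<noteq> 0" using w by auto
  have sw: "s * w = 1" using w0 by (simp add: s_def)
  then have s: "s ^ 3 - 3 * s ^ 2 + 1 = 0" using w by Groebner_Basis.algebra
  have "s \<in> L"
    by (rule tors[OF cubic_factor_point[OF s] nine_torsion_sufficient[OF cubic_factor_point[OF s]]])
       (use cubic_factor_of_root[OF s] in blast)
  then have "w \<in> L" using subfield_inverse[OF L, of s] by (simp add: s_def)
  define A where "A = (s ^ 2 - s - 2) / 3 * c"
  define B where "B = (2 * s - s ^ 2) / 3 * c ^ 2"
  note fac = r_cubic_factor[OF s c \<omega>(2) A_def B_def]
  have "r \<in> L" if r: "r ^ 3 + 3 * r * s + 1 = 0" for r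
  proof -
    have "r \<noteq> 0" using r by auto
    define y where "y = csqrt ((1 / r) ^ 3 + 1 / 4)"
    have y: "y ^ 2 = (1 / r) ^ 3 + 1 / 4" by (simp add: y_def)
    have "nine_poly ((1 / r) ^ 3) = 0"
      by (rule nine_poly_of_root[OF s r]) (use \<open>r \<noteq> 0\<close> in simp)
    then have "1 / r \<in> L"
      using tors[OF y] nine_torsion_sufficient[OF y] by blast
    then show ?thesis using subfield_inverse[OF L, of "1 / r"] by simp
  qed
  then have "A + B \<in> L" "\<omega> * A + \<omega> ^ 2 * B \<in> L" "\<omega> ^ 2 * A + \<omega> * B \<in> L"
    unfolding fac(1) by auto
  moreover have "A = ((A + B) + \<omega> ^ 2 * (\<omega> * A + \<omega> ^ 2 * B) + \<omega> * (\<omega> ^ 2 * A + \<omega> * B)) / 3"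
  proof -
    have "3 * A = (A + B) + \<omega> ^ 2 * (\<omega> * A + \<omega> ^ 2 * B) + \<omega> * (\<omega> ^ 2 * A + \<omega> * B)"
      using \<omega>(2) by Groebner_Basis.algebra
    then show ?thesis by simp
  qed
  ultimately have "A \<in> L" using \<omega>(1) by (metis cl(3,4,8,9,10))
  have "A \<noteq> 0" using fac(2) sw by auto
  then have "(s ^ 2 - s - 2) / 3 \<noteq> 0" by (simp add: A_def)
  then have "c = A / ((s ^ 2 - s - 2) / 3)" by (simp add: A_def)
  then have "c \<in> L" using \<open>A \<in> L\<close> \<open>s \<in> L\<close> by (auto intro!: cl)
  with \<open>w \<in> L\<close> show ?thesis by blast
qed

section \<open>The division fields\<close>

lemma algebraic_poly_preimage:
  fixes x :: complex
  assumes "algebraic (poly f x)" "\<And>i. coeff f i \<in> \<rat>" "degree f > 0"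
  shows "algebraic x"
proof -
  from assms(1) obtain q where q: "poly q (poly f x) = 0" "\<And>i. coeff q i \<in> \<int>" "q \<noteq> 0"
    by (elim algebraicE) auto
  show ?thesis
  proof (rule algebraicI')
    show "pcompose q f \<noteq> 0" using q(3) assms(3) by (auto simp: pcompose_eq_0_iff)
    show "coeff (pcompose q f) i \<in> \<rat>" for i
      by (rule coeff_pcompose_semiring_closed) (use q(2) assms(2) Ints_subset_Rats in auto)
    show "poly (pcompose q f) x = 0" using q(1) by (simp add: poly_pcompose)
  qed
qed

text \<open>
  Together with \<open>algebraic_twist\<close>: torsion points over \<open>\<complex>\<close> have algebraic coordinates, so the
  restriction to \<open>Qbar\<close> loses nothing.
\<close>
lemma algebraic_x_cubed_of_nine_torsion:
  fixes x y :: complex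
  assumes P: "y ^ 2 = x ^ 3 + 1 / 4" and nine: "point_mult 0 9 (Affine x y) = Infinity"
  shows "algebraic (x ^ 3)"
proof -
  define Z where "Z = x ^ 3"
  consider "Z = 0 \<or> Z = - 1" | "Z ^ 3 - 24 * Z ^ 2 + 3 * Z + 1 = 0" | "nine_poly Z = 0"
    using nine_torsion_necessary[OF P nine] three_torsion_iff[OF P] by (auto simp: Z_def)
  then have "algebraic Z"
  proof cases
    case 1
    then show ?thesis by auto
  next
    case 2
    have "poly [:1, 3, - 24, 1:] Z = Z ^ 3 - 24 * Z ^ 2 + 3 * Z + 1"
      by (simp add: algebra_simps power2_eq_square power3_eq_cube)
    then show ?thesis using 2
      by (intro algebraicI[of "[:1, 3, - 24, 1:]"]) (auto simp: coeff_pCons split: nat.splits)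
  next
    case 3
    \<comment> \<open>The expansion of \<open>nine_poly\<close>.\<close>
    let ?p = "[:1, 9, 684, 3972, 12033, 19647, - 3318, 6111, 657, 1:]"
    have "poly ?p Z = nine_poly Z"
      unfolding nine_poly_def by (simp only: poly_pCons poly_0 mult_zero_right) Groebner_Basis.algebra
    then show ?thesis using 3
      by (intro algebraicI[of ?p]) (auto simp: coeff_pCons split: nat.splits)
  qed
  then show ?thesis by (simp add: Z_def)
qed

text \<open>
  In the following, \<open>s\<close> is a sixth root of \<open>d\<close>, and \<open>y\<^sup>2 = x\<^sup>3 + 1/4\<close> is scaled by \<open>2 s\<close>.
\<close>
context
  fixes d :: rat and s :: complex
  assumes d: "d \<noteq> 0" and s6: "s ^ 6 = of_rat d"
begin

lemma s_nonzero: "s \<noteq> 0"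
  using d s6 by auto

lemma twist_on_curve:
  "(((2 * s) ^ 3 * y) ^ 2 = ((2 * s) ^ 2 * x) ^ 3 + 0 * ((2 * s) ^ 2 * x) + of_rat (16 * d)) \<longleftrightarrow>
    y ^ 2 = x ^ 3 + 1 / (4 :: complex)"
proof -
  have "((2 * s) ^ 3 * y) ^ 2 = 64 * s ^ 6 * y ^ 2"
    "((2 * s) ^ 2 * x) ^ 3 + 0 * ((2 * s) ^ 2 * x) + of_rat (16 * d) = 64 * s ^ 6 * (x ^ 3 + 1 / 4)"
    by (simp_all add: s6[symmetric] of_rat_mult power_mult_distrib algebra_simps)
  then show ?thesis using s_nonzero by simp
qed

lemma algebraic_twist:
  assumes "y ^ 2 = x ^ 3 + 1 / (4 :: complex)" "algebraic (x ^ 3)"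
  shows "algebraic ((2 * s) ^ 2 * x)" "algebraic ((2 * s) ^ 3 * y)"
proof -
  define e :: complex where "e = of_rat (1 / (64 * d))"
  have e: "e * (64 * s ^ 6) = 1" using d by (simp add: e_def s6 of_rat_divide of_rat_mult)
  then have "e \<noteq> 0" by auto
  have rat: "e \<in> \<rat>" by (simp add: e_def)
  show "algebraic ((2 * s) ^ 2 * x)"
  proof (rule algebraic_poly_preimage)
    have "poly (monom e 3) ((2 * s) ^ 2 * x) = (e * (64 * s ^ 6)) * x ^ 3"
      by (simp add: poly_monom power_mult_distrib)
    then show "algebraic (poly (monom e 3) ((2 * s) ^ 2 * x))" using assms(2) e by simp
  qed (use \<open>e \<noteq> 0\<close> rat in \<open>auto simp: degree_monom_eq\<close>)
  show "algebraic ((2 * s) ^ 3 * y)"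
  proof (rule algebraic_poly_preimage)
    have "poly [:- 1 / 4, 0, e:] ((2 * s) ^ 3 * y) = (e * (64 * s ^ 6)) * y ^ 2 - 1 / 4"
      by (simp add: power_mult_distrib power2_eq_square algebra_simps eval_nat_numeral)
    then show "algebraic (poly [:- 1 / 4, 0, e:] ((2 * s) ^ 3 * y))" using assms e by simp
  qed (use \<open>e \<noteq> 0\<close> rat in \<open>auto simp: coeff_pCons split: nat.splits\<close>)
qed

text \<open>The torsion points of the twist are the scaled torsion points of \<open>y\<^sup>2 = x\<^sup>3 + 1/4\<close>.\<close>
lemma torsion_coordinates_iff:
  assumes n: "n = 3 \<or> n = 9"
  shows "z \<in> coordinates (torsion_points Qbar 0 (of_rat (16 * d)) n) \<longleftrightarrow>
    (\<exists>x y. y ^ 2 = x ^ 3 + 1 / 4 \<and> point_mult 0 n (Affine x y) = Infinity \<and>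
      (z = (2 * s) ^ 2 * x \<or> z = (2 * s) ^ 3 * y))"
    (is "?l \<longleftrightarrow> ?r")
proof -
  have s0: "2 * s \<noteq> 0" using s_nonzero by simp
  have tors: "Affine u v \<in> torsion_points Qbar 0 (of_rat (16 * d)) n \<longleftrightarrow>
      y ^ 2 = x ^ 3 + 1 / 4 \<and> point_mult 0 n (Affine x y) = Infinity"
    if uv: "u = (2 * s) ^ 2 * x" "v = (2 * s) ^ 3 * y" for u v x y
  proof -
    have "point_mult 0 n (Affine u v) = Infinity \<longleftrightarrow> point_mult 0 n (Affine x y) = Infinity"
      using point_mult_scale[OF s0, of n "Affine x y"] scale_point_eq_Infinity
      by (simp add: uv)
    moreover have "algebraic u \<and> algebraic v"
      if P: "y ^ 2 = x ^ 3 + 1 / 4" and t: "point_mult 0 n (Affine x y) = Infinity"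
    proof -
      have "point_mult 0 9 (Affine x y) = Infinity"
        using n t point_mult_mod[of 0 3 "Affine x y" 9] by (auto simp: point_mult_0)
      from algebraic_x_cubed_of_nine_torsion[OF P this] algebraic_twist[OF P] show ?thesis
        by (simp add: uv)
    qed
    ultimately show ?thesis
      unfolding torsion_points_def curve_points_def using twist_on_curve[of y x] uv by auto
  qed
  show ?thesis
  proof
    assume ?l
    then obtain u v where uv: "Affine u v \<in> torsion_points Qbar 0 (of_rat (16 * d)) n" "z = u \<or> z = v"
      unfolding coordinates_def by auto
    define x where "x = u / (2 * s) ^ 2"
    define y where "y = v / (2 * s) ^ 3"
    have "u = (2 * s) ^ 2 * x" "v = (2 * s) ^ 3 * y" using s_nonzero by (simp_all add: x_def y_def)
    with tors[OF this] uv show ?r by blast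
  next
    assume ?r
    then show ?l unfolding coordinates_def using tors[OF refl refl] by blast
  qed
qed

lemma division_field_coords:
  assumes n: "n = 3 \<or> n = 9" and P: "y ^ 2 = x ^ 3 + 1 / 4" "point_mult 0 n (Affine x y) = Infinity"
  shows "(2 * s) ^ 2 * x \<in> Ed_division_field d n" "(2 * s) ^ 3 * y \<in> Ed_division_field d n"
proof -
  have "coordinates (torsion_points Qbar 0 (of_rat (16 * d)) n) \<subseteq> Ed_division_field d n"
    unfolding division_field_def using subset_adjoin_rat by simp
  then show "(2 * s) ^ 2 * x \<in> Ed_division_field d n" "(2 * s) ^ 3 * y \<in> Ed_division_field d n"
    using torsion_coordinates_iff[OF n] P by blast+
qed

lemma division_field_least:
  assumes n: "n = 3 \<or> n = 9" and K: "subfield K CC" "s \<in> K"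
    and "\<And>x y. y ^ 2 = x ^ 3 + 1 / 4 \<Longrightarrow> point_mult 0 n (Affine x y) = Infinity \<Longrightarrow> x \<in> K \<and> y \<in> K"
  shows "Ed_division_field d n \<subseteq> K"
  unfolding division_field_def
proof (rule adjoin_rat_least[OF K(1)])
  note cl = subfield_closed[OF K(1)]
  show "coordinates (torsion_points Qbar (of_rat 0) (of_rat (16 * d)) n) \<subseteq> K"
  proof
    fix z assume "z \<in> coordinates (torsion_points Qbar (of_rat 0) (of_rat (16 * d)) n)"
    then have "z \<in> coordinates (torsion_points Qbar 0 (of_rat (16 * d)) n)" by simp
    then obtain x y where "x \<in> K \<and> y \<in> K" "z = (2 * s) ^ 2 * x \<or> z = (2 * s) ^ 3 * y"
      unfolding torsion_coordinates_iff[OF n] using assms(4) by blast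
    then show "z \<in> K" using K(2) by (auto intro!: cl)
  qed
qed

lemma subfield_division_field: "subfield (Ed_division_field d n) CC"
  unfolding division_field_def by (rule subfield_adjoin_rat)

text \<open>
  Read off from the 3-torsion points \<open>(0, 1/2)\<close> and \<open>(-1, (2 \<omega> + 1) / 2)\<close>.
\<close>
lemma division_field_omega_s:
  assumes n: "n = 3 \<or> n = 9" and \<omega>: "\<omega> ^ 2 + \<omega> + 1 = 0"
  shows "\<omega> \<in> Ed_division_field d n" "s \<in> Ed_division_field d n"
proof -
  define L where "L = Ed_division_field d n"
  have L: "subfield L CC" unfolding L_def by (rule subfield_division_field)
  note cl = subfield_closed[OF L]
  have three: "point_mult 0 n (Affine x y) = Infinity" if "point_mult 0 3 (Affine x y) = Infinity" for x y :: complex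
    using n that point_mult_mod[of 0 3 "Affine x y" 9] by (auto simp: point_mult_0)
  have P0: "(1 / 2) ^ 2 = 0 ^ 3 + 1 / (4 :: complex)" by (simp add: power_divide)
  have P1: "((2 * \<omega> + 1) / 2) ^ 2 = (- 1) ^ 3 + 1 / 4"
  proof -
    have "(2 * \<omega> + 1) ^ 2 = - 3" using \<omega> by Groebner_Basis.algebra
    then show ?thesis unfolding power_divide by simp
  qed
  have "(2 * s) ^ 3 * (1 / 2) \<in> L"
    unfolding L_def by (rule division_field_coords(2)[OF n P0 three]) (simp add: three_torsion_iff[OF P0])
  from cl(8)[OF this cl(10)] have "(2 * s) ^ 3 * (1 / 2) / 4 \<in> L" .
  then have s3: "s ^ 3 \<in> L" by (simp add: power_mult_distrib)
  have "point_mult 0 n (Affine (- 1) ((2 * \<omega> + 1) / 2)) = Infinity"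
    by (rule three, subst three_torsion_iff[OF P1]) simp
  note mem = division_field_coords[OF n P1 this, folded L_def]
  from cl(8)[OF cl(5)[OF mem(1)] cl(10)] have "- ((2 * s) ^ 2 * - 1) / 4 \<in> L" .
  then have s2: "s ^ 2 \<in> L" by (simp add: power_mult_distrib)
  have "s ^ 3 / s ^ 2 \<in> L" using s3 s2 by (rule cl)
  then show "s \<in> Ed_division_field d n"
    using s_nonzero by (simp add: L_def power2_eq_square power3_eq_cube)
  have "((2 * s) ^ 3 * ((2 * \<omega> + 1) / 2) / (4 * s ^ 3) - 1) / 2 \<in> L"
    by (intro cl(1,7,8) mem(2) cl(4)[OF _ s3] cl(10))
  also have "(2 * s) ^ 3 * ((2 * \<omega> + 1) / 2) / (4 * s ^ 3) = 2 * \<omega> + 1"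
    using s_nonzero by (simp add: power_mult_distrib)
  finally show "\<omega> \<in> Ed_division_field d n" by (simp add: L_def)
qed

theorem division_field_3:
  assumes \<omega>: "\<omega> ^ 2 + \<omega> + 1 = 0"
  shows "Ed_division_field d 3 = adjoin_rat {\<omega>, s}"
proof (rule equalityI)
  show "Ed_division_field d 3 \<subseteq> adjoin_rat {\<omega>, s}"
  proof (rule division_field_least)
    fix x y :: complex
    assume P: "y ^ 2 = x ^ 3 + 1 / 4" and "point_mult 0 3 (Affine x y) = Infinity"
    then have "x = 0 \<or> x ^ 3 = - 1" using three_torsion_iff[OF P] by blast
    moreover have "\<omega> \<in> adjoin_rat {\<omega>, s}" using subset_adjoin_rat[of "{\<omega>, s}"] by simp
    ultimately show "x \<in> adjoin_rat {\<omega>, s} \<and> y \<in> adjoin_rat {\<omega>, s}"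
      using three_torsion_coords[OF subfield_adjoin_rat _ \<omega> P] by blast
  qed (use subset_adjoin_rat[of "{\<omega>, s}"] subfield_adjoin_rat in auto)
  show "adjoin_rat {\<omega>, s} \<subseteq> Ed_division_field d 3"
    by (rule adjoin_rat_least[OF subfield_division_field]) (use division_field_omega_s[OF _ \<omega>] in auto)
qed

theorem division_field_9:
  assumes \<omega>: "\<omega> ^ 2 + \<omega> + 1 = 0" and w: "w ^ 3 - 3 * w + 1 = 0" and c: "c ^ 3 = 3"
  shows "Ed_division_field d 9 = adjoin_rat {\<omega>, s, c, w}" (is "?L = ?K")
proof (rule equalityI)
  have K: "subfield ?K CC" by (rule subfield_adjoin_rat)
  have mem: "\<omega> \<in> ?K" "s \<in> ?K" "c \<in> ?K" "w \<in> ?K"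
    using subset_adjoin_rat[of "{\<omega>, s, c, w}"] by auto
  show "?L \<subseteq> ?K"
    by (rule division_field_least[OF _ K mem(2)], simp)
       (rule nine_torsion_coords[OF K mem(1) \<omega> mem(4) w mem(3) c])
  note L = subfield_division_field[of 9]
  note \<omega>s = division_field_omega_s[OF _ \<omega>, of 9]
  have "x \<in> ?L" if P: "y ^ 2 = x ^ 3 + 1 / 4" "point_mult 0 9 (Affine x y) = Infinity" for x y
  proof -
    note cl = subfield_closed[OF L]
    have "(2 * s) ^ 2 * x \<in> ?L" using division_field_coords(1)[OF _ P] by simp
    moreover have "(2 * s) ^ 2 \<in> ?L" using \<omega>s(2) by (intro cl) simp
    ultimately have "(2 * s) ^ 2 * x / (2 * s) ^ 2 \<in> ?L" by (rule cl(8))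
    then show ?thesis using s_nonzero by simp
  qed
  then have "w \<in> ?L \<and> c \<in> ?L"
    using generators_from_nine_torsion[OF L _ \<omega> w c] \<omega>s(1) by blast
  then show "?K \<subseteq> ?L"
    using \<omega>s by (intro adjoin_rat_least[OF L]) auto
qed

end

lemma primitive_root_3: "primitive_root_of_unity 3 \<omega> \<Longrightarrow> \<omega> ^ 2 + \<omega> + 1 = (0::complex)"
proof -
  assume "primitive_root_of_unity 3 \<omega>"
  then have "\<omega> ^ 3 = 1" "\<omega> \<noteq> 1" by (auto simp: primitive_root_of_unity_def dest: spec[of _ 1])
  have "(\<omega> - 1) * (\<omega> ^ 2 + \<omega> + 1) = 0" using \<open>\<omega> ^ 3 = 1\<close> by Groebner_Basis.algebra
  then show ?thesis using \<open>\<omega> \<noteq> 1\<close> by simp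
qed

lemma primitive_root_9:
  assumes "primitive_root_of_unity 9 \<zeta>"
  shows "(\<zeta> ^ 3) ^ 2 + \<zeta> ^ 3 + 1 = (0::complex)"
proof -
  have z: "\<zeta> ^ 9 = 1" "\<zeta> ^ 3 \<noteq> 1"
    using assms by (auto simp: primitive_root_of_unity_def)
  have "(\<zeta> ^ 3 - 1) * ((\<zeta> ^ 3) ^ 2 + \<zeta> ^ 3 + 1) = 0" using z(1) by Groebner_Basis.algebra
  then show ?thesis using z(2) by simp
qed

lemma cyclotomic_cubic:
  assumes "(\<zeta> ^ 3) ^ 2 + \<zeta> ^ 3 + 1 = (0::complex)"
  shows "(\<zeta> + inverse \<zeta>) ^ 3 - 3 * (\<zeta> + inverse \<zeta>) + 1 = 0"
proof -
  have "\<zeta> \<noteq> 0" using assms by auto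
  then have i: "\<zeta> * inverse \<zeta> = 1" by simp
  show ?thesis using assms i by Groebner_Basis.algebra
qed

section \<open>Cubes in \<open>\<rat>(\<omega>)\<close>\<close>

lemma no_int_cube:
  fixes T :: int
  assumes "m ^ 3 < k" "k < (m + 1) ^ 3"
  shows "T ^ 3 \<noteq> k"
proof
  assume "T ^ 3 = k"
  show False
  proof (cases "T \<le> m")
    case True
    then have "T ^ 3 \<le> m ^ 3" by (rule power_mono_odd[rotated]) simp
    then show False using \<open>T ^ 3 = k\<close> assms by simp
  next
    case False
    then have "m + 1 \<le> T" by simp
    then have "(m + 1) ^ 3 \<le> T ^ 3" by (rule power_mono_odd[rotated]) simp
    then show False using \<open>T ^ 3 = k\<close> assms by simp
  qed
qed

lemma rat_algebraic_int:
  fixes T :: rat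
  assumes "lead_coeff p = 1" "\<And>i. coeff p i \<in> \<int>" "poly p T = 0"
  shows "T \<in> \<int>"
proof -
  have "algebraic_int T" using assms by (intro algebraic_int.intros[of p]) auto
  moreover have "T \<in> \<rat>"
    by (metis Fract_of_int_quotient Rats_divide Rats_of_int Rat_cases)
  ultimately show ?thesis by (rule rational_algebraic_int_is_int)
qed

lemma no_rat_cube:
  fixes T :: rat and m k :: int
  assumes "m ^ 3 < k" "k < (m + 1) ^ 3"
  shows "T ^ 3 \<noteq> of_int k"
proof
  assume T: "T ^ 3 = of_int k"
  have "T \<in> \<int>"
    by (rule rat_algebraic_int[of "[:- of_int k, 0, 0, 1:]"])
       (use T in \<open>auto simp: coeff_pCons power3_eq_cube split: nat.splits\<close>)
  then obtain n where "T = of_int n" by (elim Ints_cases)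
  then have "(of_int (n ^ 3) :: rat) = of_int k" using T by simp
  then have "n ^ 3 = k" by (simp only: of_int_eq_iff)
  then show False using no_int_cube[OF assms] by blast
qed

lemma three_not_cube: "(T::rat) ^ 3 \<noteq> 3"
  and nine_not_cube: "T ^ 3 \<noteq> 9"
  and eighty_one_not_cube: "T ^ 3 \<noteq> 81"
  using no_rat_cube[of 1 3 T] no_rat_cube[of 2 9 T] no_rat_cube[of 4 81 T] by simp_all

lemma cyclotomic_cubic_irrational: "(T::rat) ^ 3 - 3 * T + 1 \<noteq> 0"
proof
  assume T: "T ^ 3 - 3 * T + 1 = 0"
  have "T \<in> \<int>"
    by (rule rat_algebraic_int[of "[:1, - 3, 0, 1:]"])
       (use T in \<open>auto simp: coeff_pCons power3_eq_cube algebra_simps split: nat.splits\<close>)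
  then obtain n where n: "T = of_int n" by (elim Ints_cases)
  have "(of_int (n ^ 3 - 3 * n + 1) :: rat) = of_int 0" using T n by simp
  then have "n ^ 3 - 3 * n + 1 = 0" by (simp only: of_int_eq_iff)
  then have "n * (3 - n ^ 2) = 1" by (simp add: algebra_simps power2_eq_square power3_eq_cube)
  then have "n = 1 \<or> n = - 1" using zmult_eq_1_iff by blast
  then show False using \<open>n * (3 - n ^ 2) = 1\<close> by auto
qed

lemma dimension_adjoin_sqrt':
  assumes K: "subfield K CC" and x: "x ^ 2 \<in> K"
  shows "ring.dimension CC (if x \<in> K then 1 else 2) K (adjoin K x)"
  using dimension_adjoin_sqrt[OF K x] dimension_self[OF K] adjoin_trivial[OF K] by auto

lemma dimension_mult:
  assumes "subfield K CC" "subfield L CC" "ring.dimension CC m K L" "ring.dimension CC n L M"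
  shows "ring.dimension CC (m * n) K M"
  by (rule CC.telescopic_base[OF assms])

context
  fixes \<omega> :: complex
  assumes \<omega>: "\<omega> ^ 2 + \<omega> + 1 = 0"
begin

lemma cnj_of_rat: "cnj (of_rat r) = of_rat r"
  by (cases r) (simp add: of_rat_rat)

text \<open>
  \<open>\<rat>(\<omega>)\<close>, generated by \<open>2 \<omega> + 1\<close>, a square root of \<open>-3\<close>.
\<close>
definition "omega_field = adjoin \<rat> (2 * \<omega> + 1)"

lemma sqrt_minus3_squared: "(2 * \<omega> + 1) ^ 2 = - 3"
  using \<omega> by Groebner_Basis.algebra

lemma sqrt_minus3_irrational: "2 * \<omega> + 1 \<notin> \<rat>"
proof
  assume "2 * \<omega> + 1 \<in> \<rat>"
  then obtain q where "2 * \<omega> + 1 = of_rat q" by (elim Rats_cases)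
  then have "(of_rat (q ^ 2) :: complex) = of_rat (- 3)" using sqrt_minus3_squared by (simp add: of_rat_power of_rat_minus)
  then have "q ^ 2 = - 3" by (simp only: of_rat_eq_iff)
  then show False by (metis not_numeral_le_zero neg_0_le_iff_le zero_le_power2)
qed

lemma subfield_omega_field: "subfield omega_field CC"
  unfolding omega_field_def by (rule subfield_adjoin)

lemma omega_in_omega_field: "\<omega> \<in> omega_field"
proof -
  note cl = subfield_closed[OF subfield_omega_field]
  have "2 * \<omega> + 1 \<in> omega_field" unfolding omega_field_def by (rule mem_adjoin)
  from cl(8)[OF cl(7)[OF this cl(1)] cl(10)] have "((2 * \<omega> + 1) - 1) / 2 \<in> omega_field" .
  then show ?thesis by simp
qed

lemma omega_field_iff: "z \<in> omega_field \<longleftrightarrow> (\<exists>p q. z = of_rat p + of_rat q * (2 * \<omega> + 1))"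
proof -
  have "z \<in> omega_field \<longleftrightarrow> (\<exists>p\<in>\<rat>. \<exists>q\<in>\<rat>. z = p + q * (2 * \<omega> + 1))"
    unfolding omega_field_def by (subst adjoin_sqrt_eq[OF subfield_rat]) (auto simp: sqrt_minus3_squared)
  then show ?thesis by (auto simp: Rats_def)
qed

lemma dimension_omega_field: "ring.dimension CC 2 \<rat> omega_field"
  unfolding omega_field_def by (rule dimension_adjoin_sqrt[OF subfield_rat _ sqrt_minus3_irrational]) (simp add: sqrt_minus3_squared)

lemma omega_cubed: "\<omega> ^ 3 = 1"
  using \<omega> by Groebner_Basis.algebra

lemma sqrt_in_omega_field_iff:
  assumes v: "v ^ 2 = of_rat d"
  shows "v \<in> omega_field \<longleftrightarrow> (\<exists>t. d = t ^ 2 \<or> d = - 3 * t ^ 2)"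
proof
  assume "v \<in> omega_field"
  then obtain p q where pq: "v = of_rat p + of_rat q * (2 * \<omega> + 1)" unfolding omega_field_iff by blast
  have "of_rat (2 * p * q) * (2 * \<omega> + 1) = v ^ 2 - of_rat (p ^ 2 - 3 * q ^ 2)"
  proof -
    have "v ^ 2 = of_rat p ^ 2 + of_rat q ^ 2 * (2 * \<omega> + 1) ^ 2 + 2 * of_rat p * of_rat q * (2 * \<omega> + 1)"
      unfolding pq by Groebner_Basis.algebra
    then show ?thesis unfolding sqrt_minus3_squared by (simp add: of_rat_mult of_rat_diff of_rat_power algebra_simps)
  qed
  then have *: "of_rat (2 * p * q) * (2 * \<omega> + 1) = of_rat (d - (p ^ 2 - 3 * q ^ 2))"
    by (simp add: v of_rat_diff)
  have "p * q = 0"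
  proof (rule ccontr)
    assume "p * q \<noteq> 0"
    then have "of_rat (2 * p * q) \<noteq> (0::complex)" by simp
    then have "2 * \<omega> + 1 = of_rat (d - (p ^ 2 - 3 * q ^ 2)) / of_rat (2 * p * q)"
      using * by (metis nonzero_mult_div_cancel_left)
    then show False using sqrt_minus3_irrational by (metis Rats_of_rat Rats_divide)
  qed
  moreover from this have "2 * p * q = 0" by simp
  with * have "(of_rat (d - (p ^ 2 - 3 * q ^ 2)) :: complex) = of_rat 0"
    by (simp only: of_rat_0 mult_zero_left)
  then have "d - (p ^ 2 - 3 * q ^ 2) = 0" by (simp only: of_rat_eq_iff)
  then have "d = p ^ 2 - 3 * q ^ 2" by simp
  ultimately have "d = p ^ 2 \<or> d = - 3 * q ^ 2" by auto
  then show "\<exists>t. d = t ^ 2 \<or> d = - 3 * t ^ 2" by blast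
next
  assume "\<exists>t. d = t ^ 2 \<or> d = - 3 * t ^ 2"
  then obtain t where "d = t ^ 2 \<or> d = - 3 * t ^ 2" by blast
  then have "v ^ 2 = of_rat t ^ 2 \<or> v ^ 2 = (of_rat t * (2 * \<omega> + 1)) ^ 2"
    using v by (auto simp: of_rat_mult of_rat_power of_rat_minus power_mult_distrib sqrt_minus3_squared)
  moreover have "of_rat t \<in> omega_field" "of_rat t * (2 * \<omega> + 1) \<in> omega_field"
    using omega_in_omega_field by (intro subfield_closed[OF subfield_omega_field])+
  ultimately show "v \<in> omega_field" using square_mem[OF subfield_omega_field] by blast
qed

lemma rat_cube_in_omega_field:
  assumes "of_rat q = m ^ 3" "m \<in> omega_field"
  shows "\<exists>t. q = t ^ 3"
proof -
  have "\<exists>m\<in>\<rat>. (of_rat q :: complex) = m ^ 3"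
    by (rule cube_in_adjoin_sqrt[OF subfield_rat _ _ assms(2)[unfolded omega_field_def] assms(1)])
       (simp_all add: sqrt_minus3_squared)
  then obtain t where "(of_rat q :: complex) = of_rat (t ^ 3)"
    by (auto elim!: Rats_cases simp: of_rat_power)
  then show ?thesis by (simp only: of_rat_eq_iff) blast
qed

lemma norm_of_omega_field:
  assumes "m \<in> omega_field"
  shows "\<exists>N. m * cnj m = of_rat N" "\<exists>T. m + cnj m = of_rat T"
proof -
  obtain p q where pq: "m = of_rat p + of_rat q * (2 * \<omega> + 1)" using assms unfolding omega_field_iff by blast
  define e where "e = 2 * \<omega> + 1"
  have e: "e ^ 2 = - 3" using sqrt_minus3_squared by (simp add: e_def)
  have "cnj e = - e"
  proof -
    have "(cnj e) ^ 2 = e ^ 2" using e by (metis complex_cnj_power complex_cnj_minus complex_cnj_numeral)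
    then have "cnj e = e \<or> cnj e = - e" by (simp only: power2_eq_iff)
    moreover have False if "cnj e = e"
    proof -
      from that have "e = of_real (Re e)" by (simp add: complex_eq_iff)
      then have "(of_real (Re e ^ 2) :: complex) = of_real (- 3)" using e by (metis of_real_power of_real_minus of_real_numeral)
      then have "Re e ^ 2 = - 3" by (simp only: of_real_eq_iff)
      then show False by (metis not_numeral_le_zero neg_0_le_iff_le zero_le_power2)
    qed
    ultimately show ?thesis by blast
  qed
  then have c: "cnj m = of_rat p - of_rat q * e" by (simp add: pq e_def[symmetric] cnj_of_rat)
  have "m * cnj m = of_rat p ^ 2 - of_rat q ^ 2 * e ^ 2"
    unfolding c unfolding pq e_def[symmetric] by Groebner_Basis.algebra
  then have "m * cnj m = of_rat (p ^ 2 + 3 * q ^ 2)"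
    unfolding e by (simp add: of_rat_add of_rat_mult of_rat_power)
  then show "\<exists>N. m * cnj m = of_rat N" by blast
  have "m + cnj m = of_rat (2 * p)"
    unfolding c unfolding pq e_def[symmetric] by (simp add: of_rat_mult)
  then show "\<exists>T. m + cnj m = of_rat T" by blast
qed

lemma norm_omega: "\<omega> * cnj \<omega> = 1" "\<omega> + cnj \<omega> = - 1"
proof -
  have "norm \<omega> ^ 3 = 1" using omega_cubed by (metis norm_power norm_one)
  then have "norm \<omega> = 1" using power_eq_1_iff[of "norm \<omega>" 3] norm_ge_zero by simp
  then show n: "\<omega> * cnj \<omega> = 1" by (simp add: complex_norm_square[symmetric])
  have "\<omega> * (\<omega> + cnj \<omega> + 1) = 0" using n \<omega> by Groebner_Basis.algebra
  moreover have "\<omega> \<noteq> 0" using n by auto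
  ultimately have "\<omega> + cnj \<omega> + 1 = 0" by simp
  then show "\<omega> + cnj \<omega> = - 1" by (simp add: eq_neg_iff_add_eq_0)
qed

text \<open>
  \<open>\<omega>\<close> is not a power of 3 times a cube of \<open>\<rat>(\<omega>)\<close>. The norm of such an equation excludes
  \<open>i \<noteq> 0\<close>. If \<open>\<omega> = m\<^sup>3\<close>, then \<open>m\<close> has norm 1, and its trace would be a rational root of
  \<open>T\<^sup>3 - 3 T + 1\<close>.
\<close>
lemma omega_cube_class:
  assumes "m \<in> omega_field" "i < 3"
  shows "\<omega> \<noteq> 3 ^ i * m ^ 3"
proof
  assume eq: "\<omega> = 3 ^ i * m ^ 3"
  obtain N where N: "m * cnj m = of_rat N" using norm_of_omega_field[OF assms(1)] by blast
  have "1 = (3 ^ i * m ^ 3) * cnj (3 ^ i * m ^ 3)"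
    using norm_omega(1) eq by simp
  also have "\<dots> = (3 ^ i) ^ 2 * (m * cnj m) ^ 3"
    by (simp add: power_mult_distrib power2_eq_square)
  also have "\<dots> = of_rat ((3 ^ i) ^ 2 * N ^ 3)"
    unfolding N by (simp add: of_rat_mult of_rat_power)
  finally have "(of_rat 1 :: complex) = of_rat ((3 ^ i) ^ 2 * N ^ 3)" by simp
  then have N3: "(3 ^ i) ^ 2 * N ^ 3 = 1" by (simp only: of_rat_eq_iff)
  then have "N \<noteq> 0" by auto
  then have inv: "(1 / N) ^ 3 = (3 ^ i) ^ 2" using N3 by (simp add: power_divide field_simps)
  have "i = 0 \<or> i = 1 \<or> i = 2" using assms(2) by auto
  then have "i = 0" using inv nine_not_cube[of "1 / N"] eighty_one_not_cube[of "1 / N"] by auto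
  then have "N ^ 3 = 1" using N3 by simp
  have "N = 1"
  proof -
    have "(N - 1) * (N ^ 2 + N + 1) = 0" using \<open>N ^ 3 = 1\<close> by Groebner_Basis.algebra
    moreover have "N ^ 2 + N + 1 = (N + 1 / 2) ^ 2 + 3 / 4"
      by (simp add: power2_eq_square algebra_simps)
    moreover have "(N + 1 / 2) ^ 2 + 3 / 4 \<noteq> 0"
      by (metis add_nonneg_pos less_irrefl zero_le_power2 zero_less_divide_iff zero_less_numeral)
    ultimately show ?thesis by simp
  qed
  obtain T where T: "m + cnj m = of_rat T" using norm_of_omega_field[OF assms(1)] by blast
  have m3: "m ^ 3 = \<omega>" using eq \<open>i = 0\<close> by simp
  then have "cnj m ^ 3 = cnj \<omega>" by (metis complex_cnj_power)
  moreover have "(m + u) ^ 3 - 3 * (m * u) * (m + u) = m ^ 3 + u ^ 3" for u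
    by Groebner_Basis.algebra
  ultimately have "(m + cnj m) ^ 3 - 3 * (m * cnj m) * (m + cnj m) = \<omega> + cnj \<omega>"
    using m3 by simp
  then have "of_rat T ^ 3 - 3 * (of_rat T :: complex) = - 1"
    unfolding T N norm_omega \<open>N = 1\<close> by simp
  then have "(of_rat (T ^ 3 - 3 * T + 1) :: complex) = of_rat 0"
    by (simp add: of_rat_add of_rat_diff of_rat_mult of_rat_power)
  then have "T ^ 3 - 3 * T + 1 = 0" by (simp only: of_rat_eq_iff)
  then show False using cyclotomic_cubic_irrational by blast
qed

text \<open>
  For rational \<open>d\<close>, taking norms removes \<open>\<omega>\<close> and moves the cube from \<open>\<rat>(\<omega>)\<close> down to \<open>\<rat>\<close>.
\<close>
lemma rat_cube_class:
  assumes d: "d \<noteq> 0" and m: "m \<in> omega_field" and eq: "of_rat d = \<omega> ^ j * 3 ^ i * m ^ 3"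
  shows "\<exists>t. d = 3 ^ i * t ^ 3"
proof -
  obtain N where N: "m * cnj m = of_rat N" using norm_of_omega_field[OF m] by blast
  define b where "b = d / 3 ^ i"
  have b: "of_rat b = \<omega> ^ j * m ^ 3" unfolding b_def by (simp add: of_rat_divide of_rat_power eq)
  have "of_rat b ^ 2 = (\<omega> ^ j * m ^ 3) * cnj (\<omega> ^ j * m ^ 3)"
    unfolding b[symmetric] by (simp add: power2_eq_square cnj_of_rat)
  also have "\<dots> = (\<omega> * cnj \<omega>) ^ j * (m * cnj m) ^ 3"
    by (simp add: power_mult_distrib)
  finally have "(of_rat (b ^ 2) :: complex) = of_rat (N ^ 3)"
    unfolding norm_omega N by (simp add: of_rat_power)
  then have bN: "b ^ 2 = N ^ 3" by (simp only: of_rat_eq_iff)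
  have "b \<noteq> 0" using d by (simp add: b_def)
  then have "N \<noteq> 0" using bN by auto
  then have "b = (b / N) ^ 3" using bN by (simp add: power_divide power2_eq_square power3_eq_cube field_simps)
  moreover have "d = 3 ^ i * b" by (simp add: b_def)
  ultimately show ?thesis by metis
qed

end

section \<open>The degrees of the division fields\<close>

text \<open>\<open>d\<close> is a square in \<open>\<rat>(\<omega>)\<close>, see \<open>sqrt_in_omega_field_iff\<close>.\<close>
definition square_over_omega :: "rat \<Rightarrow> bool" where
  "square_over_omega d \<longleftrightarrow> (\<exists>t. d = t ^ 2 \<or> d = - 3 * t ^ 2)"

definition rat_cube :: "rat \<Rightarrow> bool" where
  "rat_cube d \<longleftrightarrow> (\<exists>t. d = t ^ 3)"

text \<open>
  Equivalently, \<open>d\<close> is a cube in \<open>\<rat>(c)\<close> with \<open>c\<^sup>3 = 3\<close>.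
\<close>
definition cube_up_to_3 :: "rat \<Rightarrow> bool" where
  "cube_up_to_3 d \<longleftrightarrow> (\<exists>i<3. \<exists>t. d = 3 ^ i * t ^ 3)"

lemma dimension_adjoin_cbrt':
  assumes K: "subfield K CC" and \<omega>: "\<omega> \<in> K" "\<omega> ^ 2 + \<omega> + 1 = 0" and x: "x ^ 3 \<in> K"
  shows "ring.dimension CC (if \<exists>m\<in>K. x ^ 3 = m ^ 3 then 1 else 3) K (adjoin K x)"
proof (cases "\<exists>m\<in>K. x ^ 3 = m ^ 3")
  case True
  then obtain m where m: "m \<in> K" "x ^ 3 = m ^ 3" by blast
  note cl = subfield_closed[OF K]
  from cube_roots[OF \<omega>(2) m(2)] have "x \<in> K" using \<omega>(1) m(1) by (auto intro!: cl)
  then show ?thesis using True adjoin_trivial[OF K] dimension_self[OF K] by simp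
next
  case False
  then have "y ^ 3 \<noteq> x ^ 3" if "y \<in> K" for y using that by (auto dest: sym)
  with False show ?thesis using dimension_adjoin_cbrt[OF K x] by simp
qed

context
  fixes \<omega> s :: complex and d :: rat
  assumes \<omega>: "\<omega> ^ 2 + \<omega> + 1 = 0" and d: "d \<noteq> 0" and s6: "s ^ 6 = of_rat d"
begin

text \<open>
  \<open>\<rat>(\<omega>, \<surd>d)\<close>; note that \<open>s\<^sup>3\<close> is a square root of \<open>d\<close>, and \<open>s\<^sup>2\<close> a cube root.
\<close>
definition "omega_sqrt_field = adjoin (omega_field \<omega>) (s ^ 3)"

lemma subfield_omega_sqrt_field: "subfield omega_sqrt_field CC"
  unfolding omega_sqrt_field_def by (rule subfield_adjoin)

lemma omega_field_subset: "omega_field \<omega> \<subseteq> omega_sqrt_field"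
  unfolding omega_sqrt_field_def by (rule subset_adjoin)

lemma omega_in_omega_sqrt_field: "\<omega> \<in> omega_sqrt_field"
  using omega_field_subset omega_in_omega_field[OF \<omega>] by blast

lemma s3_squared: "(s ^ 3) ^ 2 = of_rat d"
  and s2_cubed: "(s ^ 2) ^ 3 = of_rat d"
  using s6 by simp_all

lemma dimension_omega_sqrt_field: "ring.dimension CC (2 * (if square_over_omega d then 1 else 2)) \<rat> omega_sqrt_field"
proof (rule dimension_mult[OF subfield_rat subfield_omega_field[OF \<omega>] dimension_omega_field[OF \<omega>]])
  have "s ^ 3 \<in> omega_field \<omega> \<longleftrightarrow> square_over_omega d"
    unfolding square_over_omega_def by (rule sqrt_in_omega_field_iff[OF \<omega> s3_squared])
  moreover have "(s ^ 3) ^ 2 \<in> omega_field \<omega>"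
    unfolding s3_squared by (rule subfield_of_rat[OF subfield_omega_field[OF \<omega>]])
  ultimately show "ring.dimension CC (if square_over_omega d then 1 else 2) (omega_field \<omega>) omega_sqrt_field"
    unfolding omega_sqrt_field_def using dimension_adjoin_sqrt'[OF subfield_omega_field[OF \<omega>], of "s ^ 3"] by metis
qed

lemma cube_in_omega_sqrt_field:
  assumes "b \<in> omega_field \<omega>" "m \<in> omega_sqrt_field" "b = m ^ 3"
  shows "\<exists>m\<in>omega_field \<omega>. b = m ^ 3"
proof (rule cube_in_adjoin_sqrt[OF subfield_omega_field[OF \<omega>] _ assms(1) assms(2)[unfolded omega_sqrt_field_def] assms(3)])
  show "(s ^ 3) ^ 2 \<in> omega_field \<omega>"
    unfolding s3_squared by (rule subfield_of_rat[OF subfield_omega_field[OF \<omega>]])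
qed

lemma rat_cube_in_omega_sqrt_field_iff: "(\<exists>m\<in>omega_sqrt_field. of_rat q = m ^ 3) \<longleftrightarrow> rat_cube q"
proof
  assume "\<exists>m\<in>omega_sqrt_field. of_rat q = m ^ 3"
  then have "\<exists>m\<in>omega_field \<omega>. of_rat q = m ^ 3"
    using cube_in_omega_sqrt_field subfield_of_rat[OF subfield_omega_field[OF \<omega>]] by blast
  then show "rat_cube q" unfolding rat_cube_def using rat_cube_in_omega_field[OF \<omega>] by blast
next
  assume "rat_cube q"
  then obtain t where "of_rat q = (of_rat t :: complex) ^ 3" by (auto simp: rat_cube_def of_rat_power)
  then show "\<exists>m\<in>omega_sqrt_field. of_rat q = m ^ 3" using subfield_of_rat[OF subfield_omega_sqrt_field] by blast
qed

lemma mem_of_square_cube: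
  assumes "subfield L CC" "s ^ 3 \<in> L" "s ^ 2 \<in> L"
  shows "s \<in> L"
proof -
  have "s ^ 3 / s ^ 2 \<in> L" using assms by (intro subfield_divide)
  moreover have "s \<noteq> 0" using s6 d by auto
  ultimately show ?thesis by (simp add: power2_eq_square power3_eq_cube)
qed

lemma omega_sqrt_field_least:
  assumes "subfield L CC" "\<omega> \<in> L" "s \<in> L"
  shows "omega_sqrt_field \<subseteq> L"
  unfolding omega_sqrt_field_def omega_field_def[OF \<omega>]
  using assms by (intro adjoin_least subfield_Rats subfield_closed)

lemma s3_in_omega_sqrt_field: "s ^ 3 \<in> omega_sqrt_field"
  unfolding omega_sqrt_field_def by (rule mem_adjoin)

lemma adjoin_rat_omega_s: "adjoin_rat {\<omega>, s} = adjoin omega_sqrt_field (s ^ 2)"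
proof (rule equalityI)
  have "s ^ 3 \<in> adjoin omega_sqrt_field (s ^ 2)" "\<omega> \<in> adjoin omega_sqrt_field (s ^ 2)"
    using subset_adjoin s3_in_omega_sqrt_field omega_in_omega_sqrt_field by blast+
  then show "adjoin_rat {\<omega>, s} \<subseteq> adjoin omega_sqrt_field (s ^ 2)"
    using mem_of_square_cube[OF subfield_adjoin _ mem_adjoin]
    by (intro adjoin_rat_least[OF subfield_adjoin]) auto
  have "\<omega> \<in> adjoin_rat {\<omega>, s}" "s \<in> adjoin_rat {\<omega>, s}" using subset_adjoin_rat[of "{\<omega>, s}"] by auto
  then show "adjoin omega_sqrt_field (s ^ 2) \<subseteq> adjoin_rat {\<omega>, s}"
    by (intro adjoin_least[OF subfield_adjoin_rat] omega_sqrt_field_least subfield_power subfield_adjoin_rat)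
qed

theorem degree_3:
  "degree_over_rat (adjoin_rat {\<omega>, s}) (2 * (if square_over_omega d then 1 else 2) * (if rat_cube d then 1 else 3))"
proof -
  have "(s ^ 2) ^ 3 \<in> omega_sqrt_field" unfolding s2_cubed by (rule subfield_of_rat[OF subfield_omega_sqrt_field])
  from dimension_adjoin_cbrt'[OF subfield_omega_sqrt_field omega_in_omega_sqrt_field \<omega> this]
  have "ring.dimension CC (if rat_cube d then 1 else 3) omega_sqrt_field (adjoin omega_sqrt_field (s ^ 2))"
    unfolding s2_cubed rat_cube_in_omega_sqrt_field_iff .
  then show ?thesis
    unfolding adjoin_rat_omega_s by (rule dimension_mult[OF subfield_rat subfield_omega_sqrt_field dimension_omega_sqrt_field])
qed

context
  fixes c \<zeta> :: complex
  assumes c: "c ^ 3 = 3" and \<zeta>: "\<zeta> ^ 3 = \<omega>"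
begin

lemma c_noncube: "y \<in> omega_sqrt_field \<Longrightarrow> y ^ 3 \<noteq> c ^ 3"
proof
  assume "y \<in> omega_sqrt_field" "y ^ 3 = c ^ 3"
  then have "\<exists>m\<in>omega_sqrt_field. of_rat 3 = m ^ 3" using c by (intro bexI[of _ y]) simp_all
  then show False unfolding rat_cube_in_omega_sqrt_field_iff rat_cube_def using three_not_cube by metis
qed

lemma c3_mem: "c ^ 3 \<in> omega_sqrt_field"
  unfolding c by (rule subfield_numeral[OF subfield_omega_sqrt_field])

lemma zeta_noncube: "y \<in> adjoin omega_sqrt_field c \<Longrightarrow> y ^ 3 \<noteq> \<zeta> ^ 3"
proof
  assume "y \<in> adjoin omega_sqrt_field c" "y ^ 3 = \<zeta> ^ 3"
  then have "\<omega> = y ^ 3" using \<zeta> by simp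
  from cube_in_adjoin_cbrt[OF subfield_omega_sqrt_field c3_mem c_noncube omega_in_omega_sqrt_field \<open>y \<in> _\<close> this]
  obtain i m where im: "i < 3" "m \<in> omega_sqrt_field" "\<omega> = 3 ^ i * m ^ 3" unfolding c by blast
  then have "\<omega> / 3 ^ i = m ^ 3" by simp
  moreover have "\<omega> / 3 ^ i \<in> omega_field \<omega>"
    using omega_in_omega_field[OF \<omega>] by (intro subfield_closed[OF subfield_omega_field[OF \<omega>]])
  ultimately obtain m' where m': "m' \<in> omega_field \<omega>" "\<omega> / 3 ^ i = m' ^ 3"
    using cube_in_omega_sqrt_field im(2) by blast
  then have "\<omega> = 3 ^ i * m' ^ 3" by (simp add: field_simps)
  then show False using omega_cube_class[OF \<omega> m'(1) im(1)] by blast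
qed

lemma zeta3_mem: "\<zeta> ^ 3 \<in> adjoin omega_sqrt_field c"
  unfolding \<zeta> using omega_in_omega_sqrt_field subset_adjoin by blast

lemma rat_cube_in_tower_iff: "(\<exists>m\<in>adjoin (adjoin omega_sqrt_field c) \<zeta>. of_rat d = m ^ 3) \<longleftrightarrow> cube_up_to_3 d"
proof
  assume "\<exists>m\<in>adjoin (adjoin omega_sqrt_field c) \<zeta>. of_rat d = m ^ 3"
  then obtain y where y: "y \<in> adjoin (adjoin omega_sqrt_field c) \<zeta>" "of_rat d = y ^ 3" by blast
  have "\<exists>j<3. \<exists>m\<in>adjoin omega_sqrt_field c. of_rat d = (\<zeta> ^ 3) ^ j * m ^ 3"
    by (rule cube_in_adjoin_cbrt[OF subfield_adjoin zeta3_mem zeta_noncube subfield_of_rat[OF subfield_adjoin] y])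
  then obtain j m where jm: "m \<in> adjoin omega_sqrt_field c" "of_rat d = \<omega> ^ j * m ^ 3" unfolding \<zeta> by blast
  have \<omega>0: "\<omega> \<noteq> 0" using \<omega> by auto
  have "of_rat d / \<omega> ^ j \<in> omega_sqrt_field"
    using omega_in_omega_sqrt_field by (intro subfield_closed[OF subfield_omega_sqrt_field])
  moreover have "of_rat d / \<omega> ^ j = m ^ 3" using jm \<omega>0 by simp
  ultimately obtain i m1 where im: "i < 3" "m1 \<in> omega_sqrt_field" "of_rat d / \<omega> ^ j = 3 ^ i * m1 ^ 3"
    using cube_in_adjoin_cbrt[OF subfield_omega_sqrt_field c3_mem c_noncube _ jm(1), of "of_rat d / \<omega> ^ j"]
    unfolding c by blast
  then have "of_rat d / \<omega> ^ j / 3 ^ i = m1 ^ 3" by simp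
  moreover have "of_rat d / \<omega> ^ j / 3 ^ i \<in> omega_field \<omega>"
    using omega_in_omega_field[OF \<omega>] by (intro subfield_closed[OF subfield_omega_field[OF \<omega>]])
  ultimately obtain m2 where m2: "m2 \<in> omega_field \<omega>" "of_rat d / \<omega> ^ j / 3 ^ i = m2 ^ 3"
    using cube_in_omega_sqrt_field im(2) by blast
  then have "of_rat d = \<omega> ^ j * 3 ^ i * m2 ^ 3" using \<omega>0 by (simp add: field_simps)
  from rat_cube_class[OF \<omega> d m2(1) this] show "cube_up_to_3 d"
    unfolding cube_up_to_3_def using im(1) by blast
next
  assume "cube_up_to_3 d"
  then obtain i t where it: "d = 3 ^ i * t ^ 3" unfolding cube_up_to_3_def by blast
  have "of_rat d = (c ^ i * of_rat t) ^ 3"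
  proof -
    have "(c ^ i * of_rat t) ^ 3 = (c ^ 3) ^ i * of_rat t ^ 3"
      by (simp add: power_mult_distrib power_mult[symmetric] mult.commute)
    then show ?thesis unfolding c it by (simp add: of_rat_mult of_rat_power)
  qed
  moreover have "c \<in> adjoin (adjoin omega_sqrt_field c) \<zeta>" using mem_adjoin subset_adjoin by blast
  then have "c ^ i * of_rat t \<in> adjoin (adjoin omega_sqrt_field c) \<zeta>"
    by (intro subfield_closed[OF subfield_adjoin])
  ultimately show "\<exists>m\<in>adjoin (adjoin omega_sqrt_field c) \<zeta>. of_rat d = m ^ 3" by blast
qed

lemma adjoin_rat_tower: "adjoin_rat {\<omega>, s, c, \<zeta>} = adjoin (adjoin (adjoin omega_sqrt_field c) \<zeta>) (s ^ 2)" (is "?L = ?R")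
proof (rule equalityI)
  have sub: "omega_sqrt_field \<subseteq> ?R" "c \<in> ?R" "\<zeta> \<in> ?R"
    using subset_adjoin mem_adjoin by blast+
  then have "s \<in> ?R"
    using mem_of_square_cube[OF subfield_adjoin _ mem_adjoin] s3_in_omega_sqrt_field by blast
  then show "?L \<subseteq> ?R"
    using sub omega_in_omega_sqrt_field by (intro adjoin_rat_least[OF subfield_adjoin]) auto
  have "\<omega> \<in> ?L" "s \<in> ?L" "c \<in> ?L" "\<zeta> \<in> ?L" using subset_adjoin_rat[of "{\<omega>, s, c, \<zeta>}"] by auto
  then show "?R \<subseteq> ?L"
    by (intro adjoin_least[OF subfield_adjoin_rat] omega_sqrt_field_least subfield_power subfield_adjoin_rat)
qed

theorem degree_9:
  "degree_over_rat (adjoin_rat {\<omega>, s, c, \<zeta>}) (2 * (if square_over_omega d then 1 else 2) * 3 * 3 * (if cube_up_to_3 d then 1 else 3))"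
proof -
  have "ring.dimension CC 3 omega_sqrt_field (adjoin omega_sqrt_field c)"
    by (rule dimension_adjoin_cbrt[OF subfield_omega_sqrt_field c3_mem c_noncube])
  note D1 = dimension_mult[OF subfield_rat subfield_omega_sqrt_field dimension_omega_sqrt_field this]
  have "ring.dimension CC 3 (adjoin omega_sqrt_field c) (adjoin (adjoin omega_sqrt_field c) \<zeta>)"
    by (rule dimension_adjoin_cbrt[OF subfield_adjoin zeta3_mem zeta_noncube])
  note D2 = dimension_mult[OF subfield_rat subfield_adjoin D1 this]
  have mem: "(s ^ 2) ^ 3 \<in> adjoin (adjoin omega_sqrt_field c) \<zeta>"
    unfolding s2_cubed by (rule subfield_of_rat[OF subfield_adjoin])
  have "\<omega> \<in> adjoin (adjoin omega_sqrt_field c) \<zeta>" using omega_in_omega_sqrt_field subset_adjoin by blast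
  from dimension_adjoin_cbrt'[OF subfield_adjoin this \<omega> mem]
  have "ring.dimension CC (if cube_up_to_3 d then 1 else 3) (adjoin (adjoin omega_sqrt_field c) \<zeta>)
      (adjoin (adjoin (adjoin omega_sqrt_field c) \<zeta>) (s ^ 2))"
    unfolding s2_cubed rat_cube_in_tower_iff .
  from dimension_mult[OF subfield_rat subfield_adjoin D2 this]
  show ?thesis unfolding adjoin_rat_tower .
qed

end

end

lemma degree_unique: "degree_over_rat K m \<Longrightarrow> degree_over_rat K n \<longleftrightarrow> n = m"
  using CC.dimension_is_inj[OF subfield_rat] by blast

section \<open>Sixth-power-free numbers\<close>

text \<open>
  Write \<open>v = a / b\<close> in lowest terms. Then \<open>b\<^sup>6\<close> divides \<open>16 k\<close>, which is less than \<open>4\<^sup>6 = 4096\<close>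
  and not divisible by \<open>2\<^sup>6\<close> or \<open>3\<^sup>6\<close>, so \<open>b = 1\<close>; and \<open>a\<^sup>6\<close> divides \<open>16 d\<close>.
\<close>
lemma sixth_power_free_ratio:
  fixes d v :: rat and k :: int
  assumes pf: "rat_power_free 6 (16 * d)" and d: "d = of_int k * v ^ 6" "d \<noteq> 0"
    and k: "16 * \<bar>k\<bar> < 4096" "\<not> 2 ^ 6 dvd 16 * k" "\<not> 3 ^ 6 dvd 16 * k"
  shows "d = of_int k"
proof -
  from pf obtain m :: int where m: "16 * d = of_int m" "power_free 6 m" unfolding rat_power_free_def by blast
  obtain a b where ab: "v = of_int a / of_int b" "b > 0" "coprime a b"
    by (metis quotient_of_div quotient_of_denom_pos quotient_of_coprime surj_pair)
  have "(of_int (16 * k * a ^ 6) :: rat) = of_int (m * b ^ 6)"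
    using m(1) ab(2) unfolding d(1) ab(1) by (simp add: power_divide field_simps)
  then have eq: "16 * k * a ^ 6 = m * b ^ 6" by (simp only: of_int_eq_iff)
  have k0: "k \<noteq> 0" using d by auto
  have "b ^ 6 dvd 16 * k"
  proof -
    have "b ^ 6 dvd 16 * k * a ^ 6" using eq by simp
    moreover have "coprime (b ^ 6) (a ^ 6)" using ab(3) by (simp add: coprime_commute)
    ultimately show ?thesis by (simp add: coprime_dvd_mult_left_iff)
  qed
  have "b = 1"
  proof (rule ccontr)
    assume "b \<noteq> 1"
    have "\<bar>b ^ 6\<bar> \<le> \<bar>16 * k\<bar>"
      using \<open>b ^ 6 dvd 16 * k\<close> k0 by (intro dvd_imp_le_int) auto
    then have "b ^ 6 < 4 ^ 6" using k(1) by (simp add: abs_mult)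
    then have "b < 4" using ab(2) by (metis power_less_imp_less_base zero_le_numeral)
    then have "b = 2 \<or> b = 3" using \<open>b \<noteq> 1\<close> ab(2) by auto
    then show False using \<open>b ^ 6 dvd 16 * k\<close> k(2,3) by auto
  qed
  then have "m = a ^ 6 * (16 * k)" using eq by (simp add: mult.commute)
  then have "a ^ 6 dvd m" by simp
  then have "a dvd 1" using m(2) unfolding power_free_def by blast
  then have "a = 1 \<or> a = - 1" by auto
  then show ?thesis using d(1) ab(1) \<open>b = 1\<close> by auto
qed

lemma square_and_cube:
  assumes "(d::rat) \<noteq> 0" "e \<noteq> 0" "d = e * p ^ 2" "d = e * q ^ 3"
  shows "\<exists>v. d = e * v ^ 6"
proof -
  have pq: "p ^ 2 = q ^ 3" using assms by simp
  have "q \<noteq> 0" using assms by auto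
  have "(p / q) ^ 6 = (p ^ 2) ^ 3 / (q ^ 3) ^ 2" by (simp add: power_divide)
  also have "\<dots> = q ^ 3" unfolding pq using \<open>q \<noteq> 0\<close> by (simp add: power_mult[symmetric] eval_nat_numeral)
  finally show ?thesis using assms(4) by (intro exI[of _ "p / q"]) simp
qed

text \<open>
  In each case \<open>d\<close> is \<open>k\<close> times a square and \<open>k\<close> times a cube, where \<open>k\<close> is the asserted value.
\<close>
lemma sixth_class:
  fixes d :: rat
  assumes pf: "rat_power_free 6 (16 * d)" and d0: "d \<noteq> 0"
  shows "d = t ^ 2 \<Longrightarrow> d = 1 * u ^ 3 \<Longrightarrow> d = 1"
    and "d = - 3 * t ^ 2 \<Longrightarrow> d = 1 * u ^ 3 \<Longrightarrow> d = - 27"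
    and "d = t ^ 2 \<Longrightarrow> d = 3 * u ^ 3 \<Longrightarrow> d = 81"
    and "d = - 3 * t ^ 2 \<Longrightarrow> d = 3 * u ^ 3 \<Longrightarrow> d = - 3"
    and "d = t ^ 2 \<Longrightarrow> d = 9 * u ^ 3 \<Longrightarrow> d = 9"
    and "d = - 3 * t ^ 2 \<Longrightarrow> d = 9 * u ^ 3 \<Longrightarrow> d = - 243"
proof -
  have *: "d = of_int k" if "d = of_int k * p ^ 2" "d = of_int k * q ^ 3"
    and k: "16 * \<bar>k\<bar> < 4096" "\<not> 2 ^ 6 dvd 16 * k" "\<not> 3 ^ 6 dvd 16 * k" for k p q
  proof -
    have "of_int k \<noteq> (0::rat)" using that(1) d0 by auto
    from square_and_cube[OF d0 this that(1,2)] obtain v where "d = of_int k * v ^ 6" by blast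
    from sixth_power_free_ratio[OF pf this d0 k] show ?thesis .
  qed
  show "d = t ^ 2 \<Longrightarrow> d = 1 * u ^ 3 \<Longrightarrow> d = 1"
    using *[of 1 t u] by simp
  show "d = - 3 * t ^ 2 \<Longrightarrow> d = 1 * u ^ 3 \<Longrightarrow> d = - 27"
    using *[of "- 27" "t / 3" "- u / 3"] by (simp add: power_divide)
  show "d = t ^ 2 \<Longrightarrow> d = 3 * u ^ 3 \<Longrightarrow> d = 81"
    using *[of 81 "t / 9" "u / 3"] by (simp add: power_divide)
  show "d = - 3 * t ^ 2 \<Longrightarrow> d = 3 * u ^ 3 \<Longrightarrow> d = - 3"
    using *[of "- 3" t "- u"] by simp
  show "d = t ^ 2 \<Longrightarrow> d = 9 * u ^ 3 \<Longrightarrow> d = 9"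
    using *[of 9 "t / 3" u] by (simp add: power_divide)
  show "d = - 3 * t ^ 2 \<Longrightarrow> d = 9 * u ^ 3 \<Longrightarrow> d = - 243"
    using *[of "- 243" "t / 9" "- u / 3"] by (simp add: power_divide)
qed

lemma rat_cube_inj:
  fixes x y :: rat
  assumes "x ^ 3 = y ^ 3"
  shows "x = y"
proof -
  have less: "a ^ 3 < b ^ 3" if "a < b" for a b :: rat
  proof -
    have "b ^ 3 - a ^ 3 = (b - a) * ((b + a / 2) ^ 2 + 3 / 4 * a ^ 2)"
      by (simp add: power2_eq_square power3_eq_cube algebra_simps)
    moreover have "(b + a / 2) ^ 2 + 3 / 4 * a ^ 2 > 0"
      using that by (cases "a = 0") (auto intro: add_nonneg_pos)
    ultimately show ?thesis using that by (metis diff_gt_0_iff_gt mult_pos_pos)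
  qed
  show ?thesis using less[of x y] less[of y x] assms by (cases x y rule: linorder_cases) auto
qed

lemma cube_up_to_3I: "d = t ^ 3 \<Longrightarrow> cube_up_to_3 d" "d = 3 * t ^ 3 \<Longrightarrow> cube_up_to_3 d" "d = 9 * t ^ 3 \<Longrightarrow> cube_up_to_3 d"
  unfolding cube_up_to_3_def
  by (rule exI[of _ 0], force, rule exI[of _ 1], force, rule exI[of _ 2], force)

lemma cube_up_to_3E:
  assumes "cube_up_to_3 d"
  obtains t where "d = t ^ 3" | t where "d = 3 * t ^ 3" | t where "d = 9 * t ^ 3"
proof -
  obtain i t where it: "i < 3" "d = 3 ^ i * t ^ 3" using assms unfolding cube_up_to_3_def by blast
  then have "i = 0 \<or> i = 1 \<or> i = 2" by auto
  then show thesis using it that by auto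
qed

context
  fixes d :: rat
  assumes d0: "d \<noteq> 0" and pf: "rat_power_free 6 (16 * d)"
begin

lemma square_over_omegaD:
  assumes "square_over_omega d"
  shows "d = t ^ 3 \<Longrightarrow> d = 1 \<or> d = - 27" "d = 3 * t ^ 3 \<Longrightarrow> d = 81 \<or> d = - 3" "d = 9 * t ^ 3 \<Longrightarrow> d = 9 \<or> d = - 243"
proof -
  obtain u where u: "d = u ^ 2 \<or> d = - 3 * u ^ 2" using assms unfolding square_over_omega_def by blast
  note sc = sixth_class[OF pf d0, of u t]
  show "d = t ^ 3 \<Longrightarrow> d = 1 \<or> d = - 27" using u sc(1,2)[unfolded mult_1] by blast
  show "d = 3 * t ^ 3 \<Longrightarrow> d = 81 \<or> d = - 3" using u sc(3,4) by blast
  show "d = 9 * t ^ 3 \<Longrightarrow> d = 9 \<or> d = - 243" using u sc(5,6) by blast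
qed

lemma square_over_omega_values: "d \<in> {1, - 3, 9, - 27, 81, - 243} \<Longrightarrow> square_over_omega d"
proof -
  assume "d \<in> {1, - 3, 9, - 27, 81, - 243}"
  then have "d = 1 ^ 2 \<or> d = - 3 * 1 ^ 2 \<or> d = 3 ^ 2 \<or> d = - 3 * 3 ^ 2 \<or> d = 9 ^ 2 \<or> d = - 3 * 9 ^ 2"
    by simp
  then show ?thesis unfolding square_over_omega_def by blast
qed

lemma square_and_cube_iff: "square_over_omega d \<and> rat_cube d \<longleftrightarrow> d \<in> {1, - 27}"
proof
  show "square_over_omega d \<and> rat_cube d \<Longrightarrow> d \<in> {1, - 27}"
    using square_over_omegaD(1) unfolding rat_cube_def by blast
  assume *: "d \<in> {1, - 27}"
  then have "d = 1 ^ 3 \<or> d = (- 3) ^ 3" by simp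
  then show "square_over_omega d \<and> rat_cube d" using square_over_omega_values * unfolding rat_cube_def by blast
qed

lemma cube_not_square_iff:
  "rat_cube d \<and> \<not> square_over_omega d \<longleftrightarrow> (\<exists>t. t \<noteq> 0 \<and> t \<noteq> 1 \<and> t \<noteq> - 3 \<and> d = t ^ 3)"
proof
  assume *: "rat_cube d \<and> \<not> square_over_omega d"
  then obtain t where t: "d = t ^ 3" unfolding rat_cube_def by blast
  have "t \<noteq> 0" using t d0 by auto
  moreover have "t \<noteq> 1" "t \<noteq> - 3" using * t square_over_omega_values by auto
  ultimately show "\<exists>t. t \<noteq> 0 \<and> t \<noteq> 1 \<and> t \<noteq> - 3 \<and> d = t ^ 3" using t by blast
next
  assume "\<exists>t. t \<noteq> 0 \<and> t \<noteq> 1 \<and> t \<noteq> - 3 \<and> d = t ^ 3"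
  then obtain t where t: "t \<noteq> 1" "t \<noteq> - 3" "d = t ^ 3" by blast
  have "\<not> square_over_omega d"
    using square_over_omegaD(1)[OF _ t(3)] rat_cube_inj[of t 1] rat_cube_inj[of t "- 3"] t by auto
  then show "rat_cube d \<and> \<not> square_over_omega d" using t unfolding rat_cube_def by blast
qed

lemma rat_square_cases: "(t::rat) ^ 2 = u ^ 2 \<Longrightarrow> t = u \<or> t = - u"
  by (simp only: power2_eq_iff)

lemma square_not_cube_iff:
  "square_over_omega d \<and> \<not> rat_cube d \<longleftrightarrow>
    (\<exists>t. t \<noteq> 0 \<and> (d = t ^ 2 \<and> t \<notin> {1, - 1} \<or> d = - 3 * t ^ 2 \<and> t \<notin> {3, - 3}))"
proof
  assume *: "square_over_omega d \<and> \<not> rat_cube d"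
  then have "d \<notin> {1, - 27}" using square_and_cube_iff by blast
  with * d0 show "\<exists>t. t \<noteq> 0 \<and> (d = t ^ 2 \<and> t \<notin> {1, - 1} \<or> d = - 3 * t ^ 2 \<and> t \<notin> {3, - 3})"
    unfolding square_over_omega_def by fastforce
next
  assume "\<exists>t. t \<noteq> 0 \<and> (d = t ^ 2 \<and> t \<notin> {1, - 1} \<or> d = - 3 * t ^ 2 \<and> t \<notin> {3, - 3})"
  then obtain t where t: "d = t ^ 2 \<and> t \<notin> {1, - 1} \<or> d = - 3 * t ^ 2 \<and> t \<notin> {3, - 3}" by blast
  then have sq: "square_over_omega d" unfolding square_over_omega_def by blast
  have sign: "0 \<le> t ^ 2" by simp
  have "t ^ 2 \<noteq> 1" if "t \<notin> {1, - 1}" using that rat_square_cases[of t 1] by auto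
  moreover have "t ^ 2 \<noteq> 9" if "t \<notin> {3, - 3}" using that rat_square_cases[of t 3] by auto
  ultimately have "d \<noteq> 1" "d \<noteq> - 27"
    using t sign by linarith+
  then show "square_over_omega d \<and> \<not> rat_cube d" using sq square_and_cube_iff by blast
qed

lemma square_and_cube_up_to_3_iff: "square_over_omega d \<and> cube_up_to_3 d \<longleftrightarrow> d \<in> {1, - 3, 9, - 27, 81, - 243}"
proof
  assume *: "square_over_omega d \<and> cube_up_to_3 d"
  then have "cube_up_to_3 d" by blast
  then show "d \<in> {1, - 3, 9, - 27, 81, - 243}"
    using * by (cases rule: cube_up_to_3E) (use square_over_omegaD in auto)
next
  assume *: "d \<in> {1, - 3, 9, - 27, 81, - 243}"
  then have "d = 1 ^ 3 \<or> d = 3 * (- 1) ^ 3 \<or> d = 9 * 1 ^ 3 \<or> d = (- 3) ^ 3 \<or> d = 3 * 3 ^ 3 \<or> d = 9 * (- 3) ^ 3"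
    by simp
  then have "cube_up_to_3 d" using cube_up_to_3I by blast
  then show "square_over_omega d \<and> cube_up_to_3 d" using square_over_omega_values[OF *] by blast
qed

lemma cube_up_to_3_not_square_iff:
  "cube_up_to_3 d \<and> \<not> square_over_omega d \<longleftrightarrow>
    (\<exists>t. t \<noteq> 0 \<and> t \<noteq> 1 \<and> t \<noteq> - 3 \<and> (d = t ^ 3 \<or> d = 9 * t ^ 3)) \<or>
    (\<exists>t. t \<noteq> 0 \<and> t \<noteq> - 1 \<and> t \<noteq> 3 \<and> d = 3 * t ^ 3)"
    (is "?l \<longleftrightarrow> ?r")
proof
  assume *: ?l
  then have nv: "d \<notin> {1, - 3, 9, - 27, 81, - 243}" using square_over_omega_values by blast
  from * have "cube_up_to_3 d" by blast
  then show ?r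
  proof (cases rule: cube_up_to_3E)
    case (1 t)
    then have "t \<noteq> 0" "t \<noteq> 1" "t \<noteq> - 3" using d0 nv by auto
    then show ?thesis using 1 by blast
  next
    case (2 t)
    then have "t \<noteq> 0" "t \<noteq> - 1" "t \<noteq> 3" using d0 nv by auto
    then show ?thesis using 2 by blast
  next
    case (3 t)
    then have "t \<noteq> 0" "t \<noteq> 1" "t \<noteq> - 3" using d0 nv by auto
    then show ?thesis using 3 by blast
  qed
next
  assume ?r
  then consider t where "t \<noteq> 1" "t \<noteq> - 3" "d = t ^ 3" | t where "t \<noteq> 1" "t \<noteq> - 3" "d = 9 * t ^ 3"
    | t where "t \<noteq> - 1" "t \<noteq> 3" "d = 3 * t ^ 3"
    by blast
  then show ?l
  proof cases
    case (1 t)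
    then show ?thesis using square_over_omegaD(1)[OF _ 1(3)] rat_cube_inj[of t 1] rat_cube_inj[of t "- 3"] cube_up_to_3I by auto
  next
    case (2 t)
    then show ?thesis using square_over_omegaD(3)[OF _ 2(3)] rat_cube_inj[of t 1] rat_cube_inj[of t "- 3"] cube_up_to_3I by auto
  next
    case (3 t)
    then show ?thesis using square_over_omegaD(2)[OF _ 3(3)] rat_cube_inj[of t "- 1"] rat_cube_inj[of t 3] cube_up_to_3I by auto
  qed
qed

lemma square_not_cube_up_to_3_iff:
  "square_over_omega d \<and> \<not> cube_up_to_3 d \<longleftrightarrow>
    (\<exists>t. t \<noteq> 0 \<and> t \<notin> {1, - 1, 3, - 3, 9, - 9} \<and> (d = t ^ 2 \<or> d = - 3 * t ^ 2))"
proof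
  assume *: "square_over_omega d \<and> \<not> cube_up_to_3 d"
  then have nv: "d \<notin> {1, - 3, 9, - 27, 81, - 243}" using square_and_cube_up_to_3_iff by blast
  from * obtain t where t: "d = t ^ 2 \<or> d = - 3 * t ^ 2" unfolding square_over_omega_def by blast
  have "t \<noteq> 0" "t \<notin> {1, - 1, 3, - 3, 9, - 9}" using t nv d0 by auto
  then show "\<exists>t. t \<noteq> 0 \<and> t \<notin> {1, - 1, 3, - 3, 9, - 9} \<and> (d = t ^ 2 \<or> d = - 3 * t ^ 2)" using t by blast
next
  assume "\<exists>t. t \<noteq> 0 \<and> t \<notin> {1, - 1, 3, - 3, 9, - 9} \<and> (d = t ^ 2 \<or> d = - 3 * t ^ 2)"
  then obtain t where t: "t \<notin> {1, - 1, 3, - 3, 9, - 9}" "d = t ^ 2 \<or> d = - 3 * t ^ 2" by blast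
  then have sq: "square_over_omega d" unfolding square_over_omega_def by blast
  have sign: "0 \<le> t ^ 2" by simp
  have "t ^ 2 \<noteq> 1" "t ^ 2 \<noteq> 9" "t ^ 2 \<noteq> 81"
    using t(1) rat_square_cases[of t 1] rat_square_cases[of t 3] rat_square_cases[of t 9] by auto
  then have "d \<noteq> 1" "d \<noteq> - 3" "d \<noteq> 9" "d \<noteq> - 27" "d \<noteq> 81" "d \<noteq> - 243"
    using t(2) sign by linarith+
  then have "d \<notin> {1, - 3, 9, - 27, 81, - 243}" by blast
  then show "square_over_omega d \<and> \<not> cube_up_to_3 d" using sq square_and_cube_up_to_3_iff by blast
qed

end

section \<open>Fields and degrees\<close>

lemma complex_root_exists: "n > 0 \<Longrightarrow> \<exists>z::complex. z ^ n = w"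
  by (rule exI[of _ "rcis (root n (cmod w)) (Arg w / real n)"])
     (simp add: DeMoivre2 rcis_cmod_Arg)

lemma omega_exists: "\<exists>\<omega>::complex. \<omega> ^ 2 + \<omega> + 1 = 0"
proof -
  define r where "r = csqrt (- 3)"
  have "r ^ 2 = - 3" unfolding r_def by (rule power2_csqrt)
  moreover have "((r - 1) / 2) ^ 2 + (r - 1) / 2 + 1 = (r ^ 2 + 3) / 4"
    by (simp add: power2_eq_square field_simps)
  ultimately show ?thesis by (intro exI[of _ "(r - 1) / 2"]) simp
qed

text \<open>
  \<open>\<zeta>\<close> is rational over \<open>\<zeta>\<^sup>3\<close> and \<open>w = \<zeta> + \<zeta>\<^sup>-\<^sup>1\<close>, since \<open>\<zeta>\<^sup>2 = w \<zeta> - 1\<close> gives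
  \<open>\<zeta>\<^sup>3 = (w\<^sup>2 - 1) \<zeta> - w\<close>.
\<close>
lemma zeta_in_adjoin:
  assumes K: "subfield K CC" and \<zeta>: "(\<zeta> ^ 3) ^ 2 + \<zeta> ^ 3 + 1 = 0"
    and mem: "\<zeta> ^ 3 \<in> K" "\<zeta> + inverse \<zeta> \<in> K"
  shows "\<zeta> \<in> K"
proof -
  note cl = subfield_closed[OF K]
  have "\<zeta> \<noteq> 0" using \<zeta> by auto
  then have i: "\<zeta> * inverse \<zeta> = 1" by simp
  define w where "w = \<zeta> + inverse \<zeta>"
  have eq: "(w ^ 2 - 1) * \<zeta> = \<zeta> ^ 3 + w" unfolding w_def using i by Groebner_Basis.algebra
  have "w ^ 2 - 1 \<noteq> 0"
  proof
    assume "w ^ 2 - 1 = 0"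
    then have "w ^ 2 = 1" "w = - (\<zeta> ^ 3)" using eq by (auto simp: add_eq_0_iff2)
    then have "(\<zeta> ^ 3) ^ 2 = 1" by simp
    then show False using \<zeta> by Groebner_Basis.algebra
  qed
  then have "\<zeta> = (\<zeta> ^ 3 + w) / (w ^ 2 - 1)" using eq by (simp add: eq_divide_eq mult.commute)
  also have "\<dots> \<in> K"
    by (rule cl(8)[OF cl(3)[OF mem(1)] cl(7)[OF cl(9) cl(1)]]) (simp_all add: w_def mem(2))
  finally show ?thesis .
qed

theorem degree_division_field_3:
  assumes "d \<noteq> 0"
  shows "degree_over_rat (Ed_division_field d 3) n \<longleftrightarrow>
    n = 2 * (if square_over_omega d then 1 else 2) * (if rat_cube d then 1 else 3)"
proof -
  obtain \<omega> s :: complex where "\<omega> ^ 2 + \<omega> + 1 = 0" "s ^ 6 = of_rat d"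
    using omega_exists complex_root_exists[of 6 "of_rat d"] by auto
  from division_field_3[OF assms this(2,1)] degree_3[OF this(1) assms this(2)] show ?thesis
    by (intro degree_unique) simp
qed

theorem degree_division_field_9:
  assumes "d \<noteq> 0"
  shows "degree_over_rat (Ed_division_field d 9) n \<longleftrightarrow>
    n = 18 * (if square_over_omega d then 1 else 2) * (if cube_up_to_3 d then 1 else 3)"
proof -
  obtain \<omega> s c \<zeta> :: complex where \<omega>: "\<omega> ^ 2 + \<omega> + 1 = 0" and s: "s ^ 6 = of_rat d"
    and c: "c ^ 3 = 3" and \<zeta>: "\<zeta> ^ 3 = \<omega>"
    using omega_exists complex_root_exists[of 6 "of_rat d"] complex_root_exists[of 3] by (metis zero_less_numeral)
  have \<zeta>': "(\<zeta> ^ 3) ^ 2 + \<zeta> ^ 3 + 1 = 0" using \<omega> \<zeta> by simp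
  define w where "w = \<zeta> + inverse \<zeta>"
  have w: "w ^ 3 - 3 * w + 1 = 0" unfolding w_def by (rule cyclotomic_cubic[OF \<zeta>'])
  have "adjoin_rat {\<omega>, s, c, w} = adjoin_rat {\<omega>, s, c, \<zeta>}"
  proof (rule adjoin_rat_eqI)
    have m: "\<omega> \<in> adjoin_rat {\<omega>, s, c, w}" "s \<in> adjoin_rat {\<omega>, s, c, w}" "c \<in> adjoin_rat {\<omega>, s, c, w}"
      "w \<in> adjoin_rat {\<omega>, s, c, w}" using subset_adjoin_rat[of "{\<omega>, s, c, w}"] by auto
    then have "\<zeta> \<in> adjoin_rat {\<omega>, s, c, w}"
      using zeta_in_adjoin[OF subfield_adjoin_rat \<zeta>'] \<zeta> by (simp add: w_def)
    then show "{\<omega>, s, c, \<zeta>} \<subseteq> adjoin_rat {\<omega>, s, c, w}" using m by auto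
    have m: "\<omega> \<in> adjoin_rat {\<omega>, s, c, \<zeta>}" "s \<in> adjoin_rat {\<omega>, s, c, \<zeta>}" "c \<in> adjoin_rat {\<omega>, s, c, \<zeta>}"
      "\<zeta> \<in> adjoin_rat {\<omega>, s, c, \<zeta>}" using subset_adjoin_rat[of "{\<omega>, s, c, \<zeta>}"] by auto
    then have "w \<in> adjoin_rat {\<omega>, s, c, \<zeta>}"
      unfolding w_def by (intro subfield_add subfield_inverse subfield_adjoin_rat)
    then show "{\<omega>, s, c, w} \<subseteq> adjoin_rat {\<omega>, s, c, \<zeta>}" using m by auto
  qed
  with division_field_9[OF assms s \<omega> w c] degree_9[OF \<omega> assms s c \<zeta>] show ?thesis
    by (intro degree_unique) (simp add: mult.assoc mult.left_commute)
qed

theorem proposition3p13: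
  fixes d :: rat
  assumes "d \<noteq> 0" and "rat_power_free 6 (16 * d)"
  shows
    "(\<forall>\<zeta>3 s :: complex. primitive_root_of_unity 3 \<zeta>3 \<and> s ^ 6 = of_rat d \<longrightarrow>
        Ed_division_field d 3 = adjoin_rat {\<zeta>3, s})
   \<and> (\<forall>\<zeta>3 \<zeta>9 s c :: complex.
        primitive_root_of_unity 3 \<zeta>3 \<and> primitive_root_of_unity 9 \<zeta>9 \<and>
        s ^ 6 = of_rat d \<and> c ^ 3 = 3 \<longrightarrow>
        Ed_division_field d 9 = adjoin_rat {\<zeta>3, s, c, \<zeta>9 + inverse \<zeta>9})
   \<and> (degree_over_rat (Ed_division_field d 3) 2 \<longleftrightarrow> d \<in> {1, -27})
   \<and> (degree_over_rat (Ed_division_field d 3) 4 \<longleftrightarrow>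
        (\<exists>t. t \<noteq> 0 \<and> t \<noteq> 1 \<and> t \<noteq> -3 \<and> d = t ^ 3))
   \<and> (degree_over_rat (Ed_division_field d 3) 6 \<longleftrightarrow>
        (\<exists>t. t \<noteq> 0 \<and> (d = t ^ 2 \<and> t \<notin> {1, -1} \<or> d = -3 * t ^ 2 \<and> t \<notin> {3, -3})))
   \<and> (degree_over_rat (Ed_division_field d 3) 12 \<longleftrightarrow>
        \<not> (d \<in> {1, -27}
          \<or> (\<exists>t. t \<noteq> 0 \<and> t \<noteq> 1 \<and> t \<noteq> -3 \<and> d = t ^ 3)
          \<or> (\<exists>t. t \<noteq> 0 \<and> (d = t ^ 2 \<and> t \<notin> {1, -1} \<or> d = -3 * t ^ 2 \<and> t \<notin> {3, -3}))))
   \<and> (degree_over_rat (Ed_division_field d 9) 18 \<longleftrightarrow> d \<in> {1, -3, 9, -27, 81, -243})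
   \<and> (degree_over_rat (Ed_division_field d 9) 36 \<longleftrightarrow>
        (\<exists>t. t \<noteq> 0 \<and> t \<noteq> 1 \<and> t \<noteq> -3 \<and> (d = t ^ 3 \<or> d = 9 * t ^ 3))
        \<or> (\<exists>t. t \<noteq> 0 \<and> t \<noteq> -1 \<and> t \<noteq> 3 \<and> d = 3 * t ^ 3))
   \<and> (degree_over_rat (Ed_division_field d 9) 54 \<longleftrightarrow>
        (\<exists>t. t \<noteq> 0 \<and> t \<notin> {1, -1, 3, -3, 9, -9} \<and> (d = t ^ 2 \<or> d = -3 * t ^ 2)))
   \<and> (degree_over_rat (Ed_division_field d 9) 108 \<longleftrightarrow>
        \<not> (d \<in> {1, -3, 9, -27, 81, -243}
          \<or> (\<exists>t. t \<noteq> 0 \<and> t \<noteq> 1 \<and> t \<noteq> -3 \<and> (d = t ^ 3 \<or> d = 9 * t ^ 3))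
          \<or> (\<exists>t. t \<noteq> 0 \<and> t \<noteq> -1 \<and> t \<noteq> 3 \<and> d = 3 * t ^ 3)
          \<or> (\<exists>t. t \<noteq> 0 \<and> t \<notin> {1, -1, 3, -3, 9, -9} \<and> (d = t ^ 2 \<or> d = -3 * t ^ 2))))"
proof -
  note iffs = square_and_cube_iff[OF assms, symmetric] cube_not_square_iff[OF assms, symmetric]
    square_not_cube_iff[OF assms, symmetric] square_and_cube_up_to_3_iff[OF assms, symmetric]
    cube_up_to_3_not_square_iff[OF assms, symmetric] square_not_cube_up_to_3_iff[OF assms, symmetric]
  have fields: "\<forall>\<zeta>3 s :: complex. primitive_root_of_unity 3 \<zeta>3 \<and> s ^ 6 = of_rat d \<longrightarrow>
        Ed_division_field d 3 = adjoin_rat {\<zeta>3, s}"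
    "\<forall>\<zeta>3 \<zeta>9 s c :: complex.
        primitive_root_of_unity 3 \<zeta>3 \<and> primitive_root_of_unity 9 \<zeta>9 \<and>
        s ^ 6 = of_rat d \<and> c ^ 3 = 3 \<longrightarrow>
        Ed_division_field d 9 = adjoin_rat {\<zeta>3, s, c, \<zeta>9 + inverse \<zeta>9}"
    using division_field_3[OF assms(1) _ primitive_root_3]
      division_field_9[OF assms(1) _ primitive_root_3 cyclotomic_cubic[OF primitive_root_9]]
    by blast+
  have three: "degree_over_rat (Ed_division_field d 3) 2 \<longleftrightarrow> square_over_omega d \<and> rat_cube d"
    "degree_over_rat (Ed_division_field d 3) 4 \<longleftrightarrow> rat_cube d \<and> \<not> square_over_omega d"
    "degree_over_rat (Ed_division_field d 3) 6 \<longleftrightarrow> square_over_omega d \<and> \<not> rat_cube d"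
    "degree_over_rat (Ed_division_field d 3) 12 \<longleftrightarrow>
       \<not> (square_over_omega d \<and> rat_cube d \<or> rat_cube d \<and> \<not> square_over_omega d \<or> square_over_omega d \<and> \<not> rat_cube d)"
    unfolding degree_division_field_3[OF assms(1)] by (auto split: if_splits)
  have nine: "degree_over_rat (Ed_division_field d 9) 18 \<longleftrightarrow> square_over_omega d \<and> cube_up_to_3 d"
    "degree_over_rat (Ed_division_field d 9) 36 \<longleftrightarrow> cube_up_to_3 d \<and> \<not> square_over_omega d"
    "degree_over_rat (Ed_division_field d 9) 54 \<longleftrightarrow> square_over_omega d \<and> \<not> cube_up_to_3 d"
    "degree_over_rat (Ed_division_field d 9) 108 \<longleftrightarrow>
       \<not> (square_over_omega d \<and> cube_up_to_3 d \<or> (cube_up_to_3 d \<and> \<not> square_over_omega d) \<or> square_over_omega d \<and> \<not> cube_up_to_3 d)"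
    unfolding degree_division_field_9[OF assms(1)] by (auto split: if_splits)
  show ?thesis
    unfolding disj_assoc[symmetric]
    apply (intro conjI fields)
    subgoal unfolding three(1) by (rule square_and_cube_iff[OF assms])
    subgoal unfolding three(2) by (rule cube_not_square_iff[OF assms])
    subgoal unfolding three(3) by (rule square_not_cube_iff[OF assms])
    subgoal unfolding three(4) iffs disj_assoc ..
    subgoal unfolding nine(1) by (rule square_and_cube_up_to_3_iff[OF assms])
    subgoal unfolding nine(2) by (rule cube_up_to_3_not_square_iff[OF assms])
    subgoal unfolding nine(3) by (rule square_not_cube_up_to_3_iff[OF assms])
    subgoal unfolding nine(4)
      using square_and_cube_up_to_3_iff[OF assms] cube_up_to_3_not_square_iff[OF assms] square_not_cube_up_to_3_iff[OF assms]
      by blast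
    done
qed

end
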